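(* Let $\mathbb{F}$ be a finite field of characteristic $p>2$, $r\ge2$, $t\ge 2$, let $V_1$ be a $t$-dimensional $\mathbb{F}$-space and $V=V_1^{\otimes r}=V_1\otimes\cdots\otimes V_r$ (each $V_i$ a copy of $V_1$), and let $H=\mathrm{GL}(V_1)\wr\mathrm{S}_r\le\mathrm{GL}(V)$ be the stabiliser of this tensor decomposition (base group acting factorwise, $\mathrm{S}_r$ permuting the factors). (i) If $r>2$, then $L^2V$ is a reducible $H$-module, and the minimum dimension of a non-zero quotient of $L^2V$ by an $H$-submodule is $\binom t2^r$ if $r$ is odd and $r\binom t2^{r-1}\binom{t+1}2$ if $r$ is even. (ii) If $p>3$ and $r=2$, then $L^2V$ is an irreducible $H$-module and $L^3V$ is a reducible $H$-module; the minimum dimension of a non-zero quotient of $L^3V$ by an $H$-submodule is $4$ if $t=2$, and $(t+1)t^2(t-1)^2(t-2)/9$ if $t>2$.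
   Context: $L^nV$ is the $n$th Lie power of $V$: with $[u,v]=u\otimes v-v\otimes u$ in the tensor algebra of $V$, $L(V)$ is the closure of $V$ under the bracket and $L^nV=V^{\otimes n}\cap L(V)$, with diagonal action of $\mathrm{GL}(V)$ (hence of $H$). $L^2V=A^2V$. *)

theory Defs
  imports Main "HOL.Vector_Spaces" "HOL-Combinatorics.Permutations" "HOL-Library.Function_Algebras"
begin

(* V_1 = F^t with basis e_0..e_{t-1}; V = V_1^{\<otimes> r} has basis e_w, w a word of length r over {..<t}. *)
definition basisV :: "nat \<Rightarrow> nat \<Rightarrow> nat list set" where
  "basisV t r = {w. length w = r \<and> (\<forall>i\<in>set w. i < t)}"

(* Tensor algebra T(V): finitely supported coefficient functions on words of basis vectors of V
   (the word ws = [w1,...,wn] stands for e_{w1} \<otimes> ... \<otimes> e_{wn}). *)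
definition tensalg :: "nat \<Rightarrow> nat \<Rightarrow> (nat list list \<Rightarrow> 'a::field) set" where
  "tensalg t r = {x. finite {ws. x ws \<noteq> 0} \<and> (\<forall>ws. x ws \<noteq> 0 \<longrightarrow> set ws \<subseteq> basisV t r)}"

definition homog :: "nat \<Rightarrow> nat \<Rightarrow> nat \<Rightarrow> (nat list list \<Rightarrow> 'a::field) set" where
  "homog t r n = {x \<in> tensalg t r. \<forall>ws. x ws \<noteq> 0 \<longrightarrow> length ws = n}"

definition fscale :: "'a::field \<Rightarrow> ('b \<Rightarrow> 'a) \<Rightarrow> ('b \<Rightarrow> 'a)" where
  "fscale c x = (\<lambda>ws. c * x ws)"

definition tmult :: "(nat list list \<Rightarrow> 'a::field) \<Rightarrow> (nat list list \<Rightarrow> 'a) \<Rightarrow> (nat list list \<Rightarrow> 'a)" where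
  "tmult x y = (\<lambda>ws. \<Sum>k\<le>length ws. x (take k ws) * y (drop k ws))"

definition lbr :: "(nat list list \<Rightarrow> 'a::field) \<Rightarrow> (nat list list \<Rightarrow> 'a) \<Rightarrow> (nat list list \<Rightarrow> 'a)" where
  "lbr x y = tmult x y - tmult y x"

inductive_set lieAlg :: "nat \<Rightarrow> nat \<Rightarrow> (nat list list \<Rightarrow> 'a::field) set" for t r where
  gen: "x \<in> homog t r 1 \<Longrightarrow> x \<in> lieAlg t r"
| zero: "0 \<in> lieAlg t r"
| add: "x \<in> lieAlg t r \<Longrightarrow> y \<in> lieAlg t r \<Longrightarrow> x + y \<in> lieAlg t r"
| smult: "x \<in> lieAlg t r \<Longrightarrow> fscale c x \<in> lieAlg t r"
| br: "x \<in> lieAlg t r \<Longrightarrow> y \<in> lieAlg t r \<Longrightarrow> lbr x y \<in> lieAlg t r"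

definition LiePow :: "nat \<Rightarrow> nat \<Rightarrow> nat \<Rightarrow> (nat list list \<Rightarrow> 'a::field) set" where
  "LiePow t r n = homog t r n \<inter> lieAlg t r"

definition inv_mat :: "nat \<Rightarrow> (nat \<Rightarrow> nat \<Rightarrow> 'a::field) \<Rightarrow> bool" where
  "inv_mat t A \<longleftrightarrow> (\<exists>B. (\<forall>i<t. \<forall>j<t. (\<Sum>k<t. A i k * B k j) = (if i = j then 1 else 0))
                      \<and> (\<forall>i<t. \<forall>j<t. (\<Sum>k<t. B i k * A k j) = (if i = j then 1 else 0)))"

(* matrix of the element (g_0,...,g_{r-1}) \<circ> sigma of GL(V_1) wr S_r acting on V:
   the factor permutation sends e_w to e_{w'} with w'!k = w!(sigma k)... composed with g_k on factor k *)
definition Hmat :: "nat \<Rightarrow> (nat \<Rightarrow> nat \<Rightarrow> nat \<Rightarrow> 'a::field) \<Rightarrow> (nat \<Rightarrow> nat) \<Rightarrow> nat list \<Rightarrow> nat list \<Rightarrow> 'a" where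
  "Hmat r g \<sigma> w' w = (\<Prod>k<r. g k (w' ! k) (w ! (\<sigma> k)))"

definition inH :: "nat \<Rightarrow> nat \<Rightarrow> (nat \<Rightarrow> nat \<Rightarrow> nat \<Rightarrow> 'a::field) \<Rightarrow> (nat \<Rightarrow> nat) \<Rightarrow> bool" where
  "inH t r g \<sigma> \<longleftrightarrow> (\<forall>k<r. inv_mat t (g k)) \<and> \<sigma> permutes {..<r}"

definition hact :: "nat \<Rightarrow> nat \<Rightarrow> (nat \<Rightarrow> nat \<Rightarrow> nat \<Rightarrow> 'a::field) \<Rightarrow> (nat \<Rightarrow> nat)
                    \<Rightarrow> (nat list list \<Rightarrow> 'a) \<Rightarrow> (nat list list \<Rightarrow> 'a)" where
  "hact t r g \<sigma> x = (\<lambda>vs. if set vs \<subseteq> basisV t r then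
      (\<Sum>ws\<in>{ws. length ws = length vs \<and> set ws \<subseteq> basisV t r}.
          (\<Prod>i<length vs. Hmat r g \<sigma> (vs ! i) (ws ! i)) * x ws)
    else 0)"

definition Hsubmod :: "nat \<Rightarrow> nat \<Rightarrow> nat \<Rightarrow> (nat list list \<Rightarrow> 'a::field) set \<Rightarrow> bool" where
  "Hsubmod t r n W \<longleftrightarrow> W \<subseteq> LiePow t r n \<and> module.subspace fscale W
     \<and> (\<forall>g \<sigma>. inH t r g \<sigma> \<longrightarrow> (\<forall>x\<in>W. hact t r g \<sigma> x \<in> W))"

definition Hirred :: "nat \<Rightarrow> nat \<Rightarrow> nat \<Rightarrow> 'a::field itself \<Rightarrow> bool" where
  "Hirred t r n (_ :: 'a itself) \<longleftrightarrow> (LiePow t r n :: (nat list list \<Rightarrow> 'a) set) \<noteq> {0}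
     \<and> (\<forall>W :: (nat list list \<Rightarrow> 'a) set. Hsubmod t r n W \<longrightarrow> W = {0} \<or> W = LiePow t r n)"

definition Hreducible :: "nat \<Rightarrow> nat \<Rightarrow> nat \<Rightarrow> 'a::field itself \<Rightarrow> bool" where
  "Hreducible t r n (_ :: 'a itself) \<longleftrightarrow> (\<exists>W :: (nat list list \<Rightarrow> 'a) set. Hsubmod t r n W \<and> W \<noteq> {0} \<and> W \<noteq> LiePow t r n)"

definition min_quot_dim :: "nat \<Rightarrow> nat \<Rightarrow> nat \<Rightarrow> 'a::field itself \<Rightarrow> nat \<Rightarrow> bool" where
  "min_quot_dim t r n (_ :: 'a itself) d \<longleftrightarrow>
     (\<exists>W :: (nat list list \<Rightarrow> 'a) set. Hsubmod t r n W \<and> W \<noteq> LiePow t r n \<and>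
        vector_space.dim fscale (LiePow t r n :: (nat list list \<Rightarrow> 'a) set) - vector_space.dim fscale W = d)
   \<and> (\<forall>W :: (nat list list \<Rightarrow> 'a) set. Hsubmod t r n W \<and> W \<noteq> LiePow t r n \<longrightarrow>
        d \<le> vector_space.dim fscale (LiePow t r n :: (nat list list \<Rightarrow> 'a) set) - vector_space.dim fscale W)"

end

theory Submission
  imports Defs "HOL-Library.FuncSet"
begin

text \<open>
  A basis word of \<open>V\<^sup>\<otimes>\<^sup>n\<close>, \<open>V = V\<^sub>1\<^sup>\<otimes>\<^sup>r\<close>, is an \<open>n \<times> r\<close> array of indices, and \<open>G = S\<^sub>n\<^sup>r\<close> permutes the entries of
  each column. Interpolation along lines of matrices over the finite field, followed by polarisation,
  shows that a \<open>GL(V\<^sub>1)\<^sup>r\<close>-submodule is stable under the full centraliser of \<open>G\<close>. Diagonal matrix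
  coefficients of the irreducible representations of \<open>S\<^sub>n\<close> provide idempotents in the group algebra of \<open>G\<close>,
  one for each assignment of a symmetry type to every column, and \<open>L\<^sup>nV\<close> is the image of an idempotent of the
  diagonal \<open>S\<^sub>n\<close>: the sign character for \<open>n = 2\<close>, a coefficient of the two-dimensional representation for
  \<open>n = 3\<close>. It follows that \<open>L\<^sup>nV\<close> is a multiplicity-free sum of pieces indexed by such assignments, that the
  submodules correspond to the sets of assignments stable under \<open>S\<^sub>r\<close>, and that the dimension of a piece is
  the number of arrays whose columns are in normal form. The pieces are those with an odd number of
  alternating columns for \<open>n = 2\<close>, and \<open>S\<^sup>3 \<otimes> L\<^sup>3\<close>, \<open>L\<^sup>3 \<otimes> S\<^sup>3\<close>, \<open>A\<^sup>3 \<otimes> L\<^sup>3\<close>, \<open>L\<^sup>3 \<otimes> A\<^sup>3\<close>, \<open>L\<^sup>3 \<otimes> L\<^sup>3\<close> for \<open>n = 3\<close>, \<open>r = 2\<close>.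
\<close>

text \<open>Over a small field the invertible matrices need not be dense on lines: a determinant can
  vanish at every point of a line, so singular matrices are not reached by choosing points in
  general position. The remedy: if \<open>Q\<close> denotes the action through one tensor factor in
  degree \<open>n\<close>, the sum of \<open>Q (A + c B)\<close> over all scalars \<open>c\<close>
  is a fixed multiple of \<open>Q B\<close>, whatever \<open>A\<close> is. Hence an auxiliary
  \<open>A\<close> whose whole line is invertible settles \<open>B\<close>, and on any other line in
  direction \<open>B\<close> the value at \<open>c = 0\<close> follows from the values at
  \<open>c \<noteq> 0\<close>. What the field must satisfy is the vanishing of its power sums of
  exponent below \<open>n\<close>. In degree three \<open>Mp\<close> and \<open>Mm\<close> lie in
  one irreducible representation, so orthogonality does not separate them. The index sets therefore
  contain at most one assignment per tuple of irreducibles, and the component at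
  \<open>ij Mm Mm\<close> has to be recovered from the one at \<open>ij Mp Mp\<close>. That one
  assignment suffices reflects that the Kronecker coefficients involved are all 1.\<close>

interpretation fs: vector_space fscale
  by unfold_locales (auto simp: fscale_def fun_eq_iff algebra_simps)

section \<open>Finite sums, Kronecker deltas and power sums over a finite field\<close>

lemma sum_fun_apply: "(\<Sum>a\<in>A. F a) x = (\<Sum>a\<in>A. F a x)"
  by (induction A rule: infinite_finite_induct) auto

lemma fscale_apply [simp]: "fscale c x w = c * x w"
  by (simp add: fscale_def)

lemma prod_if_eq:
  assumes "finite A"
  shows "(\<Prod>a\<in>A. if P a then (1::'a::field) else 0) = (if \<forall>a\<in>A. P a then 1 else 0)"
  using assms by (induction A) auto

lemma sum_mult_delta:
  fixes f :: "nat \<Rightarrow> 'a::field"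
  assumes "l < t"
  shows "(\<Sum>k<t. f k * (if k = l then 1 else 0)) = f l" "(\<Sum>k<t. f k * (if l = k then 1 else 0)) = f l"
    "(\<Sum>k<t. (if k = l then 1 else 0) * f k) = f l" "(\<Sum>k<t. (if l = k then 1 else 0) * f k) = f l"
proof -
  have "f k * (if k = l then 1 else 0) = (if k = l then f k else 0)"
    "f k * (if l = k then 1 else 0) = (if k = l then f k else 0)"
    "(if k = l then 1 else 0) * f k = (if k = l then f k else 0)"
    "(if l = k then 1 else 0) * f k = (if k = l then f k else 0)" for k by auto
  then show "(\<Sum>k<t. f k * (if k = l then 1 else 0)) = f l" "(\<Sum>k<t. f k * (if l = k then 1 else 0)) = f l"
    "(\<Sum>k<t. (if k = l then 1 else 0) * f k) = f l" "(\<Sum>k<t. (if l = k then 1 else 0) * f k) = f l"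
    using assms by simp_all
qed

text \<open>Substituting \<open>a * c\<close> for \<open>c\<close> permutes the field and multiplies
  the sum by \<open>a ^ k\<close>.\<close>

lemma sum_power_field_zero:
  fixes a :: "'a::{finite,field}"
  assumes "a \<noteq> 0" "a ^ k \<noteq> 1"
  shows "(\<Sum>c\<in>(UNIV::'a::{finite,field} set). c ^ k) = 0"
proof -
  have "bij (\<lambda>c::'a. a * c)"
    by (rule bijI[OF injI surjI[of _ "\<lambda>c. c / a"]]) (use assms in auto)
  then have "(\<Sum>c\<in>UNIV. c ^ k) = (\<Sum>c\<in>UNIV. (a * c) ^ k)"
    by (rule sum.reindex_bij_betw[symmetric])
  also have "\<dots> = a ^ k * (\<Sum>c\<in>UNIV. c ^ k)"
    by (simp add: power_mult_distrib sum_distrib_left)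
  finally show ?thesis using assms(2)
    by (metis mult_cancel_right1)
qed

text \<open>Translation by 1 permutes the field, so the sum of all elements equals itself plus the
  number of elements. This is the power sum of exponent 0.\<close>

lemma sum_one_field_zero: "(\<Sum>c\<in>(UNIV::'a::{finite,field} set). 1) = (0::'a)"
proof -
  have "bij (\<lambda>c::'a. c + 1)"
    by (rule bijI[OF injI surjI[of _ "\<lambda>c. c - 1"]]) auto
  then have "(\<Sum>c\<in>UNIV. c) = (\<Sum>c\<in>UNIV. c + (1::'a))"
    by (rule sum.reindex_bij_betw[symmetric])
  also have "\<dots> = (\<Sum>c\<in>UNIV. c) + (\<Sum>c\<in>(UNIV::'a set). 1)"
    by (rule sum.distrib)
  finally show ?thesis by simp
qed

text \<open>As a polynomial in \<open>c\<close> the product has degree at most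
  \<open>card A\<close>, and summation over the field kills every lower power. What remains is the
  top coefficient, which is independent of \<open>a\<close>. The power sum stays as a factor because
  it may itself be zero, as for exponent 3 over the field of five elements.\<close>

lemma sum_prod_line:
  fixes a b :: "'b \<Rightarrow> 'a::{finite,field}"
  assumes "finite A" "\<And>k. k < card A \<Longrightarrow> (\<Sum>c\<in>(UNIV::'a set). c ^ k) = 0"
  shows "(\<Sum>c\<in>UNIV. \<Prod>i\<in>A. a i + c * b i) = (\<Sum>c\<in>UNIV. c ^ card A) * (\<Prod>i\<in>A. b i)"
proof -
  have "(\<Sum>c\<in>UNIV. \<Prod>i\<in>A. a i + c * b i) =
     (\<Sum>c\<in>UNIV. \<Sum>B\<in>Pow A. (\<Prod>x\<in>B. a x) * (\<Prod>x\<in>A - B. b x) * c ^ card (A - B))"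
    by (simp add: prod_add assms(1) prod.distrib mult_ac)
  also have "\<dots> = (\<Sum>B\<in>Pow A. (\<Prod>x\<in>B. a x) * (\<Prod>x\<in>A - B. b x) * (\<Sum>c\<in>UNIV. c ^ card (A - B)))"
    by (subst sum.swap) (simp add: sum_distrib_left)
  also have "\<dots> = (\<Sum>B\<in>{{}}. (\<Prod>x\<in>B. a x) * (\<Prod>x\<in>A - B. b x) * (\<Sum>c\<in>UNIV. c ^ card (A - B)))"
  proof (rule sum.mono_neutral_right)
    show "\<forall>B\<in>Pow A - {{}}. (\<Prod>x\<in>B. a x) * (\<Prod>x\<in>A - B. b x) * (\<Sum>c\<in>(UNIV::'a set). c ^ card (A - B)) = 0"
    proof
      fix B assume B: "B \<in> Pow A - {{}}"
      then have "card (A - B) < card A"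
        using assms(1) by (intro psubset_card_mono) auto
      then show "(\<Prod>x\<in>B. a x) * (\<Prod>x\<in>A - B. b x) * (\<Sum>c\<in>(UNIV::'a set). c ^ card (A - B)) = 0"
        by (simp add: assms(2))
    qed
  qed (use assms in auto)
  finally show ?thesis by simp
qed

abbreviation Sn :: "nat \<Rightarrow> (nat \<Rightarrow> nat) set" where
  "Sn n \<equiv> {p. p permutes {..<n}}"

section \<open>Matrices\<close>

lemma inv_mat_mult:
  assumes "inv_mat t A" "inv_mat t B"
  shows "inv_mat t (\<lambda>i j. \<Sum>k<t. A i k * B k j)"
proof -
  obtain A' where A': "\<And>i j. i < t \<Longrightarrow> j < t \<Longrightarrow> (\<Sum>k<t. A i k * A' k j) = (if i = j then 1 else 0)"
    "\<And>i j. i < t \<Longrightarrow> j < t \<Longrightarrow> (\<Sum>k<t. A' i k * A k j) = (if i = j then 1 else 0)"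
    using assms(1) unfolding inv_mat_def by blast
  obtain B' where B': "\<And>i j. i < t \<Longrightarrow> j < t \<Longrightarrow> (\<Sum>k<t. B i k * B' k j) = (if i = j then 1 else 0)"
    "\<And>i j. i < t \<Longrightarrow> j < t \<Longrightarrow> (\<Sum>k<t. B' i k * B k j) = (if i = j then 1 else 0)"
    using assms(2) unfolding inv_mat_def by blast
  have gen: "(\<Sum>k<t. (\<Sum>l<t. P i l * Q l k) * (\<Sum>m<t. Q' k m * P' m j)) = (if i = j then 1 else 0)"
    if Q: "\<And>i j. i < t \<Longrightarrow> j < t \<Longrightarrow> (\<Sum>k<t. Q i k * Q' k j) = (if i = j then 1 else 0)"
      and P: "\<And>i j. i < t \<Longrightarrow> j < t \<Longrightarrow> (\<Sum>k<t. P i k * P' k j) = (if i = j then 1 else 0)"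
      and ij: "i < t" "j < t" for P Q P' Q' :: "nat \<Rightarrow> nat \<Rightarrow> 'a" and i j
  proof -
    have "(\<Sum>k<t. (\<Sum>l<t. P i l * Q l k) * (\<Sum>m<t. Q' k m * P' m j)) =
      (\<Sum>k<t. \<Sum>l<t. \<Sum>m<t. P i l * P' m j * (Q l k * Q' k m))"
      unfolding sum_product by (intro sum.cong refl) (simp only: mult_ac)
    also have "\<dots> = (\<Sum>l<t. \<Sum>m<t. \<Sum>k<t. P i l * P' m j * (Q l k * Q' k m))"
      by (subst sum.swap, rule sum.cong[OF refl], rule sum.swap)
    also have "\<dots> = (\<Sum>l<t. \<Sum>m<t. P i l * P' m j * (if l = m then 1 else 0))"
      by (intro sum.cong refl) (simp add: sum_distrib_left[symmetric] Q)
    also have "\<dots> = (\<Sum>l<t. P i l * P' l j)"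
      by (intro sum.cong refl) (simp add: sum_mult_delta)
    finally show ?thesis using P ij by simp
  qed
  show ?thesis unfolding inv_mat_def
    by (rule exI[of _ "\<lambda>i j. \<Sum>k<t. B' i k * A' k j"])
      (use gen[OF B'(1) A'(1)] gen[OF A'(2) B'(2)] in auto)
qed

text \<open>Matrices are total functions on the naturals, but only the entries with indices below
  \<open>t\<close> describe the linear map.\<close>

lemma inv_mat_cong:
  assumes "inv_mat t A" "\<And>i j. i < t \<Longrightarrow> j < t \<Longrightarrow> A i j = B i j"
  shows "inv_mat t B"
proof -
  from assms(1) obtain C where C: "\<forall>i<t. \<forall>j<t. (\<Sum>k<t. A i k * C k j) = (if i = j then 1 else 0)"
    "\<forall>i<t. \<forall>j<t. (\<Sum>k<t. C i k * A k j) = (if i = j then 1 else 0)"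
    unfolding inv_mat_def by blast
  show ?thesis unfolding inv_mat_def
    by (rule exI[of _ C]) (use C assms(2) in auto)
qed

lemma inv_mat_one: "inv_mat t (\<lambda>i j. if i = j then 1 else 0)"
  unfolding inv_mat_def
  by (rule exI[of _ "\<lambda>i j. if i = j then 1 else 0"]) (simp add: sum_mult_delta)

lemma sum_mult_column_change:
  fixes A :: "nat \<Rightarrow> nat \<Rightarrow> 'a::field"
  assumes "l < t"
  shows "(\<Sum>k<t. A i k * (if l = j then b k else if k = l then 1 else 0)) =
    (if l = j then \<Sum>k<t. A i k * b k else A i l)"
  using assms by (cases "l = j") (simp_all add: sum_mult_delta)

lemma inv_mat_column_change:
  fixes b :: "nat \<Rightarrow> 'a::field"
  assumes j: "j < t" and b: "b j \<noteq> 0"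
  shows "inv_mat t (\<lambda>k l. if l = j then b k else if k = l then 1 else 0)" (is "inv_mat t (?E b)")
proof -
  have gen: "(\<Sum>k<t. ?E b i k * ?E b' k l) = (if i = l then 1 else 0)"
    if "i < t" "l < t" "b j * b' j = 1" "\<And>k. k \<noteq> j \<Longrightarrow> b' k + b k * b' j = 0" for i l and b b' :: "nat \<Rightarrow> 'a"
  proof (cases "l = j")
    case True
    have "(\<Sum>k<t. ?E b i k * b' k) = (\<Sum>k<t. (if k = j then b i * b' j else 0) + (if k = i then (if i = j then 0 else b' i) else 0))"
      by (rule sum.cong) auto
    also have "\<dots> = b i * b' j + (if i = j then 0 else b' i)"
      using that j by (simp add: sum.distrib)
    finally show ?thesis using that True
      by (auto simp: algebra_simps)
  next
    case False
    then show ?thesis using that by (simp add: sum_mult_delta)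
  qed
  \<comment> \<open>The inverse is again an identity matrix with column \<open>j\<close> replaced;
    the side conditions of \<open>gen\<close> are the equations for that column.\<close>
  define b' where "b' k = (if k = j then 1 / b j else - b k / b j)" for k
  show ?thesis unfolding inv_mat_def
  proof (intro exI[of _ "?E b'"] conjI allI impI, goal_cases)
    case (1 i l) show ?case by (rule gen[OF 1]) (use b in \<open>auto simp: b'_def\<close>)
  next
    case (2 i l) show ?case by (rule gen[OF 2]) (use b in \<open>auto simp: b'_def\<close>)
  qed
qed

lemma inv_mat_swap:
  assumes "a < t" "b < t" "inv_mat t Y"
  shows "inv_mat t (\<lambda>i k. Y i (transpose a b k))"
proof -
  let ?P = "\<lambda>k l. if k = transpose a b l then (1::'a::field) else 0"
  have tr: "transpose a b k < t" if "k < t" for k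
    using that assms by (auto simp: transpose_def)
  have "inv_mat t ?P" unfolding inv_mat_def
    by (rule exI[of _ ?P]) (use tr in \<open>simp add: sum_mult_delta\<close>)
  from inv_mat_mult[OF assms(3) this] show ?thesis
    by (rule inv_mat_cong) (use tr in \<open>simp add: sum_mult_delta\<close>)
qed

text \<open>The new column is \<open>Y\<close> applied to \<open>b\<close>. Its coordinate along the
  old column \<open>j\<close> is \<open>b j\<close>, so \<open>b j \<noteq> 0\<close> keeps it
  independent of the other columns of \<open>Y\<close>.\<close>

lemma inv_mat_set_column:
  assumes "inv_mat t Y" "j < t" "b j \<noteq> 0"
  shows "inv_mat t (\<lambda>i l. if l = j then \<Sum>k<t. Y i k * b k else Y i l)"
  using inv_mat_mult[OF assms(1) inv_mat_column_change[where b = b, OF assms(2,3)]]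
  by (rule inv_mat_cong) (simp add: sum_mult_column_change)

text \<open>The columns of an invertible matrix are replaced one at a time. If the new column is dependent on the
  remaining ones, then adding a multiple \<open>c \<noteq> 0\<close> of the old one keeps them independent.\<close>
lemma matrix_line_induct:
  fixes P R :: "(nat \<Rightarrow> nat \<Rightarrow> 'a::field) \<Rightarrow> bool"
  assumes t: "t \<ge> 2" and inv: "\<And>Y. inv_mat t Y \<Longrightarrow> P Y"
    and R: "\<And>A B. (\<And>c. P (\<lambda>i j. A i j + c * B i j)) \<Longrightarrow> R B"
    and P: "\<And>A B. R B \<Longrightarrow> (\<And>c. c \<noteq> 0 \<Longrightarrow> P (\<lambda>i j. A i j + c * B i j)) \<Longrightarrow> P A"
  shows "P X"
proof -
  \<comment> \<open>The index \<open>j\<close> bounds the columns in which \<open>X\<close> may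
    differ from an invertible \<open>Y\<close>; for \<open>j = t\<close> and \<open>Y\<close> the
    identity this is no restriction.\<close>
  have main: "P X" if "j \<le> t" "inv_mat t Y" "\<And>i k. i < t \<Longrightarrow> j \<le> k \<Longrightarrow> k < t \<Longrightarrow> X i k = Y i k" for j X Y
    using that
  proof (induction j arbitrary: X Y)
    case 0
    then show ?case by (intro inv inv_mat_cong[of t Y X]) auto
  next
    case (Suc j)
    have j: "j < t" using Suc.prems by simp
    obtain i0 where i0: "i0 < t" "i0 \<noteq> j"
      using t that[of 0] that[of 1] by (cases "j = 0") auto
    define B where "B i k = (if k = j then Y i j else 0)" for i k
    have RB: "R B"
    proof (rule R)
      fix c :: 'a
      \<comment> \<open>\<open>A\<close> is \<open>Y\<close> with columns \<open>i0\<close> and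
        \<open>j\<close> exchanged. Then \<open>A + c B\<close> has the old column \<open>j\<close>
        at place \<open>i0\<close>, and the old column \<open>i0\<close> plus \<open>c\<close> times
        the old column \<open>j\<close> at place \<open>j\<close>, so it is invertible for every
        \<open>c\<close>. The second column is available because \<open>t \<ge> 2\<close>.\<close>
      define A where "A i k = Y i (transpose i0 j k)" for i k
      have A: "inv_mat t A" unfolding A_def by (rule inv_mat_swap[OF i0(1) j Suc.prems(2)])
      define b where "b k = (if k = j then 1 else if k = i0 then c else 0)" for k
      have "inv_mat t (\<lambda>i l. if l = j then \<Sum>k<t. A i k * b k else A i l)"
        by (rule inv_mat_set_column[OF A j]) (simp add: b_def)
      then have "inv_mat t (\<lambda>i k. A i k + c * B i k)"
      proof (rule inv_mat_cong)
        fix i l assume "i < t" "l < t"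
        have "(\<Sum>k<t. A i k * b k) = (\<Sum>k<t. (if k = j then A i k else 0) + (if k = i0 then c * A i k else 0))"
          using i0 by (intro sum.cong) (auto simp: b_def)
        also have "\<dots> = A i j + c * A i i0" using i0 j by (simp add: sum.distrib)
        finally show "(if l = j then \<Sum>k<t. A i k * b k else A i l) = A i l + c * B i l"
          by (auto simp: B_def A_def)
      qed
      then show "P (\<lambda>i k. A i k + c * B i k)" by (rule inv)
    qed
    obtain Z where Z: "\<And>i k. i < t \<Longrightarrow> k < t \<Longrightarrow> (\<Sum>l<t. Y i l * Z l k) = (if i = k then 1 else 0)"
      using Suc.prems(2) unfolding inv_mat_def by blast
    \<comment> \<open>These are the coordinates of column \<open>j\<close> of \<open>X\<close> in
      the columns of \<open>Y\<close>. Adding \<open>c B\<close> changes \<open>al j\<close> into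
      \<open>al j + c\<close>: if \<open>al j = 0\<close> then every \<open>c \<noteq> 0\<close> is
      good, otherwise \<open>c = 0\<close> is.\<close>
    define al where "al k = (\<Sum>l<t. Z k l * X l j)" for k
    have al: "(\<Sum>k<t. Y i k * al k) = X i j" if "i < t" for i
    proof -
      have "(\<Sum>k<t. Y i k * al k) = (\<Sum>l<t. (\<Sum>k<t. Y i k * Z k l) * X l j)"
        unfolding al_def sum_distrib_left sum_distrib_right by (subst sum.swap) (simp add: mult_ac)
      also have "\<dots> = X i j" using that by (simp add: Z if_distrib[of "\<lambda>a. a * _"] cong: if_cong)
      finally show ?thesis .
    qed
    have step: "P (\<lambda>i k. X i k + c * B i k)" if c: "al j + c \<noteq> 0" for c
    proof (rule Suc.IH)
      let ?b = "\<lambda>k. al k + (if k = j then c else 0)"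
      show "inv_mat t (\<lambda>i l. if l = j then \<Sum>k<t. Y i k * ?b k else Y i l)"
        by (rule inv_mat_set_column[OF Suc.prems(2) j]) (use c in simp)
      fix i k assume i: "i < t" and k: "j \<le> k" "k < t"
      have "(\<Sum>k<t. Y i k * ?b k) = (\<Sum>k<t. Y i k * al k + (if k = j then Y i k * c else 0))"
        by (rule sum.cong) (auto simp: algebra_simps)
      also have "\<dots> = X i j + c * Y i j" using j by (simp add: sum.distrib al[OF i])
      finally show "X i k + c * B i k = (if k = j then \<Sum>k<t. Y i k * ?b k else Y i k)"
        using i k Suc.prems(3)[of i k] by (auto simp: B_def)
    qed (use j in simp)
    show ?case
    proof (cases "al j = 0")
      case True
      then show ?thesis using P[OF RB, of X] step by simp
    next
      case False
      then show ?thesis using step[of 0] by simp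
    qed
  qed
  show ?thesis by (rule main[OF order_refl inv_mat_one]) auto
qed

section \<open>Words as families of columns\<close>

definition words :: "nat \<Rightarrow> nat \<Rightarrow> nat \<Rightarrow> nat list list set" where
  "words t r n = {ws. length ws = n \<and> set ws \<subseteq> basisV t r}"

text \<open>A word is stored by rows (the \<open>n\<close> tensor positions); \<open>mk\<close> builds it from its \<open>r\<close> columns.\<close>

definition mk :: "nat \<Rightarrow> nat \<Rightarrow> (nat \<Rightarrow> nat list) \<Rightarrow> nat list list" where
  "mk n r f = map (\<lambda>i. map (\<lambda>k. f k ! i) [0..<r]) [0..<n]"

definition column :: "nat \<Rightarrow> nat list list \<Rightarrow> nat list" where
  "column k vs = map (\<lambda>v. v ! k) vs"

text \<open>Columns with index at least \<open>r\<close> are left free, so updates and permutations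
  of columns stay inside. Sums run over \<open>PiE\<close> instead, which has exactly one
  representative for each word.\<close>

definition fam :: "nat \<Rightarrow> nat \<Rightarrow> nat \<Rightarrow> (nat \<Rightarrow> nat list) set" where
  "fam t r n = {f. \<forall>k<r. f k \<in> basisV t n}"

lemma basisV_iff: "c \<in> basisV t n \<longleftrightarrow> length c = n \<and> (\<forall>i<n. c ! i < t)"
  by (auto simp: basisV_def all_set_conv_all_nth)

lemma finite_basisV: "finite (basisV t r)"
proof -
  have "basisV t r = {xs. set xs \<subseteq> {..<t} \<and> length xs = r}" by (auto simp: basisV_def)
  then show ?thesis by (simp add: finite_lists_length_eq)
qed

lemma finite_words: "finite (words t r n)"
proof -
  have "words t r n = {xs. set xs \<subseteq> basisV t r \<and> length xs = n}" by (auto simp: words_def)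
  then show ?thesis by (simp add: finite_lists_length_eq finite_basisV)
qed

text \<open>There are finitely many words of length \<open>n\<close>, so the finite support demanded
  by \<open>tensalg\<close> is automatic.\<close>

lemma homog_iff: "x \<in> homog t r n \<longleftrightarrow> (\<forall>ws. x ws \<noteq> 0 \<longrightarrow> ws \<in> words t r n)"
proof
  assume "\<forall>ws. x ws \<noteq> 0 \<longrightarrow> ws \<in> words t r n"
  moreover from this have "finite {ws. x ws \<noteq> 0}"
    by (intro finite_subset[OF _ finite_words[of t r n]]) auto
  ultimately show "x \<in> homog t r n" by (auto simp: homog_def tensalg_def words_def)
qed (auto simp: homog_def tensalg_def words_def)

lemma homogD: "x \<in> homog t r n \<Longrightarrow> ws \<notin> words t r n \<Longrightarrow> x ws = 0"
  by (auto simp: homog_iff)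

lemma subspace_homog: "fs.subspace (homog t r n)"
proof (rule fs.subspaceI)
  fix x y :: "nat list list \<Rightarrow> 'a" assume "x \<in> homog t r n" "y \<in> homog t r n"
  then show "x + y \<in> homog t r n" unfolding homog_iff by (metis add_0 plus_fun_apply)
qed (auto simp: homog_iff)

lemma nth_mk: "i < n \<Longrightarrow> k < r \<Longrightarrow> mk n r f ! i ! k = f k ! i"
  by (simp add: mk_def)

lemma mk_cong: "(\<And>k. k < r \<Longrightarrow> f k = g k) \<Longrightarrow> mk n r f = mk n r g"
  by (simp add: mk_def)

lemma famD: "f \<in> fam t r n \<Longrightarrow> k < r \<Longrightarrow> f k \<in> basisV t n"
  by (simp add: fam_def)

lemma fam_length: "f \<in> fam t r n \<Longrightarrow> k < r \<Longrightarrow> length (f k) = n"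
  by (simp add: fam_def basisV_iff)

lemma column_mk: "k < r \<Longrightarrow> f \<in> fam t r n \<Longrightarrow> column k (mk n r f) = f k"
  by (rule nth_equalityI) (auto simp: column_def mk_def fam_length)

lemma mk_words: "f \<in> fam t r n \<Longrightarrow> mk n r f \<in> words t r n"
  by (auto simp: words_def mk_def fam_def basisV_iff)

lemma column_words: "vs \<in> words t r n \<Longrightarrow> k < r \<Longrightarrow> column k vs \<in> basisV t n"
  using nth_mem by (fastforce simp: words_def column_def basisV_iff)

lemma column_fam: "vs \<in> words t r n \<Longrightarrow> (\<lambda>k. column k vs) \<in> fam t r n"
  by (simp add: fam_def column_words)

lemma mk_column: "vs \<in> words t r n \<Longrightarrow> mk n r (\<lambda>k. column k vs) = vs"
proof (rule nth_equalityI)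
  assume vs: "vs \<in> words t r n"
  fix i assume "i < length (mk n r (\<lambda>k. column k vs))"
  then have i: "i < n" by (simp add: mk_def)
  then have "vs ! i \<in> basisV t r" "length vs = n" using vs by (auto simp: words_def dest: subsetD)
  then show "mk n r (\<lambda>k. column k vs) ! i = vs ! i"
    using i by (intro nth_equalityI) (auto simp: mk_def column_def basisV_iff)
qed (auto simp: mk_def words_def)

lemma mk_eq_iff: "f \<in> fam t r n \<Longrightarrow> g \<in> fam t r n \<Longrightarrow> mk n r f = mk n r g \<longleftrightarrow> (\<forall>k<r. f k = g k)"
  by (metis column_mk mk_cong)

lemma PiE_fam: "f \<in> PiE {..<r} (\<lambda>_. basisV t n) \<Longrightarrow> f \<in> fam t r n"
  by (auto simp: fam_def)

lemma bij_mk: "bij_betw (mk n r) (PiE {..<r} (\<lambda>_. basisV t n)) (words t r n)"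
proof (rule bij_betwI')
  fix f g assume *: "f \<in> PiE {..<r} (\<lambda>_. basisV t n)" "g \<in> PiE {..<r} (\<lambda>_. basisV t n)"
  show "mk n r f = mk n r g \<longleftrightarrow> f = g"
    using mk_eq_iff[OF PiE_fam[OF *(1)] PiE_fam[OF *(2)]] PiE_ext[OF *] by auto
next
  fix vs assume vs: "vs \<in> words t r n"
  have "mk n r (\<lambda>k\<in>{..<r}. column k vs) = mk n r (\<lambda>k. column k vs)"
    by (rule mk_cong) simp
  then show "\<exists>f\<in>PiE {..<r} (\<lambda>_. basisV t n). vs = mk n r f"
    using mk_column[OF vs] column_words[OF vs]
    by (intro bexI[of _ "\<lambda>k\<in>{..<r}. column k vs"]) auto
qed (simp add: mk_words PiE_fam)

lemma sum_words: "(\<Sum>ws\<in>words t r n. F ws) = (\<Sum>h\<in>PiE {..<r} (\<lambda>_. basisV t n). F (mk n r h))"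
  by (rule sum.reindex_bij_betw[OF bij_mk, symmetric])

lemma homog_eqI:
  assumes "x \<in> homog t r n" "y \<in> homog t r n"
    "\<And>f. f \<in> fam t r n \<Longrightarrow> x (mk n r f) = y (mk n r f)"
  shows "x = y"
proof
  fix vs show "x vs = y vs"
    using assms(3)[OF column_fam, of vs] homogD[OF assms(1), of vs] homogD[OF assms(2), of vs]
    by (cases "vs \<in> words t r n") (auto simp: mk_column)
qed

section \<open>The action of \<open>H\<close>\<close>

text \<open>The coefficient is a product over rows and columns; exchanging the two products leaves
  one factor per column. Column \<open>k\<close> of the output meets column
  \<open>\<sigma> k\<close> of the input.\<close>

lemma hact_mk:
  assumes f: "f \<in> fam t r n" and s: "\<sigma> permutes {..<r}"
  shows "hact t r g \<sigma> x (mk n r f) = (\<Sum>h\<in>PiE {..<r} (\<lambda>_. basisV t n).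
    (\<Prod>k<r. \<Prod>i<n. g k (f k ! i) (h (\<sigma> k) ! i)) * x (mk n r h))"
proof -
  have len: "length (mk n r h) = n" for h by (simp add: mk_def)
  have sk: "\<sigma> k < r" if "k < r" for k using permutes_in_image[OF s, of k] that by simp
  have "hact t r g \<sigma> x (mk n r f) = (\<Sum>ws\<in>words t r n. (\<Prod>i<n. Hmat r g \<sigma> (mk n r f ! i) (ws ! i)) * x ws)"
    using mk_words[OF f] by (simp add: hact_def words_def len)
  also have "\<dots> = (\<Sum>h\<in>PiE {..<r} (\<lambda>_. basisV t n). (\<Prod>i<n. \<Prod>k<r. g k (f k ! i) (h (\<sigma> k) ! i)) * x (mk n r h))"
    unfolding sum_words Hmat_def by (simp add: nth_mk sk)
  finally show ?thesis by (subst prod.swap)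
qed

lemma hact_homog:
  assumes "x \<in> homog t r n"
  shows "hact t r g \<sigma> x \<in> homog t r n"
  unfolding homog_iff
proof (intro allI impI)
  fix vs assume nz: "hact t r g \<sigma> x vs \<noteq> 0"
  then have s: "set vs \<subseteq> basisV t r" by (auto simp: hact_def split: if_splits)
  have "length vs = n"
  proof (rule ccontr)
    assume "length vs \<noteq> n"
    then have "x ws = 0" if "length ws = length vs" for ws
      using that assms by (auto simp: homog_iff words_def)
    then show False using nz by (simp add: hact_def s)
  qed
  then show "vs \<in> words t r n" using s by (simp add: words_def)
qed

text \<open>Only column \<open>m\<close> depends on \<open>c\<close>, through a product of
  \<open>n\<close> expressions linear in \<open>c\<close>, one for each row.\<close>

lemma hact_line:
  fixes x :: "nat list list \<Rightarrow> 'a::{finite,field}"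
  assumes pw: "\<And>k. k < n \<Longrightarrow> (\<Sum>c\<in>(UNIV::'a set). c ^ k) = 0"
    and x: "x \<in> homog t r n" and m: "m < r"
  shows "(\<Sum>c\<in>UNIV. hact t r (g(m := \<lambda>i j. A i j + c * B i j)) id x) =
    fscale (\<Sum>c\<in>UNIV. c ^ n) (hact t r (g(m := B)) id x)"
proof (rule homog_eqI)
  show "(\<Sum>c\<in>UNIV. hact t r (g(m := \<lambda>i j. A i j + c * B i j)) id x) \<in> homog t r n"
    by (intro fs.subspace_sum[OF subspace_homog] hact_homog[OF x])
  show "fscale (\<Sum>c\<in>UNIV. c ^ n) (hact t r (g(m := B)) id x) \<in> homog t r n"
    by (intro fs.subspace_scale[OF subspace_homog] hact_homog[OF x])
  fix f assume f: "f \<in> fam t r n"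
  let ?P = "PiE {..<r} (\<lambda>_. basisV t n)"
  define rest where "rest h = (\<Prod>k\<in>{..<r}-{m}. \<Prod>i<n. g k (f k ! i) (h k ! i))" for h
  have split: "(\<Prod>k<r. \<Prod>i<n. (g(m := X)) k (f k ! i) (h k ! i)) = (\<Prod>i<n. X (f m ! i) (h m ! i)) * rest h" for X h
    using m by (subst prod.remove[of _ m]) (auto simp: rest_def intro!: arg_cong2[where f = "(*)"] prod.cong)
  have "(\<Sum>c\<in>UNIV. hact t r (g(m := \<lambda>i j. A i j + c * B i j)) id x) (mk n r f)
    = (\<Sum>c\<in>UNIV. \<Sum>h\<in>?P. (\<Prod>i<n. A (f m ! i) (h m ! i) + c * B (f m ! i) (h m ! i)) * rest h * x (mk n r h))"
    unfolding sum_fun_apply hact_mk[OF f permutes_id] id_apply split ..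
  also have "\<dots> = (\<Sum>h\<in>?P. (\<Sum>c\<in>UNIV. \<Prod>i<n. A (f m ! i) (h m ! i) + c * B (f m ! i) (h m ! i)) * rest h * x (mk n r h))"
    by (subst sum.swap) (simp add: sum_distrib_right)
  also have "\<dots> = (\<Sum>h\<in>?P. (\<Sum>c\<in>UNIV. c ^ n) * (\<Prod>i<n. B (f m ! i) (h m ! i)) * rest h * x (mk n r h))"
    using pw by (subst sum_prod_line) auto
  also have "\<dots> = fscale (\<Sum>c\<in>UNIV. c ^ n) (hact t r (g(m := B)) id x) (mk n r f)"
    unfolding fscale_apply hact_mk[OF f permutes_id] id_apply split by (simp add: sum_distrib_left mult_ac)
  finally show "(\<Sum>c\<in>UNIV. hact t r (g(m := \<lambda>i j. A i j + c * B i j)) id x) (mk n r f) =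
    fscale (\<Sum>c\<in>UNIV. c ^ n) (hact t r (g(m := B)) id x) (mk n r f)" .
qed

text \<open>The factors are freed from invertibility one at a time, \<open>m\<close> counting those
  already arbitrary. In \<open>matrix_line_induct\<close> the predicate \<open>R\<close> is
  membership of the scaled image, so the argument survives when the scalar, a power sum, is
  zero.\<close>

lemma hact_all_matrices:
  fixes W :: "(nat list list \<Rightarrow> 'a::{finite,field}) set"
  assumes pw: "\<And>k. k < n \<Longrightarrow> (\<Sum>c\<in>(UNIV::'a set). c ^ k) = 0"
    and t: "t \<ge> 2" and W: "fs.subspace W" "W \<subseteq> homog t r n"
    and stable: "\<And>g x. (\<And>k. k < r \<Longrightarrow> inv_mat t (g k)) \<Longrightarrow> x \<in> W \<Longrightarrow> hact t r g id x \<in> W"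
    and x: "x \<in> W"
  shows "hact t r g id x \<in> W"
proof -
  have "hact t r g id x \<in> W" if "m \<le> r" "\<And>k. m \<le> k \<Longrightarrow> k < r \<Longrightarrow> inv_mat t (g k)" for m g
    using that
  proof (induction m arbitrary: g)
    case 0
    then show ?case by (intro stable x) auto
  next
    case (Suc m)
    have m: "m < r" using Suc.prems by simp
    have xh: "x \<in> homog t r n" using x W by auto
    let ?Q = "\<lambda>X. hact t r (g(m := X)) id x"
    have line: "(\<Sum>c\<in>UNIV. ?Q (\<lambda>i j. A i j + c * B i j)) = fscale (\<Sum>c\<in>UNIV. c ^ n) (?Q B)" for A B
      by (rule hact_line[OF _ xh m]) (rule pw)
    have "?Q (g m) \<in> W"
    proof (rule matrix_line_induct[OF t, where P = "\<lambda>X. ?Q X \<in> W"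
          and R = "\<lambda>B. fscale (\<Sum>c\<in>UNIV. c ^ n) (?Q B) \<in> W"], goal_cases)
      case (1 Y)
      then show ?case by (intro Suc.IH) (use Suc.prems in auto)
    next
      case (2 A B)
      then have "(\<Sum>c\<in>UNIV. ?Q (\<lambda>i j. A i j + c * B i j)) \<in> W" by (intro fs.subspace_sum[OF W(1)])
      then show ?case unfolding line .
    next
      case (3 A B)
      have "(\<Sum>c\<in>UNIV. ?Q (\<lambda>i j. A i j + c * B i j)) =
         ?Q (\<lambda>i j. A i j + 0 * B i j) + (\<Sum>c\<in>UNIV-{0}. ?Q (\<lambda>i j. A i j + c * B i j))"
        by (rule sum.remove) auto
      then have "?Q A = fscale (\<Sum>c\<in>UNIV. c ^ n) (?Q B) - (\<Sum>c\<in>UNIV-{0}. ?Q (\<lambda>i j. A i j + c * B i j))"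
        unfolding line by simp
      then show ?case using 3 by (auto intro!: fs.subspace_diff[OF W(1)] fs.subspace_sum[OF W(1)])
    qed
    then show ?case by (simp only: fun_upd_triv)
  qed
  from this[of r g] show ?thesis by linarith
qed

section \<open>Polarisation\<close>

lemma sum_Pow_minus_one:
  assumes "finite A"
  shows "(\<Sum>B\<in>Pow A. (-1) ^ card B) = (if A = {} then 1 else (0::'a::field))"
proof -
  have "(\<Sum>B\<in>Pow A. (-1) ^ card B) = (\<Sum>B\<in>Pow A. (\<Prod>x\<in>B. (-1::'a)) * (\<Prod>x\<in>A - B. 1))"
    by simp
  also have "\<dots> = (\<Prod>x\<in>A. (-1) + 1)" by (rule prod_add[symmetric, OF assms])
  finally show ?thesis using assms by auto
qed

lemma bij_betw_permutes_PiE: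
  "bij_betw (\<lambda>p. restrict p A) {p. p permutes A} {f \<in> PiE A (\<lambda>_. A). f ` A = A}" if "finite A"
proof (rule bij_betw_byWitness[where f' = "\<lambda>f k. if k \<in> A then f k else k"])
  show "(\<lambda>f k. if k \<in> A then f k else k) ` {f \<in> PiE A (\<lambda>_. A). f ` A = A} \<subseteq> {p. p permutes A}"
  proof clarify
    fix f assume f: "f \<in> PiE A (\<lambda>_. A)" "f ` A = A"
    have "inj_on f A" using f that by (simp add: eq_card_imp_inj_on)
    then have "bij_betw f A A" using f by (simp add: bij_betw_def)
    then have "bij_betw (\<lambda>k. if k \<in> A then f k else k) A A" by (subst bij_betw_cong[of A _ f]) auto
    then show "(\<lambda>k. if k \<in> A then f k else k) permutes A" by (rule bij_imp_permutes) auto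
  qed
  show "(\<lambda>p. restrict p A) ` {p. p permutes A} \<subseteq> {f \<in> PiE A (\<lambda>_. A). f ` A = A}"
    by (auto simp: permutes_in_image permutes_image)
  show "\<forall>p\<in>{p. p permutes A}. (\<lambda>k. if k \<in> A then restrict p A k else k) = p"
    by (auto simp: permutes_not_in fun_eq_iff)
  show "\<forall>f\<in>{f \<in> PiE A (\<lambda>_. A). f ` A = A}. restrict (\<lambda>k. if k \<in> A then f k else k) A = f"
  proof
    fix f assume "f \<in> {f \<in> PiE A (\<lambda>_. A). f ` A = A}"
    then have f: "f \<in> PiE A (\<lambda>_. A)" by simp
    show "restrict (\<lambda>k. if k \<in> A then f k else k) A = f"
      using PiE_arb[OF f] by (intro ext) (simp add: restrict_def)
  qed
qed

text \<open>Expanding the product gives all functions from \<open>{..<n}\<close> to itself;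
  inclusion-exclusion over the sets \<open>S\<close> containing the image retains the surjective
  ones, that is, the permutations. Applied to sums of matrix units over \<open>S\<close>, this
  isolates the symmetrised product of \<open>n\<close> possibly different units.\<close>

lemma ryser_permanent_formula:
  fixes y :: "nat \<Rightarrow> nat \<Rightarrow> 'a::field"
  shows "(\<Sum>S\<in>Pow {..<n}. (-1) ^ (n - card S) * (\<Prod>i<n. \<Sum>l\<in>S. y i l)) =
    (\<Sum>p\<in>Sn n. \<Prod>i<n. y i (p i))"
proof -
  let ?N = "{..<n}"
  let ?F = "PiE ?N (\<lambda>_. ?N)"
  have fin: "finite ?F" by (simp add: finite_PiE)
  have 1: "(\<Prod>i<n. \<Sum>l\<in>S. y i l) = (\<Sum>f\<in>?F. if f ` ?N \<subseteq> S then \<Prod>i<n. y i (f i) else 0)"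
    if "S \<in> Pow ?N" for S
  proof -
    have "finite S" using that finite_subset by auto
    then have "(\<Prod>i<n. \<Sum>l\<in>S. y i l) = (\<Sum>f\<in>PiE ?N (\<lambda>_. S). \<Prod>i<n. y i (f i))"
      by (intro prod_sum_PiE) auto
    also have "PiE ?N (\<lambda>_. S) = {f \<in> ?F. f ` ?N \<subseteq> S}" using that by (auto simp: PiE_iff extensional_def)
    also have "(\<Sum>f\<in>{f \<in> ?F. f ` ?N \<subseteq> S}. \<Prod>i<n. y i (f i)) = (\<Sum>f\<in>?F. if f ` ?N \<subseteq> S then \<Prod>i<n. y i (f i) else 0)"
      using fin by (rule sum.inter_filter)
    finally show ?thesis .
  qed
  have 2: "(\<Sum>S\<in>Pow ?N. (-1) ^ (n - card S) * (if R \<subseteq> S then z else 0)) = (if R = ?N then z else 0)"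
    if "R \<subseteq> ?N" for R and z :: 'a
  proof -
    have "(\<Sum>S\<in>Pow ?N. (-1) ^ (n - card S) * (if R \<subseteq> S then z else 0)) =
      (\<Sum>T\<in>Pow (?N - R). (-1) ^ card T * z)"
    proof -
      have "(\<Sum>S\<in>Pow ?N. (-1) ^ (n - card S) * (if R \<subseteq> S then z else 0)) =
        (\<Sum>S\<in>{S \<in> Pow ?N. R \<subseteq> S}. (-1) ^ (n - card S) * z)"
        by (subst sum.inter_filter) (auto intro: sum.cong)
      also have "\<dots> = (\<Sum>T\<in>Pow (?N - R). (-1) ^ card T * z)"
      proof (rule sum.reindex_bij_witness[where i = "\<lambda>T. ?N - T" and j = "\<lambda>S. ?N - S"])
        fix S assume "S \<in> {S \<in> Pow ?N. R \<subseteq> S}"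
        then have "card (?N - S) = n - card S"
          using card_Diff_subset[of S ?N] finite_subset[of S ?N] by auto
        then show "(-1) ^ card (?N - S) * z = (-1) ^ (n - card S) * z" by simp
      qed (use that in auto)
      finally show ?thesis .
    qed
    also have "\<dots> = (\<Sum>T\<in>Pow (?N - R). (-1) ^ card T) * z" by (simp add: sum_distrib_right)
    finally show ?thesis using that by (auto simp: sum_Pow_minus_one)
  qed
  have "(\<Sum>S\<in>Pow ?N. (-1) ^ (n - card S) * (\<Prod>i<n. \<Sum>l\<in>S. y i l)) =
    (\<Sum>S\<in>Pow ?N. \<Sum>f\<in>?F. (-1) ^ (n - card S) * (if f ` ?N \<subseteq> S then \<Prod>i<n. y i (f i) else 0))"
    by (intro sum.cong refl) (simp add: 1 sum_distrib_left)
  also have "\<dots> = (\<Sum>f\<in>?F. if f ` ?N = ?N then \<Prod>i<n. y i (f i) else 0)"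
    by (subst sum.swap) (intro sum.cong refl 2, auto)
  also have "\<dots> = (\<Sum>f\<in>{f \<in> ?F. f ` ?N = ?N}. \<Prod>i<n. y i (f i))"
    by (rule sum.inter_filter[OF fin, symmetric])
  also have "\<dots> = (\<Sum>p | p permutes ?N. \<Prod>i<n. y i (restrict p ?N i))"
    by (rule sum.reindex_bij_betw[OF bij_betw_permutes_PiE, symmetric]) simp
  finally show ?thesis by simp
qed

section \<open>Column permutations\<close>

text \<open>Components from \<open>r\<close> on are the identity, so that equality of functions is
  equality in the group and the set is finite.\<close>

definition PG :: "nat \<Rightarrow> nat \<Rightarrow> (nat \<Rightarrow> nat \<Rightarrow> nat) set" where
  "PG r n = {\<pi>. (\<forall>k<r. \<pi> k permutes {..<n}) \<and> (\<forall>k\<ge>r. \<pi> k = id)}"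

definition cact :: "(nat \<Rightarrow> nat \<Rightarrow> nat) \<Rightarrow> (nat \<Rightarrow> nat list) \<Rightarrow> nat \<Rightarrow> nat list" where
  "cact \<pi> f = (\<lambda>k. permute_list (\<pi> k) (f k))"

text \<open>\<open>cact\<close> is a right action on families of columns, so precomposition with it
  is a left action on coefficient functions. The value 0 off the words of the given shape keeps the
  result in \<open>homog\<close>.\<close>

definition Rop :: "nat \<Rightarrow> nat \<Rightarrow> nat \<Rightarrow> (nat \<Rightarrow> nat \<Rightarrow> nat) \<Rightarrow> (nat list list \<Rightarrow> 'a::field) \<Rightarrow> nat list list \<Rightarrow> 'a" where
  "Rop t r n \<pi> u = (\<lambda>vs. if vs \<in> words t r n then u (mk n r (cact \<pi> (\<lambda>k. column k vs))) else 0)"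

definition mulG :: "(nat \<Rightarrow> nat \<Rightarrow> nat) \<Rightarrow> (nat \<Rightarrow> nat \<Rightarrow> nat) \<Rightarrow> nat \<Rightarrow> nat \<Rightarrow> nat" where
  "mulG \<pi> \<rho> = (\<lambda>k. \<pi> k \<circ> \<rho> k)"

definition invG :: "(nat \<Rightarrow> nat \<Rightarrow> nat) \<Rightarrow> nat \<Rightarrow> nat \<Rightarrow> nat" where
  "invG \<pi> = (\<lambda>k. inv (\<pi> k))"

definition diagG :: "nat \<Rightarrow> (nat \<Rightarrow> nat) \<Rightarrow> nat \<Rightarrow> nat \<Rightarrow> nat" where
  "diagG r p = (\<lambda>k. if k < r then p else id)"

lemma PG_perm: "\<pi> \<in> PG r n \<Longrightarrow> \<pi> k permutes {..<n}"
  by (cases "k < r") (auto simp: PG_def)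

lemma mulG_PG: "\<pi> \<in> PG r n \<Longrightarrow> \<rho> \<in> PG r n \<Longrightarrow> mulG \<pi> \<rho> \<in> PG r n"
  by (auto simp: PG_def mulG_def intro: permutes_compose)

lemma invG_PG: "\<pi> \<in> PG r n \<Longrightarrow> invG \<pi> \<in> PG r n"
  by (auto simp: PG_def invG_def permutes_inv)

lemma diagG_PG: "p permutes {..<n} \<Longrightarrow> diagG r p \<in> PG r n"
  by (auto simp: PG_def diagG_def)

lemma invG_invG: "\<pi> \<in> PG r n \<Longrightarrow> invG (invG \<pi>) = \<pi>"
  by (auto simp: invG_def fun_eq_iff inv_inv_eq[OF permutes_bij[OF PG_perm]])

lemma mulG_assoc: "mulG (mulG a b) c = mulG a (mulG b c)"
  by (simp add: mulG_def o_assoc)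

lemma mulG_invG: "\<pi> \<in> PG r n \<Longrightarrow> mulG \<pi> (invG \<pi>) = (\<lambda>_. id)" "\<pi> \<in> PG r n \<Longrightarrow> mulG (invG \<pi>) \<pi> = (\<lambda>_. id)"
  by (auto simp: mulG_def invG_def permutes_inv_o[OF PG_perm] fun_eq_iff permutes_inverses[OF PG_perm])

lemma invG_mulG: "\<pi> \<in> PG r n \<Longrightarrow> \<rho> \<in> PG r n \<Longrightarrow> invG (mulG \<pi> \<rho>) = mulG (invG \<rho>) (invG \<pi>)"
  by (simp add: invG_def mulG_def o_inv_distrib permutes_bij[OF PG_perm])

lemma mulG_id [simp]: "mulG \<pi> (\<lambda>_. id) = \<pi>" "mulG (\<lambda>_. id) \<pi> = \<pi>"
  by (auto simp: mulG_def)

lemma cact_fam: "\<pi> \<in> PG r n \<Longrightarrow> f \<in> fam t r n \<Longrightarrow> cact \<pi> f \<in> fam t r n"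
  unfolding fam_def cact_def basisV_def
  using PG_perm[of \<pi> r n] by (auto simp: set_permute_list)

lemma cact_cact:
  assumes "\<rho> \<in> PG r n" "f \<in> fam t r n" "k < r"
  shows "cact \<rho> (cact \<pi> f) k = cact (mulG \<pi> \<rho>) f k"
  using assms by (simp add: cact_def mulG_def permute_list_compose PG_perm fam_length)

lemma Rop_mk: "f \<in> fam t r n \<Longrightarrow> Rop t r n \<pi> u (mk n r f) = u (mk n r (cact \<pi> f))"
  unfolding Rop_def by (auto simp: mk_words cact_def column_mk intro!: arg_cong[of _ _ u] mk_cong)

lemma Rop_homog: "Rop t r n \<pi> u \<in> homog t r n"
  by (auto simp: homog_iff Rop_def)

lemma Rop_Rop:
  assumes "\<pi> \<in> PG r n" "\<rho> \<in> PG r n"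
  shows "Rop t r n \<pi> (Rop t r n \<rho> u) = Rop t r n (mulG \<pi> \<rho>) u"
proof (rule homog_eqI[OF Rop_homog Rop_homog])
  fix f assume f: "f \<in> fam t r n"
  show "Rop t r n \<pi> (Rop t r n \<rho> u) (mk n r f) = Rop t r n (mulG \<pi> \<rho>) u (mk n r f)"
    by (simp add: Rop_mk f cact_fam[OF assms(1)] cact_cact[OF assms(2) f] cong: mk_cong)
qed

lemma Rop_add: "Rop t r n \<pi> (u + v) = Rop t r n \<pi> u + Rop t r n \<pi> v"
  and Rop_scale: "Rop t r n \<pi> (fscale c u) = fscale c (Rop t r n \<pi> u)"
  by (auto simp: Rop_def fun_eq_iff)

text \<open>The expansion of a product of sums for functions with a prescribed default outside the
  range. It serves \<open>PG\<close>, with default \<open>id\<close>, and the assignments of kinds,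
  with default \<open>Sy\<close>.\<close>

lemma sum_default_family_prod:
  fixes F :: "nat \<Rightarrow> 'b \<Rightarrow> 'a::comm_semiring_1"
  assumes "finite A"
  shows "(\<Sum>\<pi> | (\<forall>k<r. \<pi> k \<in> A) \<and> (\<forall>k\<ge>r. \<pi> k = d). \<Prod>k<r. F k (\<pi> k)) = (\<Prod>k<r. \<Sum>p\<in>A. F k p)"
proof -
  let ?P = "PiE {..<r} (\<lambda>_. A)"
  let ?D = "{\<pi>. (\<forall>k<r. \<pi> k \<in> A) \<and> (\<forall>k\<ge>r. \<pi> k = d)}"
  have "bij_betw (\<lambda>\<pi>. restrict \<pi> {..<r}) ?D ?P"
  proof (rule bij_betw_byWitness[where f' = "\<lambda>\<pi> k. if k < r then \<pi> k else d"])
    show "\<forall>\<pi>\<in>?D. (\<lambda>k. if k < r then restrict \<pi> {..<r} k else d) = \<pi>"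
      by (auto simp: fun_eq_iff)
    show "\<forall>\<pi>\<in>?P. restrict (\<lambda>k. if k < r then \<pi> k else d) {..<r} = \<pi>"
    proof
      fix \<pi> assume f: "\<pi> \<in> ?P"
      show "restrict (\<lambda>k. if k < r then \<pi> k else d) {..<r} = \<pi>"
        using PiE_arb[OF f] by (intro ext) (simp add: restrict_def)
    qed
    show "(\<lambda>\<pi>. restrict \<pi> {..<r}) ` ?D \<subseteq> ?P" by (auto split: if_splits)
    show "(\<lambda>\<pi> k. if k < r then \<pi> k else d) ` ?P \<subseteq> ?D"
    proof clarify
      fix \<pi> assume "\<pi> \<in> ?P"
      then have "\<pi> k \<in> A" if "k < r" for k using that by (auto dest: PiE_mem)
      then show "(\<forall>k<r. (if k < r then \<pi> k else d) \<in> A) \<and> (\<forall>k\<ge>r. (if k < r then \<pi> k else d) = d)" by simp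
    qed
  qed
  then have "(\<Sum>\<pi>\<in>?D. \<Prod>k<r. F k (restrict \<pi> {..<r} k)) = (\<Sum>\<pi>\<in>?P. \<Prod>k<r. F k (\<pi> k))"
    by (rule sum.reindex_bij_betw)
  also have "\<dots> = (\<Prod>k<r. \<Sum>p\<in>A. F k p)"
    by (rule prod_sum_PiE[symmetric]) (auto simp: assms)
  finally show ?thesis by simp
qed

lemma sum_PG_prod:
  fixes F :: "nat \<Rightarrow> (nat \<Rightarrow> nat) \<Rightarrow> 'a::comm_semiring_1"
  shows "(\<Sum>\<pi>\<in>PG r n. \<Prod>k<r. F k (\<pi> k)) = (\<Prod>k<r. \<Sum>p\<in>Sn n. F k p)"
  using sum_default_family_prod[of "Sn n" F r id] by (simp add: PG_def finite_permutations)

lemma finite_PG: "finite (PG r n)"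
proof -
  have "PG r n \<subseteq> (\<lambda>\<pi> k. if k < r then \<pi> k else id) ` PiE {..<r} (\<lambda>_. Sn n)"
    by (rule subsetI, rule_tac x = "restrict x {..<r}" in image_eqI) (simp_all add: PG_def fun_eq_iff restrict_PiE_iff)
  then show ?thesis by (rule finite_subset) (simp add: finite_PiE finite_permutations)
qed

lemma sum_PG_mul_left:
  assumes "\<rho> \<in> PG r n"
  shows "(\<Sum>\<pi>\<in>PG r n. F (mulG \<rho> \<pi>)) = (\<Sum>\<pi>\<in>PG r n. F \<pi>)"
  by (rule sum.reindex_bij_witness[where i = "mulG (invG \<rho>)" and j = "mulG \<rho>"])
    (use assms in \<open>auto simp: mulG_PG invG_PG mulG_assoc[symmetric] mulG_invG\<close>)

lemma sum_PG_mul_right: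
  assumes "\<rho> \<in> PG r n"
  shows "(\<Sum>\<pi>\<in>PG r n. F (mulG \<pi> \<rho>)) = (\<Sum>\<pi>\<in>PG r n. F \<pi>)"
  by (rule sum.reindex_bij_witness[where i = "\<lambda>\<pi>. mulG \<pi> (invG \<rho>)" and j = "\<lambda>\<pi>. mulG \<pi> \<rho>"])
    (use assms in \<open>auto simp: mulG_PG invG_PG mulG_assoc mulG_invG\<close>)

lemma sum_PG_inv: "(\<Sum>\<pi>\<in>PG r n. F (invG \<pi>)) = (\<Sum>\<pi>\<in>PG r n. F \<pi>)"
  by (rule sum.reindex_bij_witness[where i = invG and j = invG]) (auto simp: invG_PG invG_invG)

lemma permute_list_eq_iff:
  assumes "length c = n" "length a = n" "p permutes {..<n}"
  shows "(\<forall>i<n. c ! i = a ! p i) \<longleftrightarrow> c = permute_list p a"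
  using assms by (auto simp: permute_list_def list_eq_iff_nth_eq)

lemma permute_list_inv_iff:
  assumes "length c = n" "length a = n" "p permutes {..<n}"
  shows "c = permute_list p a \<longleftrightarrow> a = permute_list (inv p) c"
proof -
  have 1: "permute_list p (permute_list (inv p) c) = c" "permute_list (inv p) (permute_list p a) = a"
    using assms permute_list_compose[of p c "inv p"] permute_list_compose[of "inv p" a p]
    by (auto simp: permutes_inv_o permutes_inv)
  then show ?thesis by metis
qed

text \<open>The matrix in factor \<open>k\<close> is the sum over \<open>l\<close> in
  \<open>S k\<close> of the units sending basis index \<open>b k ! l\<close> to
  \<open>a k ! l\<close>. By \<open>ryser_permanent_formula\<close> the alternating sum over
  \<open>S\<close> is the symmetrised product of these units, and letting \<open>a\<close> run with
  weight \<open>u\<close> replaces the target word by an arbitrary tensor.\<close>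

lemma symmetrised_unit_value:
  fixes x u :: "nat list list \<Rightarrow> 'a::field"
  assumes b: "b \<in> fam t r n" and f: "f \<in> fam t r n"
  shows "(\<Sum>a\<in>PiE {..<r} (\<lambda>_. basisV t n). u (mk n r a) *
      (\<Sum>S\<in>PiE {..<r} (\<lambda>_. Pow {..<n}). (\<Prod>k<r. (-1) ^ (n - card (S k))) *
         hact t r (\<lambda>k i j. \<Sum>l\<in>S k. (if i = a k ! l \<and> j = b k ! l then 1 else 0)) id x (mk n r f)))
    = (\<Sum>\<pi>\<in>PG r n. x (mk n r (cact \<pi> b)) * u (mk n r (cact (invG \<pi>) f)))"
proof -
  let ?P = "PiE {..<r} (\<lambda>_. basisV t n)"
  let ?S = "PiE {..<r} (\<lambda>_. Pow {..<n})"
  let ?ind = "\<lambda>P. if P then (1::'a) else 0"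
  have finP: "finite ?P" by (simp add: finite_PiE finite_basisV)
  let ?G = "\<lambda>a S. hact t r (\<lambda>k i j. \<Sum>l\<in>S k. ?ind (i = a k ! l \<and> j = b k ! l)) id x (mk n r f)"
  let ?s = "\<lambda>S. \<Prod>k<r. (-1) ^ (n - card (S k)) :: 'a"
  let ?fa = "\<lambda>\<pi> a. ?ind (\<forall>k<r. f k = permute_list (\<pi> k) (a k))"
  let ?hb = "\<lambda>\<pi> h. ?ind (\<forall>k<r. h k = permute_list (\<pi> k) (b k))"
  have 1: "(\<Sum>S\<in>?S. ?s S * ?G a S) = (\<Sum>h\<in>?P. \<Sum>\<pi>\<in>PG r n. ?fa \<pi> a * ?hb \<pi> h * x (mk n r h))" if a: "a \<in> ?P" for a
  proof -
    let ?e = "\<lambda>h k i l. ?ind (f k ! i = a k ! l \<and> h k ! i = b k ! l)"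
    have "(\<Sum>S\<in>?S. ?s S * ?G a S) =
      (\<Sum>S\<in>?S. \<Sum>h\<in>?P. (\<Prod>k<r. (-1) ^ (n - card (S k)) * (\<Prod>i<n. \<Sum>l\<in>S k. ?e h k i l)) * x (mk n r h))"
      unfolding hact_mk[OF f permutes_id] id_apply sum_distrib_left
      by (simp add: prod.distrib mult.assoc)
    also have "\<dots> = (\<Sum>h\<in>?P. (\<Sum>S\<in>?S. \<Prod>k<r. (-1) ^ (n - card (S k)) * (\<Prod>i<n. \<Sum>l\<in>S k. ?e h k i l)) * x (mk n r h))"
      by (subst sum.swap) (simp add: sum_distrib_right)
    also have "\<dots> = (\<Sum>h\<in>?P. (\<Prod>k<r. \<Sum>p\<in>Sn n. \<Prod>i<n. ?e h k i (p i)) * x (mk n r h))"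
      by (subst prod_sum_PiE[symmetric]) (auto simp: ryser_permanent_formula)
    also have "\<dots> = (\<Sum>h\<in>?P. (\<Prod>k<r. \<Sum>p\<in>Sn n. ?ind (f k = permute_list p (a k)) * ?ind (h k = permute_list p (b k))) * x (mk n r h))"
    proof (intro sum.cong refl arg_cong2[where f = "(*)"] prod.cong)
      fix h k p assume h: "h \<in> ?P" and k: "k \<in> {..<r}" and p: "p \<in> Sn n"
      have len: "length (f k) = n" "length (h k) = n" "length (a k) = n" "length (b k) = n"
        using k f b PiE_fam[OF h] PiE_fam[OF a] by (auto simp: fam_length)
      have "(\<Prod>i<n. ?e h k i (p i)) = ?ind ((\<forall>i<n. f k ! i = a k ! p i) \<and> (\<forall>i<n. h k ! i = b k ! p i))"
        by (subst prod_if_eq) auto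
      then show "(\<Prod>i<n. ?e h k i (p i)) = ?ind (f k = permute_list p (a k)) * ?ind (h k = permute_list p (b k))"
        using p permute_list_eq_iff[OF len(1,3)] permute_list_eq_iff[OF len(2,4)] by simp
    qed
    also have "\<dots> = (\<Sum>h\<in>?P. \<Sum>\<pi>\<in>PG r n. ?fa \<pi> a * ?hb \<pi> h * x (mk n r h))"
      unfolding sum_PG_prod[symmetric] prod.distrib by (simp add: prod_if_eq sum_distrib_right Ball_def)
    finally show ?thesis .
  qed
  have delta: "(\<Sum>h\<in>?P. ?ind (\<forall>k<r. h k = c k) * y (mk n r h)) = y (mk n r c)" if c: "c \<in> fam t r n" for c y
  proof -
    have "restrict c {..<r} \<in> ?P" using c by (auto simp: fam_def)
    moreover have "(\<forall>k<r. h k = c k) \<longleftrightarrow> h = restrict c {..<r}" if "h \<in> ?P" for h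
      using that PiE_arb[OF that] by (auto simp: fun_eq_iff restrict_def)
    ultimately have "(\<Sum>h\<in>?P. ?ind (\<forall>k<r. h k = c k) * y (mk n r h)) = y (mk n r (restrict c {..<r}))"
      using finP by (simp add: if_distrib[of "\<lambda>z. z * _"] cong: if_cong)
    also have "mk n r (restrict c {..<r}) = mk n r c" by (rule mk_cong) simp
    finally show ?thesis .
  qed
  have "(\<Sum>a\<in>?P. u (mk n r a) * (\<Sum>S\<in>?S. ?s S * ?G a S)) =
    (\<Sum>a\<in>?P. \<Sum>h\<in>?P. \<Sum>\<pi>\<in>PG r n. (?fa \<pi> a * u (mk n r a)) * (?hb \<pi> h * x (mk n r h)))"
    by (rule sum.cong[OF refl]) (simp only: 1 sum_distrib_left mult_ac)
  also have "\<dots> = (\<Sum>a\<in>?P. \<Sum>\<pi>\<in>PG r n. \<Sum>h\<in>?P. (?fa \<pi> a * u (mk n r a)) * (?hb \<pi> h * x (mk n r h)))"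
    by (rule sum.cong[OF refl], rule sum.swap)
  also have "\<dots> = (\<Sum>\<pi>\<in>PG r n. \<Sum>a\<in>?P. \<Sum>h\<in>?P. (?fa \<pi> a * u (mk n r a)) * (?hb \<pi> h * x (mk n r h)))"
    by (rule sum.swap)
  also have "\<dots> = (\<Sum>\<pi>\<in>PG r n. u (mk n r (cact (invG \<pi>) f)) * x (mk n r (cact \<pi> b)))"
  proof (rule sum.cong[OF refl])
    fix \<pi> assume p: "\<pi> \<in> PG r n"
    \<comment> \<open>For fixed \<open>\<pi>\<close> the condition on \<open>f\<close> is solved for
      \<open>a\<close>, which produces the inverse permutation.\<close>
    have "(\<forall>k<r. f k = permute_list (\<pi> k) (a k)) \<longleftrightarrow> (\<forall>k<r. a k = cact (invG \<pi>) f k)" if "a \<in> ?P" for a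
      using permute_list_inv_iff[OF fam_length[OF f] fam_length[OF PiE_fam[OF that]] PG_perm[OF p]]
      by (auto simp: cact_def invG_def)
    then have "(\<Sum>a\<in>?P. ?fa \<pi> a * u (mk n r a)) = (\<Sum>a\<in>?P. ?ind (\<forall>k<r. a k = cact (invG \<pi>) f k) * u (mk n r a))"
      by (intro sum.cong refl) simp
    also have "\<dots> = u (mk n r (cact (invG \<pi>) f))" by (rule delta[OF cact_fam[OF invG_PG[OF p] f]])
    finally have A: "(\<Sum>a\<in>?P. ?fa \<pi> a * u (mk n r a)) = u (mk n r (cact (invG \<pi>) f))" .
    have B: "(\<Sum>h\<in>?P. ?hb \<pi> h * x (mk n r h)) = x (mk n r (cact \<pi> b))"
      using delta[OF cact_fam[OF p b]] by (simp add: cact_def)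
    show "(\<Sum>a\<in>?P. \<Sum>h\<in>?P. (?fa \<pi> a * u (mk n r a)) * (?hb \<pi> h * x (mk n r h)))
      = u (mk n r (cact (invG \<pi>) f)) * x (mk n r (cact \<pi> b))"
      unfolding sum_product[symmetric] A B ..
  qed
  finally show ?thesis by (simp add: mult.commute)
qed

text \<open>A submodule is stable under the centraliser of \<open>PG r n\<close>, which is spanned by symmetrised matrix units.\<close>
lemma submodule_symmetrised:
  fixes W :: "(nat list list \<Rightarrow> 'a::{finite,field}) set"
  assumes pw: "\<And>k. k < n \<Longrightarrow> (\<Sum>c\<in>(UNIV::'a set). c ^ k) = 0"
    and t: "t \<ge> 2" and W: "fs.subspace W" "W \<subseteq> homog t r n"
    and stable: "\<And>g x. (\<And>k. k < r \<Longrightarrow> inv_mat t (g k)) \<Longrightarrow> x \<in> W \<Longrightarrow> hact t r g id x \<in> W"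
    and x: "x \<in> W" and b: "b \<in> fam t r n"
  shows "(\<Sum>\<pi>\<in>PG r n. fscale (x (mk n r (cact (invG \<pi>) b))) (Rop t r n \<pi> u)) \<in> W"
proof -
  let ?P = "PiE {..<r} (\<lambda>_. basisV t n)"
  let ?S = "PiE {..<r} (\<lambda>_. Pow {..<n})"
  let ?y = "\<Sum>a\<in>?P. fscale (u (mk n r a)) (\<Sum>S\<in>?S. fscale (\<Prod>k<r. (-1) ^ (n - card (S k)))
         (hact t r (\<lambda>k i j. \<Sum>l\<in>S k. (if i = a k ! l \<and> j = b k ! l then 1 else 0)) id x))"
  \<comment> \<open>The matrices in \<open>?y\<close> are singular in general, hence the appeal to
    \<open>hact_all_matrices\<close>.\<close>
  have y: "?y \<in> W"
    by (intro fs.subspace_sum[OF W(1)] fs.subspace_scale[OF W(1)] hact_all_matrices[OF pw t W stable x])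
  have "(\<Sum>\<pi>\<in>PG r n. fscale (x (mk n r (cact (invG \<pi>) b))) (Rop t r n \<pi> u)) = ?y"
  proof (rule homog_eqI)
    show "?y \<in> homog t r n" using y W by auto
    show "(\<Sum>\<pi>\<in>PG r n. fscale (x (mk n r (cact (invG \<pi>) b))) (Rop t r n \<pi> u)) \<in> homog t r n"
      by (intro fs.subspace_sum[OF subspace_homog] fs.subspace_scale[OF subspace_homog] Rop_homog)
    fix f assume f: "f \<in> fam t r n"
    have "?y (mk n r f) = (\<Sum>\<pi>\<in>PG r n. x (mk n r (cact \<pi> b)) * u (mk n r (cact (invG \<pi>) f)))"
      unfolding sum_fun_apply fscale_apply by (rule symmetrised_unit_value[OF b f])
    also have "\<dots> = (\<Sum>\<pi>\<in>PG r n. x (mk n r (cact (invG \<pi>) b)) * u (mk n r (cact (invG (invG \<pi>)) f)))"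
      by (rule sum_PG_inv[symmetric])
    finally show "(\<Sum>\<pi>\<in>PG r n. fscale (x (mk n r (cact (invG \<pi>) b))) (Rop t r n \<pi> u)) (mk n r f) = ?y (mk n r f)"
      unfolding sum_fun_apply fscale_apply by (simp add: Rop_mk[OF f] invG_invG)
  qed
  then show ?thesis using y by simp
qed

section \<open>Symmetry types\<close>

text \<open>Symmetric and alternating columns, and the two halves (\<open>+1\<close> and \<open>-1\<close> under reversal) of the
  two-dimensional type in degree three.\<close>

datatype kind = Sy | Al | Mp | Mm

instance kind :: finite
proof
  have "(UNIV :: kind set) = {Sy, Al, Mp, Mm}" using kind.exhaust by auto
  then show "finite (UNIV :: kind set)" by (metis finite.emptyI finite.insertI)
qed

fun bl :: "kind \<Rightarrow> nat" where
  "bl Sy = 0" | "bl Al = 1" | "bl Mp = 2" | "bl Mm = 2"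

text \<open>\<open>th \<kappa>\<close> is a diagonal matrix coefficient of an irreducible representation of the symmetric group
  on \<open>n\<close> letters and \<open>ka \<kappa>\<close> is \<open>n!\<close> divided by its degree, so that \<open>orth\<close> is Schur orthogonality. The two coefficients \<open>Mp\<close>, \<open>Mm\<close> of the
  two-dimensional representation of the symmetric group on three letters share the block \<open>2\<close>.\<close>
locale kinds =
  fixes t r n :: nat and KS :: "kind set"
    and th :: "kind \<Rightarrow> (nat \<Rightarrow> nat) \<Rightarrow> 'a::{finite,field}" and ka :: "kind \<Rightarrow> 'a"
  assumes Sy: "Sy \<in> KS"
    and ka: "\<kappa> \<in> KS \<Longrightarrow> ka \<kappa> \<noteq> 0"
    and th_id: "\<kappa> \<in> KS \<Longrightarrow> th \<kappa> id = 1"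
    and th_inv: "\<kappa> \<in> KS \<Longrightarrow> p permutes {..<n} \<Longrightarrow> th \<kappa> (inv p) = th \<kappa> p"
    and orth: "\<kappa> \<in> KS \<Longrightarrow> \<mu> \<in> KS \<Longrightarrow> \<kappa> = \<mu> \<or> bl \<kappa> \<noteq> bl \<mu> \<Longrightarrow> h permutes {..<n} \<Longrightarrow> p permutes {..<n} \<Longrightarrow>
      (\<Sum>s\<in>Sn n. th \<kappa> s * th \<mu> (h \<circ> s \<circ> p)) = (if \<kappa> = \<mu> then ka \<kappa> * th \<kappa> h * th \<kappa> p else 0)"
    and compl: "p permutes {..<n} \<Longrightarrow> (\<Sum>\<kappa>\<in>KS. th \<kappa> p / ka \<kappa>) = (if p = id then 1 else 0)"
begin

definition idx :: "(nat \<Rightarrow> kind) set" where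
  "idx = {i. (\<forall>k<r. i k \<in> KS) \<and> (\<forall>k\<ge>r. i k = Sy)}"

text \<open>The diagonal coefficient of the external tensor product of the representations assigned
  to the columns; \<open>Kc\<close> below is the group order divided by the degree of that
  product.\<close>

definition chi :: "(nat \<Rightarrow> kind) \<Rightarrow> (nat \<Rightarrow> nat \<Rightarrow> nat) \<Rightarrow> 'a" where
  "chi i \<pi> = (\<Prod>k<r. th (i k) (\<pi> k))"

definition Kc :: "(nat \<Rightarrow> kind) \<Rightarrow> 'a" where
  "Kc i = (\<Prod>k<r. ka (i k))"

definition proj :: "(nat \<Rightarrow> kind) \<Rightarrow> (nat list list \<Rightarrow> 'a) \<Rightarrow> nat list list \<Rightarrow> 'a" where
  "proj i u = (\<Sum>\<pi>\<in>PG r n. fscale (chi i \<pi> / Kc i) (Rop t r n \<pi> u))"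

text \<open>The Lie power is the image of \<open>dproj Al\<close> for \<open>n = 2\<close> and of \<open>dproj Mp\<close> for \<open>n = 3\<close>.\<close>

definition dproj :: "kind \<Rightarrow> (nat list list \<Rightarrow> 'a) \<Rightarrow> nat list list \<Rightarrow> 'a" where
  "dproj \<kappa> u = (\<Sum>p\<in>Sn n. fscale (th \<kappa> p / ka \<kappa>) (Rop t r n (diagG r p) u))"

lemma idxD: "i \<in> idx \<Longrightarrow> k < r \<Longrightarrow> i k \<in> KS"
  by (simp add: idx_def)

lemma Kc_nz: "i \<in> idx \<Longrightarrow> Kc i \<noteq> 0"
  by (auto simp: Kc_def idx_def ka)

lemma finite_idx: "finite idx"
proof -
  have "idx \<subseteq> (\<lambda>i k. if k < r then i k else Sy) ` PiE {..<r} (\<lambda>_. UNIV)"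
    by (rule subsetI, rule_tac x = "restrict x {..<r}" in image_eqI) (simp_all add: idx_def fun_eq_iff restrict_PiE_iff)
  then show ?thesis by (rule finite_subset) (simp add: finite_PiE)
qed

lemma chi_inv: "i \<in> idx \<Longrightarrow> \<pi> \<in> PG r n \<Longrightarrow> chi i (invG \<pi>) = chi i \<pi>"
  by (simp add: chi_def invG_def th_inv idxD PG_perm)

text \<open>The situations in which \<open>orth\<close> gives information on some column.
  \<open>Mp\<close> and \<open>Mm\<close> come from one irreducible representation, where the two
  idempotents with a group element between them need not have product zero.\<close>

definition sep :: "(nat \<Rightarrow> kind) \<Rightarrow> (nat \<Rightarrow> kind) \<Rightarrow> bool" where
  "sep i j \<longleftrightarrow> i = j \<or> (\<exists>k<r. bl (i k) \<noteq> bl (j k))"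

lemma chi_orth:
  assumes "i \<in> idx" "j \<in> idx" "h \<in> PG r n" "\<rho> \<in> PG r n" "sep i j"
  shows "(\<Sum>\<pi>\<in>PG r n. chi j \<pi> * chi i (mulG h (mulG \<pi> \<rho>))) = (if i = j then Kc i * chi i h * chi i \<rho> else 0)"
proof -
  have "(\<Sum>\<pi>\<in>PG r n. chi j \<pi> * chi i (mulG h (mulG \<pi> \<rho>))) =
    (\<Sum>\<pi>\<in>PG r n. \<Prod>k<r. th (j k) (\<pi> k) * th (i k) (h k \<circ> \<pi> k \<circ> \<rho> k))"
    by (simp add: chi_def mulG_def prod.distrib o_assoc)
  also have "\<dots> = (\<Prod>k<r. \<Sum>s\<in>Sn n. th (j k) s * th (i k) (h k \<circ> s \<circ> \<rho> k))"
    by (rule sum_PG_prod)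
  also have "\<dots> = (if i = j then Kc i * chi i h * chi i \<rho> else 0)"
  proof (cases "i = j")
    case True
    have "(\<Prod>k<r. \<Sum>s\<in>Sn n. th (j k) s * th (i k) (h k \<circ> s \<circ> \<rho> k)) =
      (\<Prod>k<r. ka (i k) * th (i k) (h k) * th (i k) (\<rho> k))"
      using assms True by (intro prod.cong refl) (simp add: orth idxD PG_perm)
    then show ?thesis using True by (simp add: Kc_def chi_def prod.distrib)
  next
    case False
    then obtain k where k: "k < r" "bl (j k) \<noteq> bl (i k)" using assms(5) unfolding sep_def by metis
    then have "(\<Sum>s\<in>Sn n. th (j k) s * th (i k) (h k \<circ> s \<circ> \<rho> k)) = 0"
      using orth[of "j k" "i k" "h k" "\<rho> k"] assms by (auto simp: idxD PG_perm)
    then show ?thesis using False k by (auto intro!: prod_zero)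
  qed
  finally show ?thesis .
qed

section \<open>Idempotents of the group algebra and their products\<close>

lemma proj_homog: "proj i u \<in> homog t r n"
  unfolding proj_def by (intro fs.subspace_sum fs.subspace_scale subspace_homog Rop_homog)

lemma dproj_homog: "dproj \<kappa> u \<in> homog t r n"
  unfolding dproj_def by (intro fs.subspace_sum fs.subspace_scale subspace_homog Rop_homog)

lemma proj_add: "proj i (u + v) = proj i u + proj i v"
  by (simp add: proj_def Rop_add fs.scale_right_distrib sum.distrib)

lemma proj_scale: "proj i (fscale c u) = fscale c (proj i u)"
  by (simp add: proj_def Rop_scale fs.scale_sum_right mult.commute)

lemma proj_zero [simp]: "proj i 0 = 0"
  using proj_scale[of i 0 0] by simp

lemma proj_sum: "proj i (\<Sum>a\<in>A. F a) = (\<Sum>a\<in>A. proj i (F a))"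
  using sum_comp_morphism[of "proj i" F A, OF proj_zero proj_add] by (simp add: o_def)

lemma proj_diff: "proj i (u - v) = proj i u - proj i v"
  using proj_add[of i "u - v" v] by (simp add: algebra_simps)

lemma dproj_add: "dproj i (u + v) = dproj i u + dproj i v"
  by (simp add: dproj_def Rop_add fs.scale_right_distrib sum.distrib)

lemma dproj_scale: "dproj i (fscale c u) = fscale c (dproj i u)"
  by (simp add: dproj_def Rop_scale fs.scale_sum_right mult.commute)

lemma proj_mk: "f \<in> fam t r n \<Longrightarrow> proj i u (mk n r f) = (\<Sum>\<pi>\<in>PG r n. chi i \<pi> * u (mk n r (cact \<pi> f))) / Kc i"
  by (simp add: proj_def sum_fun_apply Rop_mk sum_divide_distrib)

lemma Rop_sum: "Rop t r n \<pi> (\<Sum>a\<in>A. F a) = (\<Sum>a\<in>A. Rop t r n \<pi> (F a))"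
proof -
  have "Rop t r n \<pi> 0 = 0" by (simp add: Rop_def fun_eq_iff)
  from sum_comp_morphism[of "Rop t r n \<pi>" F A, OF this Rop_add] show ?thesis by (simp add: o_def)
qed

lemma Rop_proj:
  assumes "\<rho> \<in> PG r n"
  shows "Rop t r n \<rho> (proj i u) = (\<Sum>\<pi>\<in>PG r n. fscale (chi i (mulG (invG \<rho>) \<pi>) / Kc i) (Rop t r n \<pi> u))"
proof -
  have "Rop t r n \<rho> (proj i u) = (\<Sum>\<pi>\<in>PG r n. fscale (chi i \<pi> / Kc i) (Rop t r n (mulG \<rho> \<pi>) u))"
    unfolding proj_def by (simp add: Rop_sum Rop_scale Rop_Rop assms)
  also have "\<dots> = (\<Sum>\<pi>\<in>PG r n. fscale (chi i (mulG (invG \<rho>) (mulG \<rho> \<pi>)) / Kc i) (Rop t r n (mulG \<rho> \<pi>) u))"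
    by (simp add: mulG_assoc[symmetric] mulG_invG[OF assms])
  also have "\<dots> = (\<Sum>\<pi>\<in>PG r n. fscale (chi i (mulG (invG \<rho>) \<pi>) / Kc i) (Rop t r n \<pi> u))"
    by (rule sum_PG_mul_left[OF assms])
  finally show ?thesis .
qed

lemma proj_Rop:
  assumes "\<rho> \<in> PG r n"
  shows "proj i (Rop t r n \<rho> u) = (\<Sum>\<pi>\<in>PG r n. fscale (chi i (mulG \<pi> (invG \<rho>)) / Kc i) (Rop t r n \<pi> u))"
proof -
  have "proj i (Rop t r n \<rho> u) = (\<Sum>\<pi>\<in>PG r n. fscale (chi i \<pi> / Kc i) (Rop t r n (mulG \<pi> \<rho>) u))"
    unfolding proj_def by (simp add: Rop_Rop assms)
  also have "\<dots> = (\<Sum>\<pi>\<in>PG r n. fscale (chi i (mulG (mulG \<pi> \<rho>) (invG \<rho>)) / Kc i) (Rop t r n (mulG \<pi> \<rho>) u))"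
    by (simp add: mulG_assoc mulG_invG[OF assms])
  also have "\<dots> = (\<Sum>\<pi>\<in>PG r n. fscale (chi i (mulG \<pi> (invG \<rho>)) / Kc i) (Rop t r n \<pi> u))"
    by (rule sum_PG_mul_right[OF assms])
  finally show ?thesis .
qed

text \<open>Compressing a group element by a primitive idempotent from both sides leaves its
  diagonal coefficient as a scalar, and idempotents from different irreducibles annihilate
  everything between them.\<close>

lemma proj_Rop_proj:
  assumes i: "i \<in> idx" and j: "j \<in> idx" and sep: "sep i j" and \<rho>: "\<rho> \<in> PG r n"
  shows "proj j (Rop t r n \<rho> (proj i u)) = (if i = j then fscale (chi i \<rho>) (proj i u) else 0)"
proof -
  let ?c = "\<lambda>\<pi> g. chi j \<pi> * chi i (mulG (invG (mulG \<pi> \<rho>)) g)" and ?K = "Kc j * Kc i" and ?R = "\<lambda>g. Rop t r n g u"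
  have "proj j (Rop t r n \<rho> (proj i u)) = (\<Sum>\<pi>\<in>PG r n. fscale (chi j \<pi> / Kc j) (Rop t r n (mulG \<pi> \<rho>) (proj i u)))"
    unfolding proj_def[of j] by (simp add: Rop_Rop \<rho>)
  also have "\<dots> = (\<Sum>\<pi>\<in>PG r n. \<Sum>g\<in>PG r n. fscale (?c \<pi> g / ?K) (?R g))"
    by (intro sum.cong refl) (simp add: Rop_proj mulG_PG \<rho> fs.scale_sum_right)
  also have "\<dots> = (\<Sum>g\<in>PG r n. \<Sum>\<pi>\<in>PG r n. fscale (?c \<pi> g / ?K) (?R g))"
    by (rule sum.swap)
  also have "\<dots> = (\<Sum>g\<in>PG r n. fscale ((if i = j then Kc i * chi i g * chi i \<rho> else 0) / ?K) (?R g))"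
  proof (rule sum.cong[OF refl])
    fix g assume g: "g \<in> PG r n"
    \<comment> \<open>Invariance of the coefficient under inversion moves \<open>\<pi>\<close> to
      the middle of the product, the form that \<open>chi_orth\<close> treats.\<close>
    have "chi i (mulG (invG (mulG \<pi> \<rho>)) g) = chi i (mulG (invG g) (mulG \<pi> \<rho>))" if "\<pi> \<in> PG r n" for \<pi>
    proof -
      have *: "mulG \<pi> \<rho> \<in> PG r n" using that \<rho> by (rule mulG_PG)
      have "chi i (mulG (invG (mulG \<pi> \<rho>)) g) = chi i (invG (mulG (invG (mulG \<pi> \<rho>)) g))"
        using i by (simp add: chi_inv mulG_PG invG_PG * g)
      then show ?thesis using * g by (simp add: invG_mulG[of _ r n] invG_PG invG_invG)
    qed
    then have "(\<Sum>\<pi>\<in>PG r n. ?c \<pi> g) = (if i = j then Kc i * chi i g * chi i \<rho> else 0)"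
      using chi_orth[OF i j invG_PG[OF g] \<rho> sep] chi_inv[OF i g] chi_inv[OF j g] by (simp cong: sum.cong)
    then show "(\<Sum>\<pi>\<in>PG r n. fscale (?c \<pi> g / ?K) (?R g)) =
      fscale ((if i = j then Kc i * chi i g * chi i \<rho> else 0) / ?K) (?R g)"
      by (simp only: fs.scale_sum_left[symmetric] sum_divide_distrib[symmetric])
  qed
  also have "\<dots> = (if i = j then fscale (chi i \<rho>) (proj i u) else 0)"
    using Kc_nz[OF i] by (auto simp: proj_def fs.scale_sum_right mult_ac)
  finally show ?thesis .
qed

lemma id_PG: "(\<lambda>_. id) \<in> PG r n"
  by (simp add: PG_def)

lemma Rop_id: "u \<in> homog t r n \<Longrightarrow> Rop t r n (\<lambda>_. id) u = u"
  by (rule homog_eqI[OF Rop_homog]) (auto simp: Rop_mk cact_def cong: mk_cong)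

text \<open>Summed over all assignments, the coefficient of a group element factorises over the
  columns, and by \<open>compl\<close> each factor is a delta at the identity.\<close>

lemma sum_proj:
  assumes u: "u \<in> homog t r n"
  shows "(\<Sum>i\<in>idx. proj i u) = u"
proof -
  have "(\<Sum>i\<in>idx. proj i u) = (\<Sum>\<pi>\<in>PG r n. fscale (\<Sum>i\<in>idx. chi i \<pi> / Kc i) (Rop t r n \<pi> u))"
    unfolding proj_def by (subst sum.swap) (simp add: fs.scale_sum_left)
  also have "\<dots> = (\<Sum>\<pi>\<in>PG r n. if \<pi> = (\<lambda>_. id) then Rop t r n \<pi> u else 0)"
  proof (rule sum.cong[OF refl])
    fix \<pi> assume p: "\<pi> \<in> PG r n"
    have "(\<Sum>i\<in>idx. chi i \<pi> / Kc i) = (\<Sum>i\<in>idx. \<Prod>k<r. th (i k) (\<pi> k) / ka (i k))"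
      by (simp add: chi_def Kc_def prod_dividef)
    also have "\<dots> = (\<Prod>k<r. \<Sum>\<kappa>\<in>KS. th \<kappa> (\<pi> k) / ka \<kappa>)"
      unfolding idx_def by (rule sum_default_family_prod) simp
    also have "\<dots> = (if \<forall>k\<in>{..<r}. \<pi> k = id then 1 else 0)"
      using p by (simp add: compl PG_perm prod_if_eq)
    also have "(\<forall>k\<in>{..<r}. \<pi> k = id) \<longleftrightarrow> \<pi> = (\<lambda>_. id)"
    proof
      assume *: "\<forall>k\<in>{..<r}. \<pi> k = id"
      show "\<pi> = (\<lambda>_. id)"
      proof
        fix k show "\<pi> k = id" using p * unfolding PG_def by (cases "k < r") simp_all
      qed
    qed simp
    finally show "fscale (\<Sum>i\<in>idx. chi i \<pi> / Kc i) (Rop t r n \<pi> u) = (if \<pi> = (\<lambda>_. id) then Rop t r n \<pi> u else 0)"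
      by simp
  qed
  also have "\<dots> = u" by (simp add: finite_PG id_PG Rop_id[OF u])
  finally show ?thesis .
qed

lemma dproj_dproj:
  assumes k: "\<kappa> \<in> KS"
  shows "dproj \<kappa> (dproj \<kappa> u) = dproj \<kappa> u"
proof -
  let ?N = "Sn n" and ?R = "\<lambda>q. Rop t r n (diagG r q) u" and ?c = "ka \<kappa> * ka \<kappa>"
  have mul: "mulG (diagG r p) (diagG r q) = diagG r (p \<circ> q)" for p q
    by (auto simp: mulG_def diagG_def)
  have "dproj \<kappa> (dproj \<kappa> u) = (\<Sum>p\<in>?N. \<Sum>q\<in>?N. fscale (th \<kappa> p * th \<kappa> q / ?c) (?R (p \<circ> q)))"
    unfolding dproj_def by (simp add: Rop_sum Rop_scale Rop_Rop diagG_PG mul fs.scale_sum_right)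
  also have "\<dots> = (\<Sum>p\<in>?N. \<Sum>q\<in>?N. fscale (th \<kappa> p * th \<kappa> (inv q \<circ> p) / ?c) (?R q))"
  proof (rule sum.cong[OF refl])
    fix p assume "p \<in> ?N"
    then have p: "p permutes {..<n}" by simp
    have *: "th \<kappa> (inv (p \<circ> q) \<circ> p) = th \<kappa> q" if "q \<in> ?N" for q
    proof -
      have "inv (p \<circ> q) \<circ> p = inv q"
        using p that by (simp add: o_inv_distrib permutes_bij o_assoc[symmetric] permutes_inv_o)
      then show ?thesis using that by (simp add: th_inv k)
    qed
    have "(\<Sum>q\<in>?N. fscale (th \<kappa> p * th \<kappa> (inv q \<circ> p) / ?c) (?R q)) =
       (\<Sum>q\<in>?N. fscale (th \<kappa> p * th \<kappa> (inv (p \<circ> q) \<circ> p) / ?c) (?R (p \<circ> q)))"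
      by (rule setum_permutations_compose_left[OF p])
    also have "\<dots> = (\<Sum>q\<in>?N. fscale (th \<kappa> p * th \<kappa> q / ?c) (?R (p \<circ> q)))"
      by (intro sum.cong refl) (simp only: *)
    finally show "(\<Sum>q\<in>?N. fscale (th \<kappa> p * th \<kappa> q / ?c) (?R (p \<circ> q))) =
      (\<Sum>q\<in>?N. fscale (th \<kappa> p * th \<kappa> (inv q \<circ> p) / ?c) (?R q))" ..
  qed
  also have "\<dots> = (\<Sum>q\<in>?N. \<Sum>p\<in>?N. fscale (th \<kappa> p * th \<kappa> (inv q \<circ> p) / ?c) (?R q))"
    by (rule sum.swap)
  also have "\<dots> = (\<Sum>q\<in>?N. fscale (th \<kappa> q / ka \<kappa>) (?R q))"
  proof (rule sum.cong[OF refl])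
    fix q assume "q \<in> ?N"
    then have q: "q permutes {..<n}" by simp
    have "(\<Sum>p\<in>?N. th \<kappa> p * th \<kappa> (inv q \<circ> p \<circ> id)) / ?c = th \<kappa> q / ka \<kappa>"
      by (subst orth[OF k k _ permutes_inv[OF q] permutes_id]) (simp_all add: th_id th_inv k q ka)
    then show "(\<Sum>p\<in>?N. fscale (th \<kappa> p * th \<kappa> (inv q \<circ> p) / ?c) (?R q)) = fscale (th \<kappa> q / ka \<kappa>) (?R q)"
      unfolding sum_divide_distrib by (simp add: fs.scale_sum_left[symmetric])
  qed
  finally show ?thesis by (simp add: dproj_def)
qed

text \<open>The diagonal coefficient, in the representation attached to \<open>i\<close>, of the
  diagonal idempotent of kind \<open>\<kappa>\<close>. If it is nonzero, components at
  \<open>i\<close> can be lifted to the image of \<open>dproj \<kappa>\<close>.\<close>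

definition coef :: "kind \<Rightarrow> (nat \<Rightarrow> kind) \<Rightarrow> 'a" where
  "coef \<kappa> i = (\<Sum>p\<in>Sn n. th \<kappa> p * chi i (diagG r p)) / ka \<kappa>"

lemma proj_dproj_proj:
  assumes i: "i \<in> idx" and j: "j \<in> idx" and sep: "sep i j"
  shows "proj j (dproj \<kappa> (proj i u)) = (if i = j then fscale (coef \<kappa> i) (proj i u) else 0)"
proof -
  have "proj j (dproj \<kappa> (proj i u)) =
    (\<Sum>p\<in>Sn n. fscale (th \<kappa> p / ka \<kappa>) (if i = j then fscale (chi i (diagG r p)) (proj i u) else 0))"
    unfolding dproj_def proj_sum proj_scale
    by (intro sum.cong refl arg_cong[of _ _ "fscale _"] proj_Rop_proj[OF i j sep] diagG_PG) simp
  then show ?thesis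
    by (auto simp: coef_def sum_divide_distrib fs.scale_sum_left)
qed

section \<open>Compatibility with the action\<close>

lemma hact_add: "hact t r g \<sigma> (x + y) = hact t r g \<sigma> x + hact t r g \<sigma> y"
  by (simp add: hact_def fun_eq_iff ring_distribs sum.distrib)

lemma hact_scale: "hact t r g \<sigma> (fscale c x) = fscale c (hact t r g \<sigma> x)"
  by (simp add: hact_def fun_eq_iff sum_distrib_left mult_ac)

lemma hact_zero [simp]: "hact t r g \<sigma> 0 = 0"
  by (simp add: hact_def fun_eq_iff)

lemma hact_sum: "hact t r g \<sigma> (\<Sum>a\<in>A. F a) = (\<Sum>a\<in>A. hact t r g \<sigma> (F a))"
  using sum_comp_morphism[of "hact t r g \<sigma>" F A, OF hact_zero hact_add] by (simp add: o_def)

text \<open>A linear map acting in the same way on all entries of a column commutes with permuting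
  those entries; the factor permutation only changes which column is permuted.\<close>

lemma hact_Rop:
  assumes p: "\<pi> \<in> PG r n" and s: "\<sigma> permutes {..<r}" and x: "x \<in> homog t r n"
  shows "hact t r g \<sigma> (Rop t r n \<pi> x) = Rop t r n (\<lambda>k. \<pi> (\<sigma> k)) (hact t r g \<sigma> x)"
proof (rule homog_eqI[OF hact_homog[OF Rop_homog] Rop_homog])
  fix f assume f: "f \<in> fam t r n"
  let ?P = "PiE {..<r} (\<lambda>_. basisV t n)"
  have sk: "\<sigma> k < r" if "k < r" for k using permutes_in_image[OF s, of k] that by simp
  have ps: "(\<lambda>k. \<pi> (\<sigma> k)) \<in> PG r n"
    using PG_perm[OF p] p permutes_not_in[OF s] by (auto simp: PG_def)
  define A where "A \<pi> h = restrict (cact \<pi> h) {..<r}" for \<pi> and h :: "nat \<Rightarrow> nat list"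
  have A: "A \<pi> h \<in> ?P" if "\<pi> \<in> PG r n" "h \<in> ?P" for \<pi> h
    using cact_fam[OF that(1) PiE_fam[OF that(2)]] by (auto simp: A_def fam_def)
  have AA: "A \<rho> (A \<pi> h) = h" if "\<pi> \<in> PG r n" "\<rho> \<in> PG r n" "mulG \<pi> \<rho> = (\<lambda>_. id)" "h \<in> ?P" for \<pi> \<rho> h
  proof (rule PiE_ext[OF A[OF that(2) A[OF that(1,4)]] that(4)])
    fix k assume k: "k \<in> {..<r}"
    then have "A \<rho> (A \<pi> h) k = cact \<rho> (cact \<pi> h) k" by (simp add: A_def cact_def)
    also have "\<dots> = h k" using k that by (simp add: cact_cact[OF that(2) PiE_fam[OF that(4)]]) (simp add: cact_def)
    finally show "A \<rho> (A \<pi> h) k = h k" .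
  qed
  have mkA: "mk n r (A \<pi> h) = mk n r (cact \<pi> h)" for h by (rule mk_cong) (simp add: A_def)
  have "Rop t r n (\<lambda>k. \<pi> (\<sigma> k)) (hact t r g \<sigma> x) (mk n r f) =
    (\<Sum>h\<in>?P. (\<Prod>k<r. \<Prod>i<n. g k (f k ! \<pi> (\<sigma> k) i) (h (\<sigma> k) ! i)) * x (mk n r h))"
    unfolding Rop_mk[OF f] hact_mk[OF cact_fam[OF ps f] s]
    using fam_length[OF f] PG_perm[OF p]
    by (intro sum.cong refl arg_cong2[where f = "(*)"] prod.cong) (simp add: cact_def permute_list_nth)
  also have "\<dots> = (\<Sum>h\<in>?P. (\<Prod>k<r. \<Prod>i<n. g k (f k ! i) (h (\<sigma> k) ! i)) * Rop t r n \<pi> x (mk n r h))"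
  proof (rule sum.reindex_bij_witness[where i = "A \<pi>" and j = "A (invG \<pi>)"])
    fix h assume h: "h \<in> ?P"
    have "(\<Prod>i<n. g k (f k ! i) (A (invG \<pi>) h (\<sigma> k) ! i)) = (\<Prod>i<n. g k (f k ! \<pi> (\<sigma> k) i) (h (\<sigma> k) ! i))"
      if k: "k < r" for k
    proof -
      have "(\<Prod>i<n. g k (f k ! i) (A (invG \<pi>) h (\<sigma> k) ! i)) =
        (\<Prod>i<n. g k (f k ! \<pi> (\<sigma> k) i) (A (invG \<pi>) h (\<sigma> k) ! \<pi> (\<sigma> k) i))"
        by (subst prod.permute[OF PG_perm[OF p, of "\<sigma> k"]]) simp
      also have "\<dots> = (\<Prod>i<n. g k (f k ! \<pi> (\<sigma> k) i) (h (\<sigma> k) ! i))"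
      proof (intro prod.cong refl arg_cong[of _ _ "g k _"])
        fix i assume "i \<in> {..<n}"
        then have "\<pi> (\<sigma> k) i < n" using permutes_in_image[OF PG_perm[OF p], of "\<sigma> k" i] by simp
        then show "A (invG \<pi>) h (\<sigma> k) ! \<pi> (\<sigma> k) i = h (\<sigma> k) ! i"
          using sk[OF k] fam_length[OF PiE_fam[OF h] sk[OF k]] permutes_inv[OF PG_perm[OF p]]
          by (simp add: A_def cact_def invG_def permute_list_nth permutes_inverses[OF PG_perm[OF p]])
      qed
      finally show ?thesis .
    qed
    moreover have "Rop t r n \<pi> x (mk n r (A (invG \<pi>) h)) = x (mk n r h)"
      using AA[OF invG_PG[OF p] p mulG_invG(2)[OF p] h]
      by (metis A Rop_mk PiE_fam h invG_PG mkA p)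
    ultimately show "(\<Prod>k<r. \<Prod>i<n. g k (f k ! i) (A (invG \<pi>) h (\<sigma> k) ! i)) * Rop t r n \<pi> x (mk n r (A (invG \<pi>) h)) =
      (\<Prod>k<r. \<Prod>i<n. g k (f k ! \<pi> (\<sigma> k) i) (h (\<sigma> k) ! i)) * x (mk n r h)" by simp
  qed (use A AA p invG_PG mulG_invG[OF p] in auto)
  also have "\<dots> = hact t r g \<sigma> (Rop t r n \<pi> x) (mk n r f)"
    by (rule hact_mk[OF f s, symmetric])
  finally show "hact t r g \<sigma> (Rop t r n \<pi> x) (mk n r f) = Rop t r n (\<lambda>k. \<pi> (\<sigma> k)) (hact t r g \<sigma> x) (mk n r f)" ..
qed

lemma idx_perm: "i \<in> idx \<Longrightarrow> \<sigma> permutes {..<r} \<Longrightarrow> i \<circ> \<sigma> \<in> idx"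
  using permutes_in_image[of \<sigma> "{..<r}"] permutes_not_in[of \<sigma> "{..<r}"] by (auto simp: idx_def)

lemma hact_proj:
  assumes s: "\<sigma> permutes {..<r}" and x: "x \<in> homog t r n"
  shows "hact t r g \<sigma> (proj i x) = proj (i \<circ> \<sigma>) (hact t r g \<sigma> x)"
proof -
  have K: "Kc (i \<circ> \<sigma>) = Kc i" unfolding Kc_def
    using prod.permute[OF s, of "\<lambda>k. ka (i k)"] by (simp add: o_def)
  have chi: "chi (i \<circ> \<sigma>) (\<lambda>k. \<pi> (\<sigma> k)) = chi i \<pi>" for \<pi> unfolding chi_def
    using prod.permute[OF s, of "\<lambda>k. th (i k) (\<pi> k)"] by (simp add: o_def)
  have PGs: "(\<lambda>k. \<pi> (\<sigma> k)) \<in> PG r n" if "\<pi> \<in> PG r n" "\<sigma> permutes {..<r}" for \<pi> \<sigma>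
    using PG_perm[OF that(1)] that(1) permutes_not_in[OF that(2)] by (auto simp: PG_def)
  have "hact t r g \<sigma> (proj i x) = (\<Sum>\<pi>\<in>PG r n. fscale (chi (i \<circ> \<sigma>) (\<lambda>k. \<pi> (\<sigma> k)) / Kc (i \<circ> \<sigma>)) (Rop t r n (\<lambda>k. \<pi> (\<sigma> k)) (hact t r g \<sigma> x)))"
    unfolding proj_def hact_sum hact_scale chi K by (simp add: hact_Rop s x)
  also have "\<dots> = (\<Sum>\<pi>\<in>PG r n. fscale (chi (i \<circ> \<sigma>) \<pi> / Kc (i \<circ> \<sigma>)) (Rop t r n \<pi> (hact t r g \<sigma> x)))"
    by (rule sum.reindex_bij_witness[where i = "\<lambda>\<pi> k. \<pi> (inv \<sigma> k)" and j = "\<lambda>\<pi> k. \<pi> (\<sigma> k)"])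
      (use PGs s permutes_inv[OF s] in \<open>auto simp: permutes_inverses[OF s]\<close>)
  finally show ?thesis by (simp add: proj_def)
qed

lemma hact_dproj:
  assumes s: "\<sigma> permutes {..<r}" and x: "x \<in> homog t r n"
  shows "hact t r g \<sigma> (dproj \<kappa> x) = dproj \<kappa> (hact t r g \<sigma> x)"
proof -
  have "(\<lambda>k. diagG r p (\<sigma> k)) = diagG r p" for p
    using permutes_in_image[OF s] by (auto simp: diagG_def)
  then show ?thesis unfolding dproj_def hact_sum hact_scale
    by (intro sum.cong refl arg_cong[of _ _ "fscale _"]) (simp add: hact_Rop s x diagG_PG)
qed

text \<open>For identity matrices the sum over \<open>h\<close> has a single nonzero term, and the
  value of the image at \<open>f \<circ> \<sigma>\<close> is the value of \<open>x\<close> at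
  \<open>f\<close>.\<close>

lemma hact_permutation_inj:
  fixes x :: "nat list list \<Rightarrow> 'a"
  assumes s: "\<sigma> permutes {..<r}" and x: "x \<in> homog t r n"
    and z: "hact t r (\<lambda>_ i j. if i = j then 1 else 0) \<sigma> x = 0"
  shows "x = 0"
proof (rule homog_eqI[OF x fs.subspace_0[OF subspace_homog]])
  fix f assume f: "f \<in> fam t r n"
  let ?P = "PiE {..<r} (\<lambda>_. basisV t n)"
  have sk: "\<sigma> k < r" if "k < r" for k using permutes_in_image[OF s, of k] that by simp
  have fs: "f \<circ> \<sigma> \<in> fam t r n" using f sk by (auto simp: fam_def)
  have fP: "restrict f {..<r} \<in> ?P" using f by (auto simp: fam_def)
  have *: "(\<Prod>k<r. \<Prod>i<n. if (f \<circ> \<sigma>) k ! i = h (\<sigma> k) ! i then (1::'a) else 0) = (if h = restrict f {..<r} then 1 else 0)"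
    if h: "h \<in> ?P" for h
  proof -
    have "(\<Prod>k<r. \<Prod>i<n. if (f \<circ> \<sigma>) k ! i = h (\<sigma> k) ! i then (1::'a) else 0) =
      (\<Prod>k<r. if f (\<sigma> k) = h (\<sigma> k) then 1 else 0)"
      using fam_length[OF f sk] fam_length[OF PiE_fam[OF h] sk]
      by (intro prod.cong refl) (auto simp: prod_if_eq list_eq_iff_nth_eq)
    also have "\<dots> = (\<Prod>k<r. if f k = h k then 1 else 0)"
      using prod.permute[OF s, of "\<lambda>k. if f k = h k then 1 else (0::'a)"] by (simp add: o_def)
    also have "\<dots> = (if \<forall>k\<in>{..<r}. f k = h k then 1 else 0)" by (simp add: prod_if_eq)
    also have "(\<forall>k\<in>{..<r}. f k = h k) \<longleftrightarrow> h = restrict f {..<r}"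
      using PiE_arb[OF h] by (auto simp: fun_eq_iff restrict_def)
    finally show ?thesis .
  qed
  have "hact t r (\<lambda>_ i j. if i = j then 1 else 0) \<sigma> x (mk n r (f \<circ> \<sigma>)) = (\<Sum>h\<in>?P. (if h = restrict f {..<r} then 1 else 0) * x (mk n r h))"
    unfolding hact_mk[OF fs s] by (intro sum.cong refl) (simp only: *)
  also have "\<dots> = x (mk n r (restrict f {..<r}))"
    using fP by (simp add: if_distrib[of "\<lambda>z. z * _"] finite_PiE finite_basisV cong: if_cong)
  also have "mk n r (restrict f {..<r}) = mk n r f" by (rule mk_cong) simp
  finally show "x (mk n r f) = 0 (mk n r f)" using z by simp
qed

end

section \<open>Submodules of the Lie power\<close>

text \<open>The dual vectors \<open>y b\<close> form a basis: the functionals show independence, and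
  joint injectivity shows that \<open>x\<close> minus the combination with coefficients
  \<open>l b x\<close> is zero.\<close>

lemma dim_by_dual_family:
  fixes l :: "'b \<Rightarrow> ('w \<Rightarrow> 'a::field) \<Rightarrow> 'a"
  assumes E: "fs.subspace E" and B: "finite B"
    and add: "\<And>b x y. l b (x + y) = l b x + l b y" and scale: "\<And>b c x. l b (fscale c x) = c * l b x"
    and inj: "\<And>x. x \<in> E \<Longrightarrow> (\<And>b. b \<in> B \<Longrightarrow> l b x = 0) \<Longrightarrow> x = 0"
    and dual: "\<And>b. b \<in> B \<Longrightarrow> \<exists>y\<in>E. l b y = 1 \<and> (\<forall>b'\<in>B - {b}. l b' y = 0)"
  shows "fs.dim E = card B"
proof -
  from dual obtain y where yE: "\<And>b. b \<in> B \<Longrightarrow> y b \<in> E" and y1: "\<And>b. b \<in> B \<Longrightarrow> l b (y b) = 1"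
    and y0: "\<And>b b'. b \<in> B \<Longrightarrow> b' \<in> B \<Longrightarrow> b' \<noteq> b \<Longrightarrow> l b' (y b) = 0"
    by (metis DiffI singletonD)
  have l0: "l b 0 = 0" for b using scale[of b 0 0] by simp
  have lsum: "l b (\<Sum>b'\<in>B. fscale (c b') (y b')) = c b" if b: "b \<in> B" for b c
  proof -
    have "l b (\<Sum>b'\<in>B. fscale (c b') (y b')) = (\<Sum>b'\<in>B. l b (fscale (c b') (y b')))"
      using sum_comp_morphism[of "l b" "\<lambda>b'. fscale (c b') (y b')" B, OF l0 add] by (simp add: o_def)
    also have "\<dots> = (\<Sum>b'\<in>B. if b' = b then c b else 0)"
      using b y1 y0 by (intro sum.cong refl) (auto simp: scale)
    finally show ?thesis using b B by simp
  qed
  have injy: "inj_on y B"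
  proof (rule inj_onI, rule ccontr)
    fix b b' assume "b \<in> B" "b' \<in> B" "y b = y b'" "b \<noteq> b'"
    then show False using y1[of b] y0[of b' b] by simp
  qed
  have "fs.independent (y ` B)"
  proof (rule fs.independent_if_scalars_zero)
    fix f x assume z: "(\<Sum>x\<in>y ` B. fscale (f x) x) = 0" and "x \<in> y ` B"
    then obtain b where b: "b \<in> B" "x = y b" by auto
    have "(\<Sum>b\<in>B. fscale (f (y b)) (y b)) = 0" using z by (simp add: sum.reindex[OF injy])
    then show "f x = 0" using lsum[OF b(1), of "\<lambda>b. f (y b)"] b l0 by simp
  qed (use B in simp)
  moreover have "E \<subseteq> fs.span (y ` B)"
  proof
    fix x assume x: "x \<in> E"
    let ?s = "\<Sum>b\<in>B. fscale (l b x) (y b)"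
    have "x + fscale (-1) ?s = 0"
    proof (rule inj)
      show "x + fscale (-1) ?s \<in> E"
        by (intro fs.subspace_add[OF E] fs.subspace_scale[OF E] fs.subspace_sum[OF E] x yE)
      fix b assume b: "b \<in> B"
      have "l b (x + fscale (-1) ?s) = l b x + (-1) * l b x" by (simp only: add scale lsum[OF b])
      then show "l b (x + fscale (-1) ?s) = 0" by simp
    qed
    then have "x - ?s = 0" by simp
    then have "x = ?s" by (rule eq_iff_diff_eq_0[THEN iffD2])
    also have "\<dots> \<in> fs.span (y ` B)"
      by (intro fs.span_sum fs.span_scale fs.span_base) simp
    finally show "x \<in> fs.span (y ` B)" .
  qed
  moreover have "y ` B \<subseteq> E" using yE by auto
  ultimately show ?thesis by (intro fs.dim_unique[OF _ _ _ card_image[OF injy]])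
qed

text \<open>The diagonal idempotent of kind \<open>lk\<close> cuts out the Lie power, and the
  components in \<open>I\<close> determine its elements, by \<open>proj_outside\<close>.
  \<open>coef_nz\<close> allows the way back from a component to the Lie power.
  \<open>Bs \<kappa>\<close> is the set of normal forms of a column: a function of type
  \<open>\<kappa>\<close> is determined by its values there, and these values can be
  prescribed.\<close>

locale lie_setup = kinds t r n KS th ka
  for t r n :: nat and KS :: "kind set" and th :: "kind \<Rightarrow> (nat \<Rightarrow> nat) \<Rightarrow> 'a::{finite,field}" and ka :: "kind \<Rightarrow> 'a" +
  fixes lk :: kind and I :: "(nat \<Rightarrow> kind) set" and Bs :: "kind \<Rightarrow> nat list set"
  assumes t: "t \<ge> 2"
    and pw: "\<And>k. k < n \<Longrightarrow> (\<Sum>c\<in>(UNIV::'a set). c ^ k) = 0"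
    and lk: "lk \<in> KS"
    and I_idx: "I \<subseteq> idx"
    and I_sep: "i \<in> I \<Longrightarrow> j \<in> I \<Longrightarrow> sep i j"
    and I_closed: "i \<in> I \<Longrightarrow> \<sigma> permutes {..<r} \<Longrightarrow> i \<circ> \<sigma> \<in> I"
    and Lie: "LiePow t r n = {x \<in> homog t r n. dproj lk x = x}"
    and coef_nz: "i \<in> I \<Longrightarrow> coef lk i \<noteq> 0"
    and proj_outside: "x \<in> LiePow t r n \<Longrightarrow> (\<And>i. i \<in> I \<Longrightarrow> proj i x = 0) \<Longrightarrow> j \<in> idx - I \<Longrightarrow> proj j x = 0"
    and Bs_sub: "\<kappa> \<in> KS \<Longrightarrow> Bs \<kappa> \<subseteq> basisV t n"
    and Bs_determines: "\<kappa> \<in> KS \<Longrightarrow>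
      (\<And>v. v \<in> basisV t n \<Longrightarrow> (\<Sum>p\<in>Sn n. th \<kappa> p * h (permute_list p v)) = ka \<kappa> * h v) \<Longrightarrow>
      (\<And>v. v \<in> Bs \<kappa> \<Longrightarrow> h v = 0) \<Longrightarrow> v \<in> basisV t n \<Longrightarrow> h v = 0"
    and Bs_dual: "\<kappa> \<in> KS \<Longrightarrow> b \<in> Bs \<kappa> \<Longrightarrow>
      \<exists>h. (\<forall>v\<in>basisV t n. (\<Sum>p\<in>Sn n. th \<kappa> p * h (permute_list p v)) = ka \<kappa> * h v) \<and>
        h b = 1 \<and> (\<forall>b'\<in>Bs \<kappa> - {b}. h b' = 0)"
begin

section \<open>Submodules as stable sets of assignments\<close>

definition WJ :: "(nat \<Rightarrow> kind) set \<Rightarrow> (nat list list \<Rightarrow> 'a) set" where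
  "WJ J = {x \<in> LiePow t r n. \<forall>i\<in>I - J. proj i x = 0}"

definition closed :: "(nat \<Rightarrow> kind) set \<Rightarrow> bool" where
  "closed J \<longleftrightarrow> (\<forall>i\<in>J. \<forall>\<sigma>. \<sigma> permutes {..<r} \<longrightarrow> i \<circ> \<sigma> \<in> J)"

definition wt :: "(nat \<Rightarrow> kind) \<Rightarrow> nat" where
  "wt i = (\<Prod>k<r. card (Bs (i k)))"

lemma Lie_homog: "x \<in> LiePow t r n \<Longrightarrow> x \<in> homog t r n"
  by (simp add: LiePow_def)

lemma subspace_Lie: "fs.subspace (LiePow t r n :: (nat list list \<Rightarrow> 'a) set)"
proof (rule fs.subspaceI)
  show "0 \<in> (LiePow t r n :: (nat list list \<Rightarrow> 'a) set)"
    using dproj_scale[of lk 0 0] fs.subspace_0[OF subspace_homog] by (simp add: Lie)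
qed (auto simp: Lie dproj_add dproj_scale intro: fs.subspace_add[OF subspace_homog] fs.subspace_scale[OF subspace_homog])

lemma subspace_WJ: "fs.subspace (WJ J)"
proof (rule fs.subspaceI)
  show "0 \<in> WJ J" using fs.subspace_0[OF subspace_Lie] by (simp add: WJ_def)
qed (auto simp: WJ_def proj_add proj_scale intro: fs.subspace_add[OF subspace_Lie] fs.subspace_scale[OF subspace_Lie])

lemma dproj_Lie: "dproj lk u \<in> LiePow t r n"
  by (simp add: Lie dproj_homog dproj_dproj lk)

lemma Lie_zeroI:
  assumes x: "x \<in> LiePow t r n" and z: "\<And>i. i \<in> I \<Longrightarrow> proj i x = 0"
  shows "x = 0"
proof -
  have "proj j x = 0" if "j \<in> idx" for j
    using that z proj_outside[OF x z] by blast
  then have "(\<Sum>i\<in>idx. proj i x) = 0" by (simp only: sum.neutral_const cong: sum.cong)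
  then show ?thesis using sum_proj[OF Lie_homog[OF x]] by simp
qed

lemma Lie_eqI:
  assumes x: "x \<in> LiePow t r n" and y: "y \<in> LiePow t r n" and z: "\<And>i. i \<in> I \<Longrightarrow> proj i x = proj i y"
  shows "x = y"
proof -
  have "x - y = 0"
    by (rule Lie_zeroI) (use fs.subspace_diff[OF subspace_Lie x y] z in \<open>auto simp: proj_diff\<close>)
  then show ?thesis by simp
qed

text \<open>The operator of \<open>submodule_symmetrised\<close>, formed from \<open>x\<close> with
  target \<open>proj i u\<close>, has among the components in \<open>I\<close> only the one at
  \<open>i\<close>, namely a scalar times \<open>proj i u\<close>; the scalar is nonzero for
  suitable \<open>b\<close>. Since the components in \<open>I\<close> determine an element of the
  Lie power, the result is a nonzero multiple of \<open>dproj lk (proj i u)\<close>. Thus one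
  nonzero component at \<open>i\<close> yields the whole piece.\<close>

lemma component_in_submodule:
  assumes W: "fs.subspace W" "W \<subseteq> LiePow t r n"
    and stable: "\<And>g x. (\<And>k. k < r \<Longrightarrow> inv_mat t (g k)) \<Longrightarrow> x \<in> W \<Longrightarrow> hact t r g id x \<in> W"
    and x: "x \<in> W" and i: "i \<in> I" and nz: "proj i x \<noteq> 0"
  shows "dproj lk (proj i u) \<in> W"
proof -
  have ii: "i \<in> idx" using i I_idx by auto
  obtain b where b: "b \<in> fam t r n" and bnz: "proj i x (mk n r b) \<noteq> 0"
    using homog_eqI[OF proj_homog fs.subspace_0[OF subspace_homog], of i x] nz by fastforce
  define y where "y = (\<Sum>\<pi>\<in>PG r n. fscale (x (mk n r (cact (invG \<pi>) b))) (Rop t r n \<pi> (proj i u)))"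
  have yW: "y \<in> W" unfolding y_def
    by (rule submodule_symmetrised[OF _ t W(1) _ stable x b]) (use pw W(2) Lie_homog in auto)
  define s where "s = Kc i * proj i x (mk n r b)"
  have s: "s \<noteq> 0" using bnz Kc_nz[OF ii] by (simp add: s_def)
  have s_eq: "(\<Sum>\<pi>\<in>PG r n. x (mk n r (cact (invG \<pi>) b)) * chi i \<pi>) = s"
  proof -
    have "(\<Sum>\<pi>\<in>PG r n. x (mk n r (cact (invG \<pi>) b)) * chi i \<pi>) =
      (\<Sum>\<pi>\<in>PG r n. x (mk n r (cact (invG \<pi>) b)) * chi i (invG \<pi>))"
      by (intro sum.cong refl) (simp add: chi_inv ii)
    also have "\<dots> = (\<Sum>\<pi>\<in>PG r n. x (mk n r (cact \<pi> b)) * chi i \<pi>)"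
      by (rule sum_PG_inv)
    also have "\<dots> = s" using Kc_nz[OF ii] by (simp add: s_def proj_mk[OF b] mult.commute)
    finally show ?thesis .
  qed
  have "y = fscale (s / coef lk i) (dproj lk (proj i u))"
  proof (rule Lie_eqI)
    show "y \<in> LiePow t r n" using yW W(2) by auto
    show "fscale (s / coef lk i) (dproj lk (proj i u)) \<in> LiePow t r n"
      by (intro fs.subspace_scale[OF subspace_Lie] dproj_Lie)
    fix j assume jI: "j \<in> I"
    then have j: "j \<in> idx" using I_idx by auto
    have "proj j y = (\<Sum>\<pi>\<in>PG r n. fscale (x (mk n r (cact (invG \<pi>) b))) (if i = j then fscale (chi i \<pi>) (proj i u) else 0))"
      unfolding y_def proj_sum proj_scale by (intro sum.cong refl) (simp add: proj_Rop_proj[OF ii j I_sep[OF i jI]])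
    also have "\<dots> = (if i = j then fscale s (proj i u) else 0)"
      by (auto simp: s_eq[symmetric] fs.scale_sum_left)
    finally show "proj j y = proj j (fscale (s / coef lk i) (dproj lk (proj i u)))"
      using coef_nz[OF i] by (cases "i = j") (auto simp: proj_scale proj_dproj_proj[OF ii j I_sep[OF i jI]] proj_dproj_proj[OF j j I_sep[OF jI jI]])
  qed
  then have "dproj lk (proj i u) = fscale (coef lk i / s) y"
    using s coef_nz[OF i] by simp
  then show ?thesis using fs.subspace_scale[OF W(1) yW] by simp
qed

text \<open>After division by \<open>coef lk i\<close>, applying \<open>dproj lk\<close> to
  \<open>proj i x\<close> leaves its component at \<open>i\<close> unchanged and creates none at the
  other members of \<open>I\<close>, so both sides have equal components.\<close>

lemma Lie_decomp:
  assumes x: "x \<in> LiePow t r n"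
  shows "x = (\<Sum>i\<in>I. fscale (1 / coef lk i) (dproj lk (proj i x)))"
proof (rule Lie_eqI[OF x])
  show "(\<Sum>i\<in>I. fscale (1 / coef lk i) (dproj lk (proj i x))) \<in> LiePow t r n"
    by (intro fs.subspace_sum[OF subspace_Lie] fs.subspace_scale[OF subspace_Lie] dproj_Lie)
  fix j assume j: "j \<in> I"
  have fin: "finite I" using I_idx finite_idx finite_subset by blast
  have "proj j (\<Sum>i\<in>I. fscale (1 / coef lk i) (dproj lk (proj i x))) =
     (\<Sum>i\<in>I. if i = j then proj j x else 0)"
    unfolding proj_sum proj_scale using I_idx j coef_nz
    by (intro sum.cong refl) (auto simp: proj_dproj_proj subset_eq I_sep)
  then show "proj j x = proj j (\<Sum>i\<in>I. fscale (1 / coef lk i) (dproj lk (proj i x)))"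
    using fin j by simp
qed

lemma submodule_eq_WJ:
  assumes W: "Hsubmod t r n W"
  shows "\<exists>J\<subseteq>I. closed J \<and> W = WJ J"
proof -
  have sub: "fs.subspace W" "W \<subseteq> LiePow t r n"
    and stab: "\<And>g \<sigma> x. inH t r g \<sigma> \<Longrightarrow> x \<in> W \<Longrightarrow> hact t r g \<sigma> x \<in> W"
    using W by (auto simp: Hsubmod_def)
  have stable: "hact t r g id x \<in> W" if "\<And>k. k < r \<Longrightarrow> inv_mat t (g k)" "x \<in> W" for g x
    by (rule stab) (use that in \<open>auto simp: inH_def\<close>)
  \<comment> \<open>The assignments at which \<open>W\<close> has a nonzero component;
    \<open>component_in_submodule\<close> then puts each of these pieces entirely into
    \<open>W\<close>.\<close>
  define J where "J = {i \<in> I. \<exists>x\<in>W. proj i x \<noteq> 0}"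
  have "closed J" unfolding closed_def
  proof (intro ballI allI impI)
    fix i \<sigma> assume "i \<in> J" and s: "\<sigma> permutes {..<r}"
    then obtain x where x: "x \<in> W" "proj i x \<noteq> 0" and i: "i \<in> I" by (auto simp: J_def)
    let ?g = "\<lambda>_ i j. if i = j then 1 else (0::'a)"
    have "inH t r ?g \<sigma>" using s by (simp add: inH_def inv_mat_one)
    then have "hact t r ?g \<sigma> x \<in> W" by (rule stab[OF _ x(1)])
    moreover have "proj (i \<circ> \<sigma>) (hact t r ?g \<sigma> x) \<noteq> 0"
      using hact_permutation_inj[OF s proj_homog, of i x] x sub(2) Lie_homog
      by (subst hact_proj[OF s, symmetric]) auto
    ultimately show "i \<circ> \<sigma> \<in> J" using I_closed[OF i s] by (auto simp: J_def)
  qed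
  moreover have "W = WJ J"
  proof
    show "W \<subseteq> WJ J" using sub(2) by (auto simp: WJ_def J_def)
    show "WJ J \<subseteq> W"
    proof
      fix x assume x: "x \<in> WJ J"
      then have "x = (\<Sum>i\<in>I. fscale (1 / coef lk i) (dproj lk (proj i x)))"
        by (intro Lie_decomp) (simp add: WJ_def)
      also have "\<dots> \<in> W"
      proof (rule fs.subspace_sum[OF sub(1)])
        fix i assume i: "i \<in> I"
        show "fscale (1 / coef lk i) (dproj lk (proj i x)) \<in> W"
        proof (cases "i \<in> J")
          case True
          then obtain y where "y \<in> W" "proj i y \<noteq> 0" by (auto simp: J_def)
          then show ?thesis by (intro fs.subspace_scale[OF sub(1)] component_in_submodule[OF sub stable _ i])
        next
          case False
          then have "proj i x = 0" using x i by (simp add: WJ_def)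
          then show ?thesis using fs.subspace_0[OF sub(1)] dproj_scale[of lk 0 0] by simp
        qed
      qed
      finally show "x \<in> W" .
    qed
  qed
  moreover have "J \<subseteq> I" by (simp add: J_def)
  ultimately show ?thesis by (intro exI[of _ J] conjI)
qed

lemma Hsubmod_WJ:
  assumes J: "closed J"
  shows "Hsubmod t r n (WJ J)"
  unfolding Hsubmod_def
proof (intro conjI allI impI ballI)
  show "WJ J \<subseteq> LiePow t r n" by (auto simp: WJ_def)
  show "fs.subspace (WJ J)" by (rule subspace_WJ)
  fix g :: "nat \<Rightarrow> nat \<Rightarrow> nat \<Rightarrow> 'a" and \<sigma> x assume H: "inH t r g \<sigma>" and x: "x \<in> WJ J"
  have s: "\<sigma> permutes {..<r}" using H by (simp add: inH_def)
  have xL: "x \<in> LiePow t r n" using x by (simp add: WJ_def)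
  have xh: "x \<in> homog t r n" using xL by (rule Lie_homog)
  have "hact t r g \<sigma> x \<in> LiePow t r n"
    using xL hact_dproj[OF s xh, of g lk] by (simp add: Lie hact_homog)
  moreover have "proj i (hact t r g \<sigma> x) = 0" if i: "i \<in> I - J" for i
  proof -
    \<comment> \<open>The action sends the component at \<open>i \<circ> inv \<sigma>\<close> to the
      one at \<open>i\<close>; closedness of \<open>J\<close> enters contrapositively.\<close>
    have iss: "(i \<circ> inv \<sigma>) \<circ> \<sigma> = i" using s by (simp add: o_assoc[symmetric] permutes_inv_o)
    have "i \<circ> inv \<sigma> \<in> I - J"
      using i I_closed[of i "inv \<sigma>"] J s iss unfolding closed_def by (metis DiffD1 DiffD2 DiffI permutes_inv)
    then have "proj (i \<circ> inv \<sigma>) x = 0" using x by (simp add: WJ_def)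
    then show ?thesis using hact_proj[OF s xh, of g "i \<circ> inv \<sigma>"] iss by simp
  qed
  ultimately show "hact t r g \<sigma> x \<in> WJ J" by (simp add: WJ_def)
qed

lemma WJ_I: "WJ I = LiePow t r n"
  by (simp add: WJ_def)

lemma WJ_empty: "WJ {} = {0}"
  using Lie_zeroI fs.subspace_0[OF subspace_Lie] by (auto simp: WJ_def)

section \<open>Normal-form words and the dimension of a piece\<close>

lemma proj_column:
  assumes i: "i \<in> idx" and k0: "k0 < r" and f: "f \<in> fam t r n"
  shows "(\<Sum>p\<in>Sn n. th (i k0) p * proj i u (mk n r (f(k0 := permute_list p (f k0))))) =
    ka (i k0) * proj i u (mk n r f)"
proof -
  let ?N = "Sn n"
  define sg where "sg p = (\<lambda>k. if k = k0 then p else (id :: nat \<Rightarrow> nat))" for p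
  have sgPG: "sg p \<in> PG r n" if "p \<in> ?N" for p using that k0 by (auto simp: sg_def PG_def)
  have sgmk: "mk n r (f(k0 := permute_list p (f k0))) = mk n r (cact (sg p) f)" for p
    by (rule mk_cong) (simp add: cact_def sg_def)
  \<comment> \<open>Permuting column \<open>k0\<close> alone changes one factor of the coefficient,
    and the sum over \<open>p\<close> is an instance of \<open>orth\<close> in that factor with one
    argument the identity.\<close>
  have key: "(\<Sum>p\<in>?N. th (i k0) p * chi i (mulG (invG (sg p)) \<pi>)) = ka (i k0) * chi i \<pi>" if \<pi>: "\<pi> \<in> PG r n" for \<pi>
  proof -
    define R where "R = (\<Prod>k\<in>{..<r} - {k0}. th (i k) (\<pi> k))"
    have q: "\<pi> k0 permutes {..<n}" by (rule PG_perm[OF \<pi>])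
    have ik: "i k0 \<in> KS" using i k0 by (rule idxD)
    have 1: "chi i (mulG (invG (sg p)) \<pi>) = th (i k0) (inv (\<pi> k0) \<circ> p \<circ> id) * R" if "p \<in> ?N" for p
    proof -
      have p: "p permutes {..<n}" using that by simp
      have "chi i (mulG (invG (sg p)) \<pi>) = th (i k0) (inv p \<circ> \<pi> k0) * R"
        unfolding chi_def R_def using k0
        by (subst prod.remove[of _ k0]) (auto simp: mulG_def invG_def sg_def intro!: prod.cong)
      also have "th (i k0) (inv p \<circ> \<pi> k0) = th (i k0) (inv (inv p \<circ> \<pi> k0))"
        by (rule th_inv[OF ik, symmetric]) (intro permutes_compose permutes_inv p q)
      also have "inv (inv p \<circ> \<pi> k0) = inv (\<pi> k0) \<circ> p \<circ> id"
        by (simp add: o_inv_distrib[OF permutes_bij[OF permutes_inv[OF p]] permutes_bij[OF q]] permutes_inv_inv[OF p])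
      finally show ?thesis .
    qed
    have "(\<Sum>p\<in>?N. th (i k0) p * chi i (mulG (invG (sg p)) \<pi>)) =
      (\<Sum>p\<in>?N. th (i k0) p * th (i k0) (inv (\<pi> k0) \<circ> p \<circ> id)) * R"
      unfolding sum_distrib_right by (intro sum.cong refl) (simp add: 1)
    also have "\<dots> = ka (i k0) * (th (i k0) (\<pi> k0) * R)"
      by (subst orth[OF ik ik _ permutes_inv[OF q] permutes_id]) (simp_all add: th_inv[OF ik q] th_id[OF ik])
    also have "th (i k0) (\<pi> k0) * R = chi i \<pi>"
      unfolding chi_def R_def using k0 by (subst (2) prod.remove[of _ k0]) auto
    finally show ?thesis .
  qed
  have "(\<Sum>p\<in>?N. th (i k0) p * proj i u (mk n r (f(k0 := permute_list p (f k0))))) =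
    (\<Sum>p\<in>?N. th (i k0) p * Rop t r n (sg p) (proj i u) (mk n r f))"
    by (simp add: sgmk Rop_mk[OF f])
  also have "\<dots> = (\<Sum>p\<in>?N. \<Sum>\<pi>\<in>PG r n. th (i k0) p * chi i (mulG (invG (sg p)) \<pi>) * (Rop t r n \<pi> u (mk n r f) / Kc i))"
    by (intro sum.cong refl) (simp add: Rop_proj sgPG sum_fun_apply sum_distrib_left mult.assoc)
  also have "\<dots> = (\<Sum>\<pi>\<in>PG r n. (\<Sum>p\<in>?N. th (i k0) p * chi i (mulG (invG (sg p)) \<pi>)) * (Rop t r n \<pi> u (mk n r f) / Kc i))"
    by (subst sum.swap) (simp only: sum_distrib_right)
  also have "\<dots> = ka (i k0) * proj i u (mk n r f)"
    unfolding proj_def sum_fun_apply sum_distrib_left by (intro sum.cong refl) (simp add: key mult.assoc)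
  finally show ?thesis .
qed

text \<open>Columns are released from normal form one at a time: by \<open>proj_column\<close> the
  value, as a function of column \<open>m\<close>, is of type \<open>i m\<close>, so
  \<open>Bs_determines\<close> applies to it.\<close>

lemma proj_eq_zeroI:
  assumes i: "i \<in> idx" and z: "\<And>f. f \<in> fam t r n \<Longrightarrow> (\<And>k. k < r \<Longrightarrow> f k \<in> Bs (i k)) \<Longrightarrow> proj i u (mk n r f) = 0"
  shows "proj i u = 0"
proof -
  have "proj i u (mk n r f) = 0"
    if "m \<le> r" "f \<in> fam t r n" "\<And>k. m \<le> k \<Longrightarrow> k < r \<Longrightarrow> f k \<in> Bs (i k)" for m f
    using that
  proof (induction m arbitrary: f)
    case 0
    then show ?case by (intro z) auto
  next
    case (Suc m)
    have m: "m < r" using Suc.prems by simp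
    have fv: "f(m := v) \<in> fam t r n" if "v \<in> basisV t n" for v
      using that Suc.prems(2) by (auto simp: fam_def)
    have "proj i u (mk n r (f(m := f m))) = 0"
    proof (rule Bs_determines[where \<kappa> = "i m" and h = "\<lambda>v. proj i u (mk n r (f(m := v)))"])
      show "i m \<in> KS" using i m by (rule idxD)
      show "f m \<in> basisV t n" using Suc.prems(2) m by (rule famD)
      fix v
      show "(\<Sum>p\<in>Sn n. th (i m) p * proj i u (mk n r (f(m := permute_list p v)))) = ka (i m) * proj i u (mk n r (f(m := v)))"
        if "v \<in> basisV t n" using proj_column[OF i m fv[OF that], of u] by simp
      show "proj i u (mk n r (f(m := v))) = 0" if v: "v \<in> Bs (i m)"
      proof (rule Suc.IH)
        show "f(m := v) \<in> fam t r n" using v Bs_sub[OF idxD[OF i m]] by (intro fv) auto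
      qed (use v m Suc.prems in auto)
    qed
    then show ?case by simp
  qed
  from this[of r] show ?thesis
    by (intro homog_eqI[OF proj_homog fs.subspace_0[OF subspace_homog]]) simp
qed

definition BB :: "(nat \<Rightarrow> kind) \<Rightarrow> nat list list set" where
  "BB i = mk n r ` PiE {..<r} (\<lambda>k. Bs (i k))"

lemma Bs_PiE_fam: "i \<in> idx \<Longrightarrow> f \<in> PiE {..<r} (\<lambda>k. Bs (i k)) \<Longrightarrow> f \<in> PiE {..<r} (\<lambda>_. basisV t n)"
  using Bs_sub idxD by (fastforce simp: PiE_iff)

lemma card_BB: "i \<in> idx \<Longrightarrow> card (BB i) = wt i"
proof -
  assume i: "i \<in> idx"
  have "inj_on (mk n r) (PiE {..<r} (\<lambda>k. Bs (i k)))"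
    by (rule inj_on_subset[OF bij_betw_imp_inj_on[OF bij_mk[of n r t]]]) (use Bs_PiE_fam[OF i] in blast)
  then show ?thesis by (simp add: BB_def wt_def card_image card_PiE)
qed

lemma finite_BB: "i \<in> idx \<Longrightarrow> finite (BB i)"
  unfolding BB_def by (intro finite_imageI finite_PiE) (auto intro: finite_subset[OF Bs_sub[OF idxD] finite_basisV])

text \<open>The witness is a product over the columns of functions from \<open>Bs_dual\<close>. The
  sum over \<open>PG\<close> factorises, so \<open>proj i\<close> reproduces the product on words,
  and it vanishes at a normal-form word that differs in any column.\<close>

lemma dual_element:
  assumes i: "i \<in> idx" and b: "b \<in> BB i"
  shows "\<exists>y. proj i y b = 1 \<and> (\<forall>b'\<in>BB i - {b}. proj i y b' = 0)"
proof -
  obtain f where f: "f \<in> PiE {..<r} (\<lambda>k. Bs (i k))" and bf: "b = mk n r f" using b by (auto simp: BB_def)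
  have "\<forall>k. \<exists>h. k < r \<longrightarrow> (\<forall>v\<in>basisV t n. (\<Sum>p\<in>Sn n. th (i k) p * h (permute_list p v)) = ka (i k) * h v) \<and>
        h (f k) = 1 \<and> (\<forall>b'\<in>Bs (i k) - {f k}. h b' = 0)"
  proof
    fix k
    show "\<exists>h. k < r \<longrightarrow> (\<forall>v\<in>basisV t n. (\<Sum>p\<in>Sn n. th (i k) p * h (permute_list p v)) = ka (i k) * h v) \<and>
        h (f k) = 1 \<and> (\<forall>b'\<in>Bs (i k) - {f k}. h b' = 0)"
    proof (cases "k < r")
      case True
      then show ?thesis using Bs_dual[OF idxD[OF i True], of "f k"] PiE_mem[OF f, of k] by auto
    qed simp
  qed
  from choice[OF this] obtain h where h: "\<And>k v. k < r \<Longrightarrow> v \<in> basisV t n \<Longrightarrow> (\<Sum>p\<in>Sn n. th (i k) p * h k (permute_list p v)) = ka (i k) * h k v"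
    and h1: "\<And>k. k < r \<Longrightarrow> h k (f k) = 1" and h0: "\<And>k c. k < r \<Longrightarrow> c \<in> Bs (i k) \<Longrightarrow> c \<noteq> f k \<Longrightarrow> h k c = 0"
    by blast
  define y where "y vs = (\<Prod>k<r. h k (column k vs))" for vs
  have ymk: "y (mk n r c) = (\<Prod>k<r. h k (c k))" if "c \<in> fam t r n" for c
    using that by (simp add: y_def column_mk)
  have val: "proj i y (mk n r c) = (\<Prod>k<r. h k (c k))" if c: "c \<in> fam t r n" for c
  proof -
    have "proj i y (mk n r c) = (\<Sum>\<pi>\<in>PG r n. \<Prod>k<r. th (i k) (\<pi> k) * h k (permute_list (\<pi> k) (c k))) / Kc i"
      by (simp add: proj_mk[OF c] ymk cact_fam[OF _ c] chi_def prod.distrib) (simp add: cact_def)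
    also have "\<dots> = (\<Prod>k<r. ka (i k) * h k (c k)) / Kc i"
      by (subst sum_PG_prod[where F = "\<lambda>k p. th (i k) p * h k (permute_list p (c k))"]) (use h famD[OF c] in simp)
    also have "\<dots> = (\<Prod>k<r. h k (c k))" using Kc_nz[OF i] by (simp add: prod.distrib Kc_def)
    finally show ?thesis .
  qed
  note ff = PiE_fam[OF Bs_PiE_fam[OF i]]
  have "proj i y b = 1" using h1 by (simp add: bf val[OF ff[OF f]])
  moreover have "proj i y b' = 0" if b': "b' \<in> BB i - {b}" for b'
  proof -
    obtain f' where f': "f' \<in> PiE {..<r} (\<lambda>k. Bs (i k))" "b' = mk n r f'" using b' unfolding BB_def by blast
    obtain k where k: "k < r" "f' k \<noteq> f k"
      using b' f' bf mk_cong[of r f' f n] by auto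
    then have "h k (f' k) = 0" using f' by (intro h0) auto
    then show ?thesis using k by (auto simp: f'(2) val[OF ff[OF f'(1)]])
  qed
  ultimately show ?thesis by blast
qed

lemma finite_I: "finite I"
  using I_idx finite_idx finite_subset by blast

text \<open>The functionals are the values of the component at \<open>i\<close> on the normal-form
  words for \<open>i\<close>, with \<open>i\<close> running through \<open>J\<close>.\<close>

theorem dim_WJ:
  assumes J: "J \<subseteq> I"
  shows "fs.dim (WJ J) = (\<Sum>i\<in>J. wt i)"
proof -
  have Ji: "i \<in> idx" if "i \<in> J" for i using that J I_idx by auto
  have fJ: "finite J" using J finite_I finite_subset by blast
  have "fs.dim (WJ J) = card (Sigma J BB)"
  proof (rule dim_by_dual_family[where l = "\<lambda>(i, b) x. proj i x b"])
    show "fs.subspace (WJ J)" by (rule subspace_WJ)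
    show "finite (Sigma J BB)" using fJ Ji finite_BB by auto
  next
    fix x assume x: "x \<in> WJ J" and z: "\<And>b. b \<in> Sigma J BB \<Longrightarrow> (case b of (i, b) \<Rightarrow> \<lambda>x. proj i x b) x = 0"
    have "proj i x = 0" if i: "i \<in> I" for i
    proof (cases "i \<in> J")
      case True
      show ?thesis
      proof (rule proj_eq_zeroI[OF Ji[OF True]])
        fix f assume "f \<in> fam t r n" "\<And>k. k < r \<Longrightarrow> f k \<in> Bs (i k)"
        then have "restrict f {..<r} \<in> PiE {..<r} (\<lambda>k. Bs (i k))" by auto
        moreover have "mk n r (restrict f {..<r}) = mk n r f" by (rule mk_cong) simp
        ultimately have "mk n r f \<in> BB i" unfolding BB_def by (metis imageI)
        then show "proj i x (mk n r f) = 0" using z[of "(i, mk n r f)"] True by simp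
      qed
    qed (use x i in \<open>simp add: WJ_def\<close>)
    moreover have "x \<in> LiePow t r n" using x by (simp add: WJ_def)
    ultimately show "x = 0" using Lie_zeroI by metis
  next
    fix b assume "b \<in> Sigma J BB"
    then obtain i c where b: "b = (i, c)" and i: "i \<in> J" and c: "c \<in> BB i" by auto
    obtain y where y: "proj i y c = 1" "\<And>c'. c' \<in> BB i - {c} \<Longrightarrow> proj i y c' = 0"
      using dual_element[OF Ji[OF i] c] by blast
    \<comment> \<open>This lifts the dual element to the Lie power with unchanged component at
      \<open>i\<close> and zero components at the other members of \<open>I\<close>.\<close>
    define z where "z = fscale (1 / coef lk i) (dproj lk (proj i y))"
    have zL: "z \<in> LiePow t r n" unfolding z_def by (intro fs.subspace_scale[OF subspace_Lie] dproj_Lie)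
    have pz: "proj j z = (if i = j then proj i y else 0)" if "j \<in> I" for j
    proof -
      have j: "j \<in> idx" using that I_idx by auto
      have iI: "i \<in> I" using i J by auto
      show ?thesis unfolding z_def proj_scale proj_dproj_proj[OF Ji[OF i] j I_sep[OF iI that]] using coef_nz[of i] i J by auto
    qed
    have "z \<in> WJ J" using zL pz i by (auto simp: WJ_def)
    moreover have "(case b' of (j, d) \<Rightarrow> \<lambda>x. proj j x d) z = 0" if "b' \<in> Sigma J BB - {b}" for b'
    proof -
      obtain j d where "b' = (j, d)" by (cases b')
      with that b have jd: "b' = (j, d)" "j \<in> J" "d \<in> BB j" "(j, d) \<noteq> (i, c)" by auto
      then have "j \<in> I" using J by auto
      then show ?thesis using jd y(2) pz by auto
    qed
    ultimately show "\<exists>y\<in>WJ J. (case b of (i, b) \<Rightarrow> \<lambda>x. proj i x b) y = 1 \<and> (\<forall>b'\<in>Sigma J BB - {b}. (case b' of (i, b) \<Rightarrow> \<lambda>x. proj i x b) y = 0)"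
      using y(1) pz[of i] i J by (intro bexI[of _ z]) (auto simp: b)
  qed (auto simp: proj_add proj_scale)
  also have "\<dots> = (\<Sum>i\<in>J. wt i)" using fJ Ji by (simp add: card_SigmaI finite_BB card_BB)
  finally show ?thesis .
qed

lemma dim_diff:
  assumes "J \<subseteq> I"
  shows "fs.dim (LiePow t r n :: (nat list list \<Rightarrow> 'a) set) - fs.dim (WJ J) = (\<Sum>i\<in>I - J. wt i)"
  using dim_WJ[OF assms] dim_WJ[OF order_refl] sum.subset_diff[OF assms finite_I, of wt] by (simp add: WJ_I)

text \<open>The comparison in \<open>min\<close> concerns only those \<open>J\<close> whose
  complement has positive weight: pieces of weight 0, such as those with an alternating column of
  length three when \<open>t = 2\<close>, make no difference to the submodule.\<close>

theorem min_quot_dimI: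
  assumes J0: "J0 \<subseteq> I" "closed J0" "(\<Sum>i\<in>I - J0. wt i) = d" "d > 0"
    and min: "\<And>J. J \<subseteq> I \<Longrightarrow> closed J \<Longrightarrow> J \<noteq> I \<Longrightarrow> (\<Sum>i\<in>I - J. wt i) > 0 \<Longrightarrow> d \<le> (\<Sum>i\<in>I - J. wt i)"
  shows "min_quot_dim t r n TYPE('a) d"
  unfolding min_quot_dim_def
proof (intro conjI allI impI)
  have "WJ J0 \<noteq> LiePow t r n" using dim_diff[OF J0(1)] J0(3,4) by auto
  then show "\<exists>W :: (nat list list \<Rightarrow> 'a) set. Hsubmod t r n W \<and> W \<noteq> LiePow t r n \<and>
        fs.dim (LiePow t r n :: (nat list list \<Rightarrow> 'a) set) - fs.dim W = d"
    using Hsubmod_WJ[OF J0(2)] dim_diff[OF J0(1)] J0(3) by blast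
next
  fix W :: "(nat list list \<Rightarrow> 'a) set"
  assume "Hsubmod t r n W \<and> W \<noteq> LiePow t r n"
  then obtain J where J: "J \<subseteq> I" "closed J" "W = WJ J" and ne: "WJ J \<noteq> LiePow t r n"
    using submodule_eq_WJ by blast
  have "(\<Sum>i\<in>I - J. wt i) > 0"
  proof (rule ccontr)
    assume "\<not> ?thesis"
    then have w0: "wt i = 0" if "i \<in> I - J" for i using that finite_I by (simp add: sum_eq_0_iff)
    \<comment> \<open>A piece of weight 0 has no normal-form words at all and is therefore
      zero.\<close>
    have "proj i x = 0" if i: "i \<in> I - J" for i x
    proof (rule proj_eq_zeroI)
      show ii: "i \<in> idx" using i I_idx by auto
      fix f assume "\<And>k. k < r \<Longrightarrow> f k \<in> Bs (i k)"
      then have "restrict f {..<r} \<in> PiE {..<r} (\<lambda>k. Bs (i k))" by auto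
      then have "BB i \<noteq> {}" by (metis BB_def empty_iff image_is_empty)
      then show "proj i x (mk n r f) = 0" using w0[OF i] card_BB[OF ii] finite_BB[OF ii] by simp
    qed
    then show False using ne by (auto simp: WJ_def)
  qed
  moreover have "J \<noteq> I" using ne WJ_I by auto
  ultimately show "d \<le> fs.dim (LiePow t r n :: (nat list list \<Rightarrow> 'a) set) - fs.dim W"
    using min[OF J(1,2)] dim_diff[OF J(1)] J(3) by simp
qed

theorem HreducibleI:
  assumes J: "J \<subseteq> I" "closed J" "(\<Sum>i\<in>J. wt i) > 0" "(\<Sum>i\<in>I - J. wt i) > 0"
  shows "Hreducible t r n TYPE('a)"
  unfolding Hreducible_def
proof (intro exI conjI)
  show "Hsubmod t r n (WJ J)" by (rule Hsubmod_WJ[OF J(2)])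
  show "WJ J \<noteq> {0}" using dim_WJ[OF J(1)] dim_WJ[of "{}"] J(3) by (auto simp: WJ_empty)
  show "WJ J \<noteq> LiePow t r n" using dim_diff[OF J(1)] J(4) by auto
qed

theorem HirredI:
  assumes "(\<Sum>i\<in>I. wt i) > 0" and "\<And>J. J \<subseteq> I \<Longrightarrow> closed J \<Longrightarrow> J = {} \<or> J = I"
  shows "Hirred t r n TYPE('a)"
  unfolding Hirred_def
proof (intro conjI allI impI)
  show "(LiePow t r n :: (nat list list \<Rightarrow> 'a) set) \<noteq> {0}"
    using dim_WJ[OF order_refl] dim_WJ[of "{}"] assms(1) by (auto simp: WJ_empty WJ_I)
  fix W :: "(nat list list \<Rightarrow> 'a) set" assume "Hsubmod t r n W"
  then show "W = {0} \<or> W = LiePow t r n"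
    using submodule_eq_WJ[of W] assms(2) WJ_empty WJ_I by metis
qed

end

section \<open>Lie powers of degree two and three\<close>

text \<open>The relations in degrees 0 and 2 are carried along because the value of a bracket on
  three letters involves them: only the splittings of degree 1 with degree 2 survive.\<close>

lemma lieAlg_relations:
  assumes "x \<in> lieAlg t r"
  shows "x [] = 0 \<and> (\<forall>a b. x [a, b] = - x [b, a]) \<and> (\<forall>a b c. x [a, b, c] = x [c, b, a]) \<and>
    (\<forall>a b c. x [a, b, c] + x [b, c, a] + x [c, a, b] = 0)"
  using assms
proof (induction rule: lieAlg.induct)
  case (gen x)
  then have "x ws = 0" if "length ws \<noteq> 1" for ws using that by (auto simp: homog_def)
  then show ?case by simp
next
  case (add x y)
  have 2: "x [a, b] = - x [b, a]" "y [a, b] = - y [b, a]" for a b using add.IH by blast+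
  have 3: "x [a, b, c] = x [c, b, a]" "y [a, b, c] = y [c, b, a]" for a b c using add.IH by blast+
  have c: "x [a, b, c] + x [b, c, a] + x [c, a, b] = 0" "y [a, b, c] + y [b, c, a] + y [c, a, b] = 0" for a b c
    using add.IH by blast+
  show ?case
  proof (intro conjI allI)
    show "(x + y) [] = 0" using add.IH by simp
    fix a b c
    show "(x + y) [a, b] = - (x + y) [b, a]" unfolding plus_fun_apply 2[of a b] by simp
    show "(x + y) [a, b, c] = (x + y) [c, b, a]" unfolding plus_fun_apply 3[of a b c] by simp
    have "(x + y) [a, b, c] + (x + y) [b, c, a] + (x + y) [c, a, b] =
      (x [a, b, c] + x [b, c, a] + x [c, a, b]) + (y [a, b, c] + y [b, c, a] + y [c, a, b])"
      by (simp add: algebra_simps)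
    then show "(x + y) [a, b, c] + (x + y) [b, c, a] + (x + y) [c, a, b] = 0" unfolding c by simp
  qed
next
  case (smult x c)
  have 2: "x [a, b] = - x [b, a]" for a b using smult.IH by blast
  have 3: "x [a, b, c] = x [c, b, a]" for a b c using smult.IH by blast
  have c: "x [a, b, c] + x [b, c, a] + x [c, a, b] = 0" for a b c using smult.IH by blast
  show ?case
  proof (intro conjI allI)
    show "fscale c x [] = 0" using smult.IH by simp
    fix a b d
    show "fscale c x [a, b] = - fscale c x [b, a]" unfolding fscale_apply 2[of a b] by simp
    show "fscale c x [a, b, d] = fscale c x [d, b, a]" unfolding fscale_apply 3[of a b d] by simp
    show "fscale c x [a, b, d] + fscale c x [b, d, a] + fscale c x [d, a, b] = 0"
      unfolding fscale_apply distrib_left[symmetric] c by simp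
  qed
next
  case (br x y)
  have e: "x [] = 0" "y [] = 0" using br.IH by blast+
  have 2: "lbr x y [a, b] = x [a] * y [b] - y [a] * x [b]" for a b
    by (simp add: lbr_def tmult_def numeral_2_eq_2 atMost_Suc e)
  have 3: "lbr x y [a, b, c] = x [a] * y [b, c] + x [a, b] * y [c] - y [a] * x [b, c] - y [a, b] * x [c]" for a b c
    by (simp add: lbr_def tmult_def numeral_3_eq_3 numeral_2_eq_2 atMost_Suc e)
  have x: "x [a, b] = - x [b, a]" and y: "y [a, b] = - y [b, a]" for a b using br.IH by blast+
  have "lbr x y [] = 0" by (simp add: lbr_def tmult_def e)
  moreover have "lbr x y [a, b, c] = lbr x y [c, b, a]" for a b c
    unfolding 3 x[of c b] x[of b a] y[of c b] y[of b a] by (simp add: algebra_simps)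
  moreover have "lbr x y [a, b, c] + lbr x y [b, c, a] + lbr x y [c, a, b] = 0" for a b c
    unfolding 3 by (simp add: algebra_simps)
  ultimately show ?case by (simp add: 2 algebra_simps)
qed auto

definition ind :: "'w \<Rightarrow> 'w \<Rightarrow> 'a::field" where
  "ind u v = (if v = u then 1 else 0)"

lemma tmult_ind: "tmult (ind u) (ind v) = ind (u @ v)"
proof
  fix ws :: "nat list list"
  have "tmult (ind u) (ind v) ws = (\<Sum>k\<le>length ws. if k = length u \<and> ws = u @ v then 1 else (0::'a))"
    unfolding tmult_def
  proof (rule sum.cong[OF refl])
    fix k assume "k \<in> {..length ws}"
    then have "take k ws = u \<and> drop k ws = v \<longleftrightarrow> k = length u \<and> ws = u @ v"
      using append_take_drop_id[of k ws] by auto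
    then show "ind u (take k ws) * ind v (drop k ws) = (if k = length u \<and> ws = u @ v then 1 else (0::'a))"
      by (auto simp: ind_def)
  qed
  also have "\<dots> = ind (u @ v) ws" by (cases "ws = u @ v") (auto simp: ind_def)
  finally show "tmult (ind u) (ind v) ws = (ind (u @ v) ws :: 'a)" .
qed

lemma tmult_diff_left: "tmult (x - y) z = tmult x z - tmult y z"
  and tmult_diff_right: "tmult z (x - y) = tmult z x - tmult z y"
  by (auto simp: tmult_def fun_eq_iff algebra_simps sum_subtractf)

lemma lbr_ind: "lbr (ind [a]) (ind [b]) = ind [a, b] - ind [b, a]"
  by (simp add: lbr_def tmult_ind)

lemma lbr_lbr_ind:
  "lbr (lbr (ind [a]) (ind [b])) (ind [c]) = ind [a, b, c] - ind [b, a, c] - ind [c, a, b] + ind [c, b, a]"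
  by (simp add: lbr_ind) (simp add: lbr_def tmult_ind tmult_diff_left tmult_diff_right)

lemma ind_lieAlg: "w \<in> basisV t r \<Longrightarrow> ind [w] \<in> lieAlg t r"
  by (rule lieAlg.gen) (auto simp: homog_iff words_def ind_def)

lemma lieAlg_sum: "(\<And>a. a \<in> A \<Longrightarrow> F a \<in> lieAlg t r) \<Longrightarrow> (\<Sum>a\<in>A. F a) \<in> lieAlg t r"
  by (induction A rule: infinite_finite_induct) (auto intro: lieAlg.zero lieAlg.add)

lemma sum_mult_ind:
  assumes "finite A" "h ws \<in> A" "\<And>u. u \<in> A \<Longrightarrow> ws = g u \<longleftrightarrow> u = h ws"
  shows "(\<Sum>u\<in>A. x u * ind (g u) ws) = (x (h ws) :: 'a::field)"
proof -
  have "(\<Sum>u\<in>A. x u * ind (g u) ws) = (\<Sum>u\<in>A. if u = h ws then x (h ws) else 0)"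
    using assms(3) by (intro sum.cong refl) (auto simp: ind_def)
  then show ?thesis using assms by simp
qed

lemma words2: "ws \<in> words t r 2 \<longleftrightarrow> (\<exists>a b. ws = [a, b] \<and> a \<in> basisV t r \<and> b \<in> basisV t r)"
  by (auto simp: words_def numeral_2_eq_2 length_Suc_conv)

lemma words3: "ws \<in> words t r 3 \<longleftrightarrow> (\<exists>a b c. ws = [a, b, c] \<and> a \<in> basisV t r \<and> b \<in> basisV t r \<and> c \<in> basisV t r)"
  by (auto simp: words_def numeral_3_eq_3 length_Suc_conv)

text \<open>For the converse, an antisymmetric tensor is half the sum of its coefficients times the
  corresponding brackets.\<close>

lemma LiePow2:
  assumes "(2::'a::field) \<noteq> 0"
  shows "LiePow t r 2 = {x :: nat list list \<Rightarrow> 'a. x \<in> homog t r 2 \<and> (\<forall>a b. x [a, b] = - x [b, a])}"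
proof (intro equalityI subsetI)
  fix x :: "nat list list \<Rightarrow> 'a" assume "x \<in> LiePow t r 2"
  then show "x \<in> {x. x \<in> homog t r 2 \<and> (\<forall>a b. x [a, b] = - x [b, a])}"
    using lieAlg_relations[of x t r] unfolding LiePow_def by blast
next
  fix x :: "nat list list \<Rightarrow> 'a" assume "x \<in> {x. x \<in> homog t r 2 \<and> (\<forall>a b. x [a, b] = - x [b, a])}"
  then have x: "x \<in> homog t r 2" and anti: "\<And>a b. x [a, b] = - x [b, a]" by blast+
  let ?g = "\<lambda>u. [u ! 1, u ! 0]"
  have "x = (\<Sum>u\<in>words t r 2. fscale (x u / 2) (lbr (ind [u ! 0]) (ind [u ! 1])))" (is "_ = ?y")
  proof
    fix ws
    have "?y ws = (\<Sum>u\<in>words t r 2. x u / 2 * ind [u ! 0, u ! 1] ws) - (\<Sum>u\<in>words t r 2. x u / 2 * ind (?g u) ws)"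
      by (simp add: sum_fun_apply lbr_ind right_diff_distrib sum_subtractf)
    also have "\<dots> = x ws"
    proof (cases "ws \<in> words t r 2")
      case True
      then obtain a b where ws: "ws = [a, b]" "a \<in> basisV t r" "b \<in> basisV t r" by (auto simp: words2)
      have S1: "(\<Sum>u\<in>words t r 2. x u / 2 * ind [u ! 0, u ! 1] ws) = x [ws ! 0, ws ! 1] / 2"
        by (rule sum_mult_ind[where h = "\<lambda>u. [u ! 0, u ! 1]" and x = "\<lambda>u. x u / 2"]) (use ws in \<open>auto simp: finite_words words2\<close>)
      have S2: "(\<Sum>u\<in>words t r 2. x u / 2 * ind (?g u) ws) = x [ws ! 1, ws ! 0] / 2"
        by (rule sum_mult_ind[where h = ?g and x = "\<lambda>u. x u / 2"]) (use ws in \<open>auto simp: finite_words words2\<close>)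
      show ?thesis unfolding S1 S2 using anti[of b a] assms by (simp add: ws(1) field_simps)
    next
      case False
      then have "ind [u ! 0, u ! 1] ws = (0::'a)" "ind (?g u) ws = (0::'a)" if "u \<in> words t r 2" for u
        using that by (auto simp: words2 ind_def)
      then show ?thesis using homogD[OF x False] by simp
    qed
    finally show "x ws = ?y ws" ..
  qed
  also have "\<dots> \<in> lieAlg t r"
    by (intro lieAlg_sum lieAlg.smult lieAlg.br ind_lieAlg) (auto simp: words2)
  finally show "x \<in> LiePow t r 2" using x by (simp add: LiePow_def)
qed

text \<open>The converse is the Dynkin-Specht-Wever argument: replacing each word by its left-normed
  bracket multiplies a Lie element of degree 3 by 3, and the two relations are all that this
  computation uses.\<close>

lemma LiePow3:
  assumes "(3::'a::field) \<noteq> 0"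
  shows "LiePow t r 3 = {x :: nat list list \<Rightarrow> 'a. x \<in> homog t r 3 \<and> (\<forall>a b c. x [a, b, c] = x [c, b, a]) \<and>
    (\<forall>a b c. x [a, b, c] + x [b, c, a] + x [c, a, b] = 0)}" (is "_ = ?R")
proof (intro equalityI subsetI)
  fix x :: "nat list list \<Rightarrow> 'a" assume "x \<in> LiePow t r 3"
  then show "x \<in> ?R"
    using lieAlg_relations[of x t r] unfolding LiePow_def by blast
next
  fix x :: "nat list list \<Rightarrow> 'a" assume "x \<in> ?R"
  then have x: "x \<in> homog t r 3" and rv: "\<And>a b c. x [a, b, c] = x [c, b, a]"
    and cyc: "\<And>a b c. x [a, b, c] + x [b, c, a] + x [c, a, b] = 0" by blast+
  let ?S = "\<lambda>g ws. \<Sum>u\<in>words t r 3. x u / 3 * ind (g u) ws"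
  let ?g1 = "\<lambda>u. [u ! 0, u ! 1, u ! 2]" and ?g2 = "\<lambda>u. [u ! 1, u ! 0, u ! 2]"
  let ?g3 = "\<lambda>u. [u ! 2, u ! 0, u ! 1]" and ?g4 = "\<lambda>u. [u ! 2, u ! 1, u ! 0]"
  have "x = (\<Sum>u\<in>words t r 3. fscale (x u / 3) (lbr (lbr (ind [u ! 0]) (ind [u ! 1])) (ind [u ! 2])))" (is "_ = ?y")
  proof
    fix ws
    have "?y ws = ?S ?g1 ws - ?S ?g2 ws - ?S ?g3 ws + ?S ?g4 ws"
      unfolding sum_fun_apply fscale_apply lbr_lbr_ind sum_subtractf[symmetric] sum.distrib[symmetric]
      by (intro sum.cong refl) (simp add: algebra_simps)
    also have "\<dots> = x ws"
    proof (cases "ws \<in> words t r 3")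
      case True
      then obtain a b c where ws: "ws = [a, b, c]" "a \<in> basisV t r" "b \<in> basisV t r" "c \<in> basisV t r"
        by (auto simp: words3)
      have S1: "?S ?g1 ws = x [ws ! 0, ws ! 1, ws ! 2] / 3"
        by (rule sum_mult_ind[where h = ?g1 and x = "\<lambda>u. x u / 3"]) (use ws in \<open>auto simp: finite_words words3\<close>)
      have S2: "?S ?g2 ws = x [ws ! 1, ws ! 0, ws ! 2] / 3"
        by (rule sum_mult_ind[where h = ?g2 and x = "\<lambda>u. x u / 3"]) (use ws in \<open>auto simp: finite_words words3\<close>)
      have S3: "?S ?g3 ws = x [ws ! 1, ws ! 2, ws ! 0] / 3"
        by (rule sum_mult_ind[where h = "\<lambda>u. [u ! 1, u ! 2, u ! 0]" and x = "\<lambda>u. x u / 3"]) (use ws in \<open>auto simp: finite_words words3\<close>)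
      have S4: "?S ?g4 ws = x [ws ! 2, ws ! 1, ws ! 0] / 3"
        by (rule sum_mult_ind[where h = ?g4 and x = "\<lambda>u. x u / 3"]) (use ws in \<open>auto simp: finite_words words3\<close>)
      \<comment> \<open>Reversal turns \<open>x [c, b, a]\<close> into \<open>x [a, b, c]\<close>
        and \<open>x [b, a, c]\<close> into \<open>x [c, a, b]\<close>; the cyclic relation supplies
        the third copy.\<close>
      have "x [a, b, c] - x [b, a, c] - x [b, c, a] + x [c, b, a] = 3 * x [a, b, c]"
        using cyc[of a b c] rv[of c b a] rv[of b a c] by algebra
      then have "(x [a, b, c] - x [b, a, c] - x [b, c, a] + x [c, b, a]) / 3 = x [a, b, c]" using assms by simp
      then show ?thesis unfolding S1 S2 S3 S4 by (simp add: ws(1) diff_divide_distrib add_divide_distrib)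
    next
      case False
      then have "ind (?g1 u) ws = (0::'a)" "ind (?g2 u) ws = (0::'a)" "ind (?g3 u) ws = (0::'a)" "ind (?g4 u) ws = (0::'a)"
        if "u \<in> words t r 3" for u
        using that by (auto simp: words3 ind_def)
      then show ?thesis using homogD[OF x False] by simp
    qed
    finally show "x ws = ?y ws" ..
  qed
  also have "\<dots> \<in> lieAlg t r"
    by (intro lieAlg_sum lieAlg.smult lieAlg.br ind_lieAlg) (auto simp: words3)
  finally show "x \<in> LiePow t r 3" using x by (simp add: LiePow_def)
qed

section \<open>One-dimensional symmetry types\<close>

definition sgf :: "(nat \<Rightarrow> nat) \<Rightarrow> 'a::field" where
  "sgf p = of_int (sign p)"

text \<open>In the two-dimensional representation on three letters, \<open>mmf\<close> is the diagonal coefficient at the vector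
  fixed by the transposition of \<open>0\<close> and \<open>2\<close>.\<close>

definition mmf :: "(nat \<Rightarrow> nat) \<Rightarrow> 'a::field" where
  "mmf p = (if p 1 = 1 then 1 else - (1 / 2))"

text \<open>Multiplying by the sign gives an isomorphic two-dimensional representation and exchanges
  the two eigenvectors of the transposition of 0 and 2. Hence \<open>Mm\<close> is the coefficient
  at the vector negated by that transposition.\<close>

definition thf :: "kind \<Rightarrow> (nat \<Rightarrow> nat) \<Rightarrow> 'a::field" where
  "thf \<kappa> p = (case \<kappa> of Sy \<Rightarrow> 1 | Al \<Rightarrow> sgf p | Mp \<Rightarrow> mmf p | Mm \<Rightarrow> sgf p * mmf p)"

lemma thf_simps [simp]: "thf Sy p = 1" "thf Al p = sgf p" "thf Mp p = mmf p" "thf Mm p = sgf p * mmf p"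
  by (simp_all add: thf_def)

lemma sgf_id [simp]: "sgf id = 1"
  by (simp add: sgf_def)

lemma sgf_compose: "p permutes {..<n} \<Longrightarrow> q permutes {..<n} \<Longrightarrow> sgf (p \<circ> q) = sgf p * sgf q"
  by (simp add: sgf_def sign_compose permutes_imp_permutation[of "{..<n}"])

lemma sgf_inv: "p permutes {..<n} \<Longrightarrow> sgf (inv p) = sgf p"
  by (simp add: sgf_def sign_inverse permutes_imp_permutation[of "{..<n}"])

lemma sgf_square [simp]: "sgf p * sgf p = 1" "sgf p * (sgf p * x) = x"
  by (simp_all add: sgf_def mult.assoc[symmetric] of_int_mult[symmetric] del: of_int_mult)

text \<open>For \<open>Mp\<close> and \<open>Mm\<close> these are the semistandard tableaux of shape
  (2,1) for the reversed order, with corner \<open>v ! 2\<close>, row neighbour \<open>v ! 1\<close>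
  and column neighbour \<open>v ! 0\<close>.\<close>

definition Bsf :: "nat \<Rightarrow> nat \<Rightarrow> kind \<Rightarrow> nat list set" where
  "Bsf t n \<kappa> = {v \<in> basisV t n. case \<kappa> of Sy \<Rightarrow> sorted v | Al \<Rightarrow> sorted v \<and> distinct v
     | _ \<Rightarrow> v ! 0 < v ! 2 \<and> v ! 1 \<le> v ! 2}"

lemma permute_basisV: "v \<in> basisV t n \<Longrightarrow> p permutes {..<n} \<Longrightarrow> permute_list p v \<in> basisV t n"
  by (auto simp: basisV_def)

lemma sort_permute:
  assumes "v \<in> basisV t n"
  obtains p where "p permutes {..<n}" "permute_list p v = sort v"
  using mset_eq_permutation[of "sort v" v] assms by (auto simp: basisV_iff)

text \<open>For a multiplicative coefficient, shifting the summation variable by \<open>q\<close>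
  turns the eigenvalue equation at \<open>permute_list q v\<close> into \<open>c q\<close> times the
  one at \<open>v\<close>.\<close>

lemma character_equivariance:
  assumes c: "(of_nat (fact n) :: 'a::field) \<noteq> 0" and mult: "\<And>p q. p permutes {..<n} \<Longrightarrow> q permutes {..<n} \<Longrightarrow> c (p \<circ> q) = c p * c q"
    and sq: "\<And>p. c p * c p = 1"
    and h: "\<And>v. v \<in> basisV t n \<Longrightarrow> (\<Sum>p\<in>Sn n. c p * h (permute_list p v)) = of_nat (fact n) * h v"
    and v: "v \<in> basisV t n" and q: "q permutes {..<n}"
  shows "h (permute_list q v) = (c q :: 'a) * h v"
proof -
  have "of_nat (fact n) * h (permute_list q v) = (\<Sum>p\<in>Sn n. c p * h (permute_list p (permute_list q v)))"
    by (rule h[OF permute_basisV[OF v q], symmetric])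
  also have "\<dots> = c q * (\<Sum>p\<in>Sn n. c (q \<circ> p) * h (permute_list (q \<circ> p) v))"
    unfolding sum_distrib_left
  proof (intro sum.cong refl)
    fix p assume "p \<in> Sn n"
    then have p: "p permutes {..<n}" by simp
    have "permute_list (q \<circ> p) v = permute_list p (permute_list q v)"
      using p v by (intro permute_list_compose) (simp add: basisV_iff)
    then show "c p * h (permute_list p (permute_list q v)) = c q * (c (q \<circ> p) * h (permute_list (q \<circ> p) v))"
      using sq[of q] by (simp add: mult p q mult.assoc[symmetric])
  qed
  also have "(\<Sum>p\<in>Sn n. c (q \<circ> p) * h (permute_list (q \<circ> p) v)) = (\<Sum>p\<in>Sn n. c p * h (permute_list p v))"
    by (rule setum_permutations_compose_left[OF q, symmetric])
  also have "\<dots> = of_nat (fact n) * h v" by (rule h[OF v])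
  finally show ?thesis using c by (simp add: mult.left_commute)
qed

lemma Sy_determines:
  assumes c: "(of_nat (fact n) :: 'a::field) \<noteq> 0"
    and h: "\<And>v. v \<in> basisV t n \<Longrightarrow> (\<Sum>p\<in>Sn n. thf Sy p * h (permute_list p v)) = of_nat (fact n) * h v"
    and z: "\<And>v. v \<in> Bsf t n Sy \<Longrightarrow> h v = (0::'a)" and v: "v \<in> basisV t n"
  shows "h v = 0"
proof -
  obtain p where p: "p permutes {..<n}" "permute_list p v = sort v" using v by (rule sort_permute)
  have "h (permute_list p v) = thf Sy p * h v"
    by (rule character_equivariance[OF c _ _ h v p(1)]) auto
  moreover have "sort v \<in> Bsf t n Sy" using v by (simp add: Bsf_def basisV_def)
  ultimately show ?thesis using z p(2) by simp
qed

lemma Sy_dual: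
  assumes b: "b \<in> Bsf t n Sy"
  shows "\<exists>h. (\<forall>v\<in>basisV t n. (\<Sum>p\<in>Sn n. thf Sy p * h (permute_list p v)) = of_nat (fact n) * h v) \<and>
        h b = (1::'a::field) \<and> (\<forall>b'\<in>Bsf t n Sy - {b}. h b' = 0)"
proof (intro exI[of _ "\<lambda>v. if mset v = mset b then 1 else 0"] conjI ballI)
  fix v assume "v \<in> basisV t n"
  then have "mset (permute_list p v) = mset v" if "p permutes {..<n}" for p
    using that by (simp add: basisV_iff)
  then show "(\<Sum>p\<in>Sn n. thf Sy p * (if mset (permute_list p v) = mset b then 1 else (0::'a))) =
    of_nat (fact n) * (if mset v = mset b then 1 else 0)"
    by (simp add: card_permutations)
next
  fix b' assume "b' \<in> Bsf t n Sy - {b}"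
  then show "(if mset b' = mset b then 1 else (0::'a)) = 0"
    using b properties_for_sort[of b b'] properties_for_sort[of b' b'] by (auto simp: Bsf_def)
qed simp

lemma Al_determines:
  assumes c: "(of_nat (fact n) :: 'a::field) \<noteq> 0" and two: "(2::'a) \<noteq> 0"
    and h: "\<And>v. v \<in> basisV t n \<Longrightarrow> (\<Sum>p\<in>Sn n. thf Al p * h (permute_list p v)) = of_nat (fact n) * h v"
    and z: "\<And>v. v \<in> Bsf t n Al \<Longrightarrow> h v = (0::'a)" and v: "v \<in> basisV t n"
  shows "h v = 0"
proof -
  have eq: "h (permute_list p v) = sgf p * h v" if "p permutes {..<n}" for p
    by (rule character_equivariance[where c = sgf, OF c sgf_compose[where n = n] sgf_square(1) h[unfolded thf_simps] v that])
  show ?thesis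
  proof (cases "distinct v")
    case True
    obtain p where p: "p permutes {..<n}" "permute_list p v = sort v" using v by (rule sort_permute)
    have "sort v \<in> Bsf t n Al" using v True by (simp add: Bsf_def basisV_def)
    then have "sgf p * h v = 0" using z eq[OF p(1)] p(2) by simp
    then show ?thesis by (metis mult_zero_right sgf_square(2))
  next
    case False
    then obtain i j where ij: "i < n" "j < n" "i \<noteq> j" "v ! i = v ! j"
      using v by (auto simp: distinct_conv_nth basisV_iff)
    let ?q = "transpose i j"
    have q: "?q permutes {..<n}" using ij by (intro permutes_swap_id) auto
    have perm: "permute_list ?q v = v"
      using ij v by (intro nth_equalityI) (auto simp: permute_list_def basisV_iff transpose_def)
    have sg: "sgf ?q = (-1::'a)" using ij(3) by (simp add: sgf_def sign_swap_id)
    have "h v = -1 * h v" using eq[OF q] unfolding perm sg .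
    then have "h v + h v = 0" by (metis add.right_inverse mult_minus1)
    then show ?thesis using two by (metis mult_2 mult_eq_0_iff)
  qed
qed

lemma Al_dual:
  assumes b: "b \<in> Bsf t n Al"
  shows "\<exists>h. (\<forall>v\<in>basisV t n. (\<Sum>p\<in>Sn n. thf Al p * h (permute_list p v)) = of_nat (fact n) * h v) \<and>
        h b = (1::'a::field) \<and> (\<forall>b'\<in>Bsf t n Al - {b}. h b' = 0)"
proof -
  let ?N = "Sn n"
  \<comment> \<open>The signed indicator of the orbit of \<open>b\<close>. A sorted word without
    repetition has trivial stabiliser, which gives the value 1 at \<open>b\<close>.\<close>
  define h where "h v = (\<Sum>p\<in>?N. sgf p * (if permute_list p v = b then 1 else (0::'a)))" for v
  have fin: "finite ?N" by (simp add: finite_permutations)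
  have bl: "length b = n" "sorted b" "distinct b" using b by (auto simp: Bsf_def basisV_iff)
  have "(\<Sum>q\<in>?N. thf Al q * h (permute_list q v)) = of_nat (fact n) * h v" if v: "v \<in> basisV t n" for v
  proof -
    have "(\<Sum>q\<in>?N. thf Al q * h (permute_list q v)) = (\<Sum>q\<in>?N. h v)"
    proof (rule sum.cong[OF refl])
      fix q assume "q \<in> ?N"
      then have q: "q permutes {..<n}" by simp
      have "h v = (\<Sum>p\<in>?N. sgf (q \<circ> p) * (if permute_list (q \<circ> p) v = b then 1 else 0))"
        unfolding h_def by (rule setum_permutations_compose_left[OF q])
      also have "\<dots> = thf Al q * h (permute_list q v)"
        unfolding h_def sum_distrib_left
      proof (intro sum.cong refl)
        fix p assume "p \<in> ?N"
        then have p: "p permutes {..<n}" by simp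
        have "permute_list (q \<circ> p) v = permute_list p (permute_list q v)"
          using p v by (intro permute_list_compose) (simp add: basisV_iff)
        then show "sgf (q \<circ> p) * (if permute_list (q \<circ> p) v = b then 1 else 0) =
          thf Al q * (sgf p * (if permute_list p (permute_list q v) = b then 1 else (0::'a)))"
          by (simp add: sgf_compose[OF q p])
      qed
      finally show "thf Al q * h (permute_list q v) = h v" ..
    qed
    then show ?thesis by (simp add: card_permutations)
  qed
  moreover have "h b = 1"
  proof -
    have "permute_list p b = b \<longleftrightarrow> p = id" if p: "p \<in> ?N" for p
    proof
      assume *: "permute_list p b = b"
      show "p = id"
      proof
        fix i show "p i = id i"
        proof (cases "i < n")
          case True
          have pi: "p i < n" using permutes_in_image[of p "{..<n}" i] p True by simp
          have "b ! p i = b ! i" using arg_cong[OF *, of "\<lambda>l. l ! i"] True bl by (simp add: permute_list_def)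
          then show ?thesis using nth_eq_iff_index_eq[OF bl(3)] True pi bl by simp
        qed (use p in \<open>simp add: permutes_not_in\<close>)
      qed
    qed simp
    then have "h b = (\<Sum>p\<in>?N. if p = id then 1 else 0)"
      unfolding h_def by (intro sum.cong refl) simp
    then show ?thesis using fin by (simp add: permutes_id)
  qed
  moreover have "h b' = 0" if "b' \<in> Bsf t n Al - {b}" for b'
  proof -
    have "permute_list p b' \<noteq> b" if p: "p \<in> ?N" for p
    proof
      assume "permute_list p b' = b"
      moreover have "length b' = n" "sorted b'" using \<open>b' \<in> Bsf t n Al - {b}\<close> by (auto simp: Bsf_def basisV_iff)
      ultimately have "mset b = mset b'" using p by auto
      then have "b = b'" using bl \<open>sorted b'\<close> by (metis properties_for_sort)
      then show False using \<open>b' \<in> Bsf t n Al - {b}\<close> by simp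
    qed
    then show ?thesis unfolding h_def by (intro sum.neutral) auto
  qed
  ultimately show ?thesis by blast
qed

lemma card_Bsf_Al: "card (Bsf t n Al) = t choose n"
proof -
  have "bij_betw set (Bsf t n Al) {S. S \<subseteq> {..<t} \<and> card S = n}"
  proof (rule bij_betw_byWitness[where f' = sorted_list_of_set])
    show "\<forall>v\<in>Bsf t n Al. sorted_list_of_set (set v) = v"
      by (auto simp: Bsf_def sorted_list_of_set.idem_if_sorted_distinct)
    have fin: "finite S" if "S \<subseteq> {..<t}" for S using that finite_lessThan by (rule finite_subset)
    show "\<forall>S\<in>{S. S \<subseteq> {..<t} \<and> card S = n}. set (sorted_list_of_set S) = S"
      by (simp add: fin)
    show "set ` Bsf t n Al \<subseteq> {S. S \<subseteq> {..<t} \<and> card S = n}"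
      by (auto simp: Bsf_def basisV_def distinct_card)
    show "sorted_list_of_set ` {S. S \<subseteq> {..<t} \<and> card S = n} \<subseteq> Bsf t n Al"
    proof clarify
      fix S assume S: "S \<subseteq> {..<t}" "n = card S"
      then show "sorted_list_of_set S \<in> Bsf t (card S) Al"
        using fin[OF S(1)] by (auto simp: Bsf_def basisV_def)
    qed
  qed
  then have "card (Bsf t n Al) = card {S. S \<subseteq> {..<t} \<and> card S = n}" by (rule bij_betw_same_card)
  then show ?thesis by (simp add: n_subsets)
qed

text \<open>Applying one permutation to every column permutes the rows, which are the tensor
  positions.\<close>

lemma (in kinds) Rop_diag:
  assumes vs: "vs \<in> words t r n" and p: "p permutes {..<n}"
  shows "Rop t r n (diagG r p) u vs = u (permute_list p vs)"
proof -
  have len: "length vs = n" using vs by (simp add: words_def)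
  have pw: "permute_list p vs \<in> words t r n" using vs p by (auto simp: words_def)
  have "mk n r (cact (diagG r p) (\<lambda>k. column k vs)) = mk n r (\<lambda>k. column k (permute_list p vs))"
    using p len by (intro mk_cong) (simp add: cact_def diagG_def column_def permute_list_map)
  then show ?thesis using vs by (simp add: Rop_def mk_column[OF pw])
qed

lemma (in kinds) dproj_words:
  "vs \<in> words t r n \<Longrightarrow> dproj \<kappa> u vs = (\<Sum>p\<in>Sn n. th \<kappa> p / ka \<kappa> * u (permute_list p vs))"
  by (simp add: dproj_def sum_fun_apply Rop_diag)

section \<open>The exterior square\<close>

lemma lessThan2: "{..<2::nat} = {0, 1}" by auto

lemma transpose01_neq_id: "transpose 0 1 \<noteq> (id :: nat \<Rightarrow> nat)"
  by (metis id_apply transpose_apply_first zero_neq_one)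

lemma sum_permutes2: "(\<Sum>p\<in>Sn 2. F p) = F id + F (transpose 0 (1::nat))"
proof -
  have "{p. p permutes {..<2::nat}} = {id, transpose 0 1}"
    unfolding lessThan2 permutes_doubleton_iff by auto
  then show ?thesis using transpose01_neq_id by (simp add: eq_commute)
qed

lemma transpose01_permutes: "transpose 0 1 permutes {..<2::nat}"
  by (rule permutes_swap_id) auto

lemma sgf_transpose: "a \<noteq> b \<Longrightarrow> sgf (transpose a b) = -1"
  by (simp add: sgf_def sign_swap_id)

lemma neg_eq_self_imp_zero: "(2::'a::field) \<noteq> 0 \<Longrightarrow> - a = a \<Longrightarrow> a = (0::'a)"
  by (metis add.right_inverse mult_2 mult_eq_0_iff)

lemma permute_list_pair: "permute_list (transpose 0 1) [a, b] = [b, a]"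
  by (simp add: permute_list_def)

lemma kinds2:
  assumes two: "(2::'a::{finite,field}) \<noteq> 0"
  shows "kinds 2 {Sy, Al} (thf :: kind \<Rightarrow> _ \<Rightarrow> 'a) (\<lambda>_. 2)"
proof
  fix \<kappa> \<mu> h p
  assume *: "\<kappa> \<in> {Sy, Al}" "\<mu> \<in> {Sy, Al}" "h permutes {..<2::nat}" "p permutes {..<2::nat}"
  have sg: "sgf (h \<circ> s \<circ> p) = sgf h * sgf s * (sgf p :: 'a)" if "s permutes {..<2}" for s
    using that *(3,4) by (simp add: sgf_compose[where n = 2] permutes_compose)
  show "(\<Sum>s\<in>Sn 2. thf \<kappa> s * thf \<mu> (h \<circ> s \<circ> p)) = (if \<kappa> = \<mu> then 2 * thf \<kappa> h * (thf \<kappa> p :: 'a) else 0)"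
    using *(1,2) sg[OF permutes_id] sg[OF transpose01_permutes]
    by (auto simp: sum_permutes2 sgf_transpose simp del: One_nat_def)
next
  fix p assume "p permutes {..<2::nat}"
  then have "p = id \<or> p = transpose 0 1" unfolding lessThan2 permutes_doubleton_iff .
  then show "(\<Sum>\<kappa>\<in>{Sy, Al}. thf \<kappa> p / 2) = (if p = id then 1 else (0::'a))"
    using two transpose01_neq_id by (auto simp: sgf_transpose simp del: One_nat_def)
next
  fix \<kappa> p assume "\<kappa> \<in> {Sy, Al}" "p permutes {..<2::nat}"
  then show "thf \<kappa> (inv p) = (thf \<kappa> p :: 'a)" by (auto simp: sgf_inv)
qed (use two in auto)

abbreviation aset :: "nat \<Rightarrow> (nat \<Rightarrow> kind) \<Rightarrow> nat set" where
  "aset r i \<equiv> {k. k < r \<and> i k = Al}"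

text \<open>The transposition applied to all columns at once has as its coefficient -1 to the number
  of alternating columns; antisymmetry requires this to be -1.\<close>

definition I2 :: "nat \<Rightarrow> (nat \<Rightarrow> kind) set" where
  "I2 r = {i. (\<forall>k<r. i k \<in> {Sy, Al}) \<and> (\<forall>k\<ge>r. i k = Sy) \<and> odd (card (aset r i))}"

lemma prod_sgf:
  fixes r :: nat
  assumes "\<forall>k<r. i k \<in> {Sy, Al}"
  shows "(\<Prod>k<r. thf (i k) (transpose 0 1)) = (-1::'a::field) ^ card (aset r i)"
proof -
  have "(\<Prod>k<r. thf (i k) (transpose 0 1)) = (\<Prod>k\<in>{..<r}. if i k = Al then -1 else (1::'a))"
    using assms by (intro prod.cong refl) (auto simp: sgf_transpose simp del: One_nat_def)
  also have "\<dots> = (\<Prod>k\<in>{k\<in>{..<r}. i k = Al}. -1)" by (rule prod.inter_filter[symmetric]) simp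
  finally show ?thesis by simp
qed

lemma card_Al_compose:
  fixes r :: nat
  assumes "\<sigma> permutes {..<r}"
  shows "card (aset r (i \<circ> \<sigma>)) = card (aset r i)"
proof -
  have lt: "\<sigma> k < r \<longleftrightarrow> k < r" for k using permutes_in_image[OF assms, of k] by simp
  have "aset r i = \<sigma> ` aset r (i \<circ> \<sigma>)"
  proof (intro equalityI subsetI)
    fix k assume "k \<in> aset r i"
    then show "k \<in> \<sigma> ` aset r (i \<circ> \<sigma>)"
      using lt[of "inv \<sigma> k"] by (intro image_eqI[of _ _ "inv \<sigma> k"]) (simp_all add: permutes_inverses[OF assms])
  qed (use lt in auto)
  then show ?thesis using permutes_inj_on[OF assms] by (simp add: card_image)
qed

lemma lie_setup2:
  assumes two: "(2::'a::{finite,field}) \<noteq> 0" and t: "t \<ge> 2"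
  shows "lie_setup t r 2 {Sy, Al} (thf :: kind \<Rightarrow> _ \<Rightarrow> 'a) (\<lambda>_. 2) Al (I2 r) (Bsf t 2)"
proof -
  interpret K: kinds t r 2 "{Sy, Al}" "thf :: kind \<Rightarrow> _ \<Rightarrow> 'a" "\<lambda>_. 2" by (rule kinds2[OF two])
  let ?\<tau> = "transpose 0 (1::nat)"
  have f2: "(of_nat (fact 2) :: 'a) = 2" by (simp add: fact_numeral)
  have Lie: "LiePow t r 2 = {x \<in> homog t r 2. K.dproj Al x = x}"
  proof -
    have dp: "K.dproj Al x [a, b] = (x [a, b] - x [b, a]) / 2" if "[a, b] \<in> words t r 2" for x a b
      using that by (simp add: K.dproj_words sum_permutes2 sgf_transpose permute_list_pair diff_divide_distrib del: One_nat_def)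
    have sw: "[a, b] \<in> words t r 2 \<longleftrightarrow> [b, a] \<in> words t r 2" for a b by (auto simp: words2)
    have "(\<forall>a b. x [a, b] = - x [b, a]) \<longleftrightarrow> K.dproj Al x = x" if x: "x \<in> homog t r 2" for x
    proof
      assume anti: "\<forall>a b. x [a, b] = - x [b, a]"
      show "K.dproj Al x = x"
      proof
        fix ws show "K.dproj Al x ws = x ws"
        proof (cases "ws \<in> words t r 2")
          case True
          then obtain a b where ws: "ws = [a, b]" by (auto simp: words2)
          show ?thesis using anti[rule_format, of b a] two dp[OF True[unfolded ws], of x] by (simp add: ws field_simps)
        next
          case False
          then show ?thesis using homogD[OF x] homogD[OF K.dproj_homog] by simp
        qed
      qed
    next
      assume eq: "K.dproj Al x = x"
      show "\<forall>a b. x [a, b] = - x [b, a]"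
      proof (intro allI)
        fix a b
        show "x [a, b] = - x [b, a]"
        proof (cases "[a, b] \<in> words t r 2")
          case True
          have "(x [a, b] - x [b, a]) / 2 = x [a, b]" using dp[OF True, of x] unfolding eq ..
          then have "x [a, b] - x [b, a] = 2 * x [a, b]" using two by (simp add: field_simps)
          then show ?thesis by algebra
        next
          case False
          then show ?thesis using homogD[OF x False] homogD[OF x, of "[b, a]"] sw[of a b] by simp
        qed
      qed
    qed
    then show ?thesis unfolding LiePow2[OF two] by blast
  qed
  \<comment> \<open>For exponent 1 the multiplier 2 serves: it is nonzero by assumption and never
    equal to 1.\<close>
  have pw: "(\<Sum>c\<in>(UNIV::'a set). c ^ k) = 0" if "k < 2" for k
  proof (cases k)
    case 0
    then show ?thesis using sum_one_field_zero by simp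
  next
    case (Suc m)
    then have "k = 1" using that by simp
    moreover have "(\<Sum>c\<in>(UNIV::'a set). c ^ 1) = 0"
      by (rule sum_power_field_zero[OF two]) (metis add_cancel_right_right one_add_one power_one_right zero_neq_one)
    ultimately show ?thesis by simp
  qed
  \<comment> \<open>With an even number of alternating columns the simultaneous transposition fixes
    the component, while antisymmetry of \<open>x\<close> negates it.\<close>
  have outside: "K.proj j x = 0" if x: "x \<in> LiePow t r 2" and j: "j \<in> K.idx - I2 r" for x j
  proof -
    have ev: "even (card (aset r j))" and js: "\<forall>k<r. j k \<in> {Sy, Al}"
      using j by (auto simp: K.idx_def I2_def)
    have d: "diagG r ?\<tau> \<in> PG r 2" by (rule diagG_PG[OF transpose01_permutes])
    have "Rop t r 2 (diagG r ?\<tau>) x = fscale (-1) x"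
    proof
      fix ws
      show "Rop t r 2 (diagG r ?\<tau>) x ws = fscale (-1) x ws"
      proof (cases "ws \<in> words t r 2")
        case True
        then obtain a b where ws: "ws = [a, b]" by (auto simp: words2)
        have "x [b, a] = - x [a, b]" using x unfolding LiePow2[OF two] by blast
        then show ?thesis using K.Rop_diag[OF True transpose01_permutes, of x]
          by (simp add: ws permute_list_pair del: One_nat_def)
      next
        case False
        then show ?thesis using homogD[OF Rop_homog] homogD[of x t r 2] x by (simp add: LiePow_def)
      qed
    qed
    then have "fscale (-1) (K.proj j x) = K.proj j (Rop t r 2 (diagG r ?\<tau>) x)" by (simp only: K.proj_scale)
    also have "\<dots> = (\<Sum>\<pi>\<in>PG r 2. fscale (K.chi j (mulG \<pi> (invG (diagG r ?\<tau>))) / K.Kc j) (Rop t r 2 \<pi> x))"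
      by (rule K.proj_Rop[OF d])
    also have "\<dots> = K.proj j x" unfolding K.proj_def
    proof (intro sum.cong refl arg_cong2[where f = fscale] arg_cong2[where f = "(/)"])
      fix \<pi> assume \<pi>: "\<pi> \<in> PG r 2"
      have "K.chi j (mulG \<pi> (invG (diagG r ?\<tau>))) = (\<Prod>k<r. thf (j k) (\<pi> k) * thf (j k) ?\<tau>)"
        unfolding K.chi_def mulG_def invG_def diagG_def
      proof (intro prod.cong refl)
        fix k assume k: "k \<in> {..<r}"
        then have "j k = Sy \<or> j k = Al" using js by auto
        then show "thf (j k) (\<pi> k \<circ> inv (if k < r then ?\<tau> else id)) = (thf (j k) (\<pi> k) * thf (j k) ?\<tau> :: 'a)"
          using k sgf_compose[OF PG_perm[OF \<pi>] transpose01_permutes] by (auto simp del: One_nat_def)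
      qed
      also have "\<dots> = K.chi j \<pi> * (-1) ^ card (aset r j)"
        unfolding prod.distrib K.chi_def prod_sgf[OF js] ..
      finally show "K.chi j (mulG \<pi> (invG (diagG r ?\<tau>))) = K.chi j \<pi>" using ev by simp
    qed
    finally have eq: "fscale (-1) (K.proj j x) = K.proj j x" .
    show ?thesis
    proof
      fix ws
      have "- K.proj j x ws = K.proj j x ws" using fun_cong[OF eq, of ws] by simp
      then show "K.proj j x ws = 0 ws" using two by (simp add: neg_eq_self_imp_zero)
    qed
  qed
  show ?thesis
  proof unfold_locales
    show "K.sep i j" if "i \<in> I2 r" "j \<in> I2 r" for i j
    proof (cases "i = j")
      case False
      then obtain k where k: "i k \<noteq> j k" by auto
      then have kr: "k < r" using that unfolding I2_def by (cases "k < r") auto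
      then have "i k \<in> {Sy, Al}" "j k \<in> {Sy, Al}" using that unfolding I2_def by blast+
      then show ?thesis using k kr unfolding K.sep_def by (intro disjI2 exI[of _ k]) auto
    qed (simp add: K.sep_def)
    show "I2 r \<subseteq> K.idx" by (auto simp: I2_def K.idx_def)
    show "i \<circ> \<sigma> \<in> I2 r" if "i \<in> I2 r" "\<sigma> permutes {..<r}" for i \<sigma>
      using K.idx_perm[of i \<sigma>] card_Al_compose[OF that(2), of i] that by (simp add: I2_def K.idx_def)
    show "K.coef Al i \<noteq> 0" if "i \<in> I2 r" for i
    proof -
      have "K.chi i (diagG r ?\<tau>) = (\<Prod>k<r. thf (i k) ?\<tau>)" by (simp add: K.chi_def diagG_def)
      also have "\<dots> = -1" using that prod_sgf[of r i] by (simp add: I2_def)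
      finally have "K.chi i (diagG r ?\<tau>) = -1" .
      moreover have "K.chi i (diagG r id) = 1"
        using that by (auto simp: K.chi_def diagG_def I2_def intro!: prod.neutral)
      ultimately show ?thesis using two by (simp add: K.coef_def sum_permutes2 sgf_transpose del: One_nat_def)
    qed
    show "Bsf t 2 \<kappa> \<subseteq> basisV t 2" for \<kappa> by (auto simp: Bsf_def)
    show "h v = 0" if "\<kappa> \<in> {Sy, Al}"
      "\<And>v. v \<in> basisV t 2 \<Longrightarrow> (\<Sum>p\<in>Sn 2. thf \<kappa> p * h (permute_list p v)) = 2 * (h v :: 'a)"
      "\<And>v. v \<in> Bsf t 2 \<kappa> \<Longrightarrow> h v = 0" "v \<in> basisV t 2" for \<kappa> h v
      using that Sy_determines[of 2 t h v] Al_determines[of 2 t h v] two unfolding f2 by blast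
    show "\<exists>h. (\<forall>v\<in>basisV t 2. (\<Sum>p\<in>Sn 2. thf \<kappa> p * h (permute_list p v)) = 2 * (h v :: 'a)) \<and>
        h b = 1 \<and> (\<forall>b'\<in>Bsf t 2 \<kappa> - {b}. h b' = 0)" if "\<kappa> \<in> {Sy, Al}" "b \<in> Bsf t 2 \<kappa>" for \<kappa> b
      using that Sy_dual[of b t 2, where 'a = 'a] Al_dual[of b t 2, where 'a = 'a] unfolding f2 by blast
  qed (use t pw Lie outside in auto)
qed

section \<open>Levels: assignments with a given number of alternating columns\<close>

lemma card_Bsf_Sy2: "card (Bsf t 2 Sy) = (t + 1) choose 2"
proof -
  have B: "Bsf t 2 Sy = Bsf t 2 Al \<union> (\<lambda>a. [a, a]) ` {..<t}"
    by (auto simp: Bsf_def basisV_def numeral_2_eq_2 length_Suc_conv)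
  have fin: "finite (Bsf t 2 Al)" by (rule finite_subset[OF _ finite_basisV[of t 2]]) (auto simp: Bsf_def)
  have "card (Bsf t 2 Sy) = card (Bsf t 2 Al) + card ((\<lambda>a. [a, a]) ` {..<t})"
    unfolding B using fin by (intro card_Un_disjoint) (auto simp: Bsf_def)
  also have "card ((\<lambda>a. [a, a]) ` {..<t}) = t" by (simp add: card_image inj_on_def)
  finally show ?thesis by (simp add: card_Bsf_Al numeral_2_eq_2)
qed

lemma permutes_extend:
  assumes "finite R" "A \<subseteq> R" "B \<subseteq> R" "card A = card B"
  obtains \<sigma> where "\<sigma> permutes R" "\<sigma> ` A = B"
proof -
  have fin: "finite A" "finite B" using assms finite_subset by blast+
  have "card (R - A) = card (R - B)" using assms fin by (simp add: card_Diff_subset)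
  then obtain g where g: "bij_betw g (R - A) (R - B)" using assms(1) by (metis bij_betw_iff_card finite_Diff)
  obtain f where f: "bij_betw f A B" using assms(4) fin by (metis bij_betw_iff_card)
  define \<sigma> where "\<sigma> x = (if x \<in> A then f x else if x \<in> R then g x else x)" for x
  have 1: "bij_betw \<sigma> A B" using f by (subst bij_betw_cong[of A _ f]) (auto simp: \<sigma>_def)
  have 2: "bij_betw \<sigma> (R - A) (R - B)" using g by (subst bij_betw_cong[of "R - A" _ g]) (auto simp: \<sigma>_def)
  have "bij_betw \<sigma> (A \<union> (R - A)) (B \<union> (R - B))" by (rule bij_betw_combine[OF 1 2]) auto
  then have "bij_betw \<sigma> R R" using assms(2,3) by (simp add: Un_absorb1)
  then have "\<sigma> permutes R" by (rule bij_imp_permutes) (use assms in \<open>auto simp: \<sigma>_def\<close>)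
  moreover have "\<sigma> ` A = B" using 1 by (simp add: bij_betw_def)
  ultimately show ?thesis by (rule that)
qed

text \<open>An assignment is determined by its set of alternating columns, and permutations act
  transitively on subsets of equal size. So the orbits are the levels.\<close>

lemma I2_transitive:
  assumes i: "i \<in> I2 r" and j: "j \<in> I2 r" and c: "card (aset r i) = card (aset r j)"
  obtains \<sigma> where "\<sigma> permutes {..<r}" "j = i \<circ> \<sigma>"
proof -
  let ?A = "aset r"
  obtain \<sigma> where s: "\<sigma> permutes {..<r}" "\<sigma> ` ?A j = ?A i"
    using permutes_extend[of "{..<r}" "?A j" "?A i"] c by auto
  have "j k = i (\<sigma> k)" for k
  proof (cases "k < r")
    case True
    then have sk: "\<sigma> k < r" using permutes_in_image[OF s(1), of k] by simp
    have "k \<in> ?A j \<longleftrightarrow> \<sigma> k \<in> ?A i" unfolding s(2)[symmetric] using permutes_inj[OF s(1)] by (auto dest: injD)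
    moreover have "j k \<in> {Sy, Al}" "i (\<sigma> k) \<in> {Sy, Al}" using True sk i j unfolding I2_def by blast+
    ultimately show ?thesis using True sk by auto
  next
    case False
    then show ?thesis using permutes_not_in[OF s(1), of k] i j by (simp add: I2_def)
  qed
  then show ?thesis using that[OF s(1)] by (auto simp: fun_eq_iff)
qed

lemma card_I2:
  assumes "odd s"
  shows "card {i \<in> I2 r. card (aset r i) = s} = r choose s"
proof -
  have "bij_betw (\<lambda>i. aset r i) {i \<in> I2 r. card (aset r i) = s} {S. S \<subseteq> {..<r} \<and> card S = s}"
  proof (rule bij_betw_byWitness[where f' = "\<lambda>S k. if k \<in> S then Al else Sy"])
    show "\<forall>i\<in>{i \<in> I2 r. card (aset r i) = s}. (\<lambda>k. if k \<in> aset r i then Al else Sy) = i"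
    proof (intro ballI ext)
      fix i k assume "i \<in> {i \<in> I2 r. card (aset r i) = s}"
      then show "(if k \<in> aset r i then Al else Sy) = i k"
        by (cases "k < r") (auto simp: I2_def)
    qed
    have S: "{k. k < r \<and> (if k \<in> S then Al else Sy) = Al} = S" if "S \<subseteq> {..<r}" for S using that by auto
    then show "\<forall>S\<in>{S. S \<subseteq> {..<r} \<and> card S = s}. {k. k < r \<and> (if k \<in> S then Al else Sy) = Al} = S" by blast
    show "(\<lambda>i. aset r i) ` {i \<in> I2 r. card (aset r i) = s} \<subseteq> {S. S \<subseteq> {..<r} \<and> card S = s}" by auto
    show "(\<lambda>S k. if k \<in> S then Al else Sy) ` {S. S \<subseteq> {..<r} \<and> card S = s} \<subseteq> {i \<in> I2 r. card (aset r i) = s}"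
    proof clarify
      fix S assume "S \<subseteq> {..<r}" "s = card S"
      then show "(\<lambda>k. if k \<in> S then Al else Sy) \<in> I2 r \<and> card {k. k < r \<and> (if k \<in> S then Al else Sy) = Al} = card S"
        using assms S[of S] unfolding I2_def mem_Collect_eq by (simp add: subset_eq not_less[symmetric])
    qed
  qed
  then have "card {i \<in> I2 r. card (aset r i) = s} = card {S. S \<subseteq> {..<r} \<and> card S = s}" by (rule bij_betw_same_card)
  then show ?thesis by (simp add: n_subsets)
qed

text \<open>In Pascal's rule one summand is at least \<open>r\<close> by induction and the other is
  at least 1; the case \<open>s = r\<close> in the step is symmetry.\<close>

lemma binomial_ge_top:
  assumes "1 \<le> s" "s < r"
  shows "r \<le> r choose s"
  using assms
proof (induction r arbitrary: s)
  case (Suc r)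
  obtain s' where s: "s = Suc s'" using Suc.prems by (cases s) auto
  show ?case
  proof (cases "s < r")
    case True
    have "1 \<le> r choose s'" using True s by (simp add: Suc_leI)
    then show ?thesis using Suc.IH[of s] Suc.prems True s by simp
  next
    case False
    then have "s = r" using Suc.prems by simp
    then show ?thesis using binomial_symmetric[of r "Suc r"] by simp
  qed
qed simp

section \<open>Weights of the levels and the resulting quotients of the exterior square\<close>

context
  fixes t r :: nat
  assumes two: "(2::'a::{finite,field}) \<noteq> 0" and t: "t \<ge> 2"
begin

interpretation L: lie_setup t r 2 "{Sy, Al}" "thf :: kind \<Rightarrow> _ \<Rightarrow> 'a" "\<lambda>_. 2" Al "I2 r" "Bsf t 2"
  by (rule lie_setup2[OF two t])

lemma wt2:
  assumes "i \<in> I2 r"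
  shows "L.wt i = (t choose 2) ^ card (aset r i) * ((t + 1) choose 2) ^ (r - card (aset r i))"
proof -
  have "L.wt i = (\<Prod>k<r. if i k = Al then t choose 2 else (t + 1) choose 2)"
    unfolding L.wt_def using assms by (intro prod.cong refl) (auto simp: I2_def card_Bsf_Al card_Bsf_Sy2)
  also have "\<dots> = (t choose 2) ^ card ({..<r} \<inter> {k. i k = Al}) * ((t + 1) choose 2) ^ card ({..<r} \<inter> - {k. i k = Al})"
    by (simp add: prod.If_cases)
  also have "{..<r} \<inter> {k. i k = Al} = aset r i" by auto
  also have "{..<r} \<inter> - {k. i k = Al} = {..<r} - aset r i" by auto
  also have "card ({..<r} - aset r i) = r - card (aset r i)" by (subst card_Diff_subset) auto
  finally show ?thesis .
qed

lemma choose_pos: "t choose 2 \<ge> 1" "t choose 2 \<le> (t + 1) choose 2"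
  using t by (simp_all add: numeral_2_eq_2 Suc_leI)

lemma sum_level:
  assumes "odd s"
  shows "(\<Sum>i\<in>{i \<in> I2 r. card (aset r i) = s}. L.wt i) = (r choose s) * (t choose 2) ^ s * ((t + 1) choose 2) ^ (r - s)"
  using assms by (simp add: wt2 card_I2)

lemma closed_level:
  assumes "L.closed J" "J \<subseteq> I2 r" "i \<in> I2 r - J" "j \<in> I2 r" "card (aset r j) = card (aset r i)"
  shows "j \<notin> J"
proof
  assume "j \<in> J"
  obtain \<sigma> where "\<sigma> permutes {..<r}" "i = j \<circ> \<sigma>"
    using I2_transitive[of j r i] assms by blast
  then show False using assms \<open>j \<in> J\<close> by (auto simp: L.closed_def)
qed

lemma closed_levels: "L.closed {i \<in> I2 r. P (card (aset r i))}"
  unfolding L.closed_def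
proof (intro ballI allI impI)
  fix i \<sigma> assume "i \<in> {i \<in> I2 r. P (card (aset r i))}" "\<sigma> permutes {..<r}"
  then show "i \<circ> \<sigma> \<in> {i \<in> I2 r. P (card (aset r i))}"
    using L.I_closed[of i \<sigma>] card_Al_compose[of \<sigma> r i] by (simp del: comp_apply)
qed

text \<open>Trading a factor \<open>t choose 2\<close> for the larger
  \<open>(t + 1) choose 2\<close> only increases the product, so as many alternating columns as
  parity allows is best. For even \<open>r\<close> an odd \<open>s\<close> lies strictly between 0
  and \<open>r\<close>, where \<open>r choose s\<close> is at least \<open>r\<close>.\<close>

lemma level_bounds:
  assumes "odd s" "s \<le> r"
  shows "(if odd r then (t choose 2) ^ r else r * (t choose 2) ^ (r - 1) * ((t + 1) choose 2))
    \<le> (r choose s) * (t choose 2) ^ s * ((t + 1) choose 2) ^ (r - s)"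
proof -
  let ?a = "t choose 2" and ?b = "(t + 1) choose 2"
  show ?thesis
  proof (cases "odd r")
    case True
    have "?a ^ r = ?a ^ s * ?a ^ (r - s)" using assms by (simp add: power_add[symmetric])
    also have "\<dots> \<le> ?a ^ s * ?b ^ (r - s)" using choose_pos by (intro mult_left_mono power_mono) auto
    also have "\<dots> \<le> (r choose s) * (?a ^ s * ?b ^ (r - s))"
      using mult_le_mono1[of 1 "r choose s" "?a ^ s * ?b ^ (r - s)"] assms by (simp add: Suc_leI)
    finally show ?thesis using True by (simp add: mult.assoc)
  next
    case False
    then have s: "1 \<le> s" "s < r" using assms by (auto simp: order_le_less) (metis One_nat_def Suc_lessI odd_pos)
    have "?a ^ (r - 1) * ?b = ?a ^ s * (?a ^ (r - 1 - s) * ?b)" using s by (simp add: power_add[symmetric] mult.assoc[symmetric])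
    also have "\<dots> \<le> ?a ^ s * (?b ^ (r - 1 - s) * ?b)" using choose_pos by (intro mult_left_mono mult_right_mono power_mono) auto
    also have "?b ^ (r - 1 - s) * ?b = ?b ^ (r - s)" using s by (simp add: power_Suc2[symmetric] Suc_diff_Suc del: power_Suc)
    finally have "r * (?a ^ (r - 1) * ?b) \<le> (r choose s) * (?a ^ s * ?b ^ (r - s))"
      by (rule mult_le_mono[OF binomial_ge_top[OF s]])
    then show ?thesis using False by (simp add: mult.assoc)
  qed
qed

lemma card_aset_le: "card (aset r i) \<le> r"
  using card_mono[of "{..<r}" "aset r i"] by auto

lemma exterior_square_min_quot:
  assumes r: "r > 0"
  shows "min_quot_dim t r 2 TYPE('a)
     (if odd r then (t choose 2) ^ r else r * (t choose 2) ^ (r - 1) * ((t + 1) choose 2))" (is "min_quot_dim _ _ _ _ ?d")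
proof -
  \<comment> \<open>The largest odd number not exceeding \<open>r\<close>; the smallest quotient
    retains exactly this level.\<close>
  define s where "s = (if odd r then r else r - 1)"
  have s: "odd s" "s \<le> r" using r by (auto simp: s_def)
  let ?N = "{i \<in> I2 r. card (aset r i) = s}"
  have IN: "I2 r - (I2 r - ?N) = ?N" by auto
  have "(\<Sum>i\<in>?N. L.wt i) = ?d"
  proof (cases "odd r")
    case False
    then have "r choose (r - 1) = r" "r - (r - 1) = 1" using r binomial_symmetric[of 1 r] by auto
    then show ?thesis using False sum_level[OF s(1)] by (simp add: s_def)
  qed (use sum_level[OF s(1)] in \<open>simp add: s_def\<close>)
  then have d: "(\<Sum>i\<in>I2 r - (I2 r - ?N). L.wt i) = ?d" unfolding IN .
  show ?thesis
  proof (rule L.min_quot_dimI[OF _ _ d])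
    have "I2 r - ?N = {i \<in> I2 r. card (aset r i) \<noteq> s}" by auto
    then show "L.closed (I2 r - ?N)" using closed_levels[of "\<lambda>c. c \<noteq> s"] by simp
    show "0 < ?d" using t r by auto
    fix J assume J: "J \<subseteq> I2 r" "L.closed J" "J \<noteq> I2 r"
    then obtain i where i: "i \<in> I2 r - J" by auto
    let ?s = "card (aset r i)"
    have os: "odd ?s" using i by (simp add: I2_def)
    have "?d \<le> (r choose ?s) * (t choose 2) ^ ?s * ((t + 1) choose 2) ^ (r - ?s)"
      by (rule level_bounds[OF os card_aset_le])
    also have "\<dots> = (\<Sum>j\<in>{j \<in> I2 r. card (aset r j) = ?s}. L.wt j)" by (rule sum_level[OF os, symmetric])
    also have "\<dots> \<le> (\<Sum>j\<in>I2 r - J. L.wt j)"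
      using L.finite_I closed_level[OF J(2,1) i] by (intro sum_mono2) auto
    finally show "?d \<le> (\<Sum>j\<in>I2 r - J. L.wt j)" .
  qed auto
qed

lemma level_pos:
  assumes "odd s" "s \<le> r"
  shows "(\<Sum>i\<in>{i \<in> I2 r. card (aset r i) = s}. L.wt i) > 0"
  using sum_level[OF assms(1)] choose_pos t assms(2) by simp

lemma exterior_square_reducible:
  assumes r: "r > 2"
  shows "Hreducible t r 2 TYPE('a)"
proof (rule L.HreducibleI)
  \<comment> \<open>For \<open>r > 2\<close> the levels 1 and 3 are both present, which gives a
    proper nonzero submodule.\<close>
  let ?N = "{i \<in> I2 r. card (aset r i) = 1}"
  show "?N \<subseteq> I2 r" by auto
  show "L.closed ?N" by (rule closed_levels)
  show "(\<Sum>i\<in>?N. L.wt i) > 0" by (rule level_pos) (use r in auto)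
  have "0 < (\<Sum>i\<in>{i \<in> I2 r. card (aset r i) = 3}. L.wt i)" by (rule level_pos) (use r in auto)
  also have "\<dots> \<le> (\<Sum>i\<in>I2 r - ?N. L.wt i)" using L.finite_I by (intro sum_mono2) auto
  finally show "0 < (\<Sum>i\<in>I2 r - ?N. L.wt i)" .
qed

lemma exterior_square_irreducible:
  assumes r: "r = 2"
  shows "Hirred t r 2 TYPE('a)"
proof (rule L.HirredI)
  have one: "card (aset r i) = 1" if "i \<in> I2 r" for i
  proof -
    have "odd (card (aset r i))" "card (aset r i) \<le> 2" using that card_aset_le[of i] r by (auto simp: I2_def)
    then show ?thesis by presburger
  qed
  have "0 < (\<Sum>i\<in>{i \<in> I2 r. card (aset r i) = 1}. L.wt i)" by (rule level_pos) (use r in auto)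
  also have "{i \<in> I2 r. card (aset r i) = 1} = I2 r" using one by auto
  finally show "0 < (\<Sum>i\<in>I2 r. L.wt i)" .
  fix J assume J: "J \<subseteq> I2 r" "L.closed J"
  show "J = {} \<or> J = I2 r"
  proof (rule ccontr)
    assume "\<not> ?thesis"
    then obtain i j where "i \<in> I2 r - J" "j \<in> J" using J by auto
    then show False using closed_level[OF J(2,1), of i j] J(1) one by auto
  qed
qed

end

section \<open>Permutations of three letters\<close>

abbreviation "t12 \<equiv> transpose 1 (2::nat)"
abbreviation "t01 \<equiv> transpose 0 (1::nat)"
abbreviation "t02 \<equiv> transpose 0 (2::nat)"
abbreviation "cy \<equiv> t01 \<circ> t12"
abbreviation "cz \<equiv> t02 \<circ> t12"

lemma lessThan3: "{..<3::nat} = {0, 1, 2}" by auto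

lemma sum_permutes3:
  "(\<Sum>p\<in>Sn 3. F p) = F id + F t12 + F t01 + F cy + F t02 + F cz"
proof -
  have two: "{p. p permutes {1, 2::nat}} = {id, t12}" unfolding permutes_doubleton_iff by auto
  have ne: "t12 \<noteq> id" by (rule notI, drule fun_cong[of _ _ 1]) simp
  have "(\<Sum>p | p permutes insert 0 {1, 2}. F p) =
    (\<Sum>b\<in>insert 0 {1, 2}. \<Sum>q | q permutes {1, 2}. F (transpose 0 b \<circ> q))"
    by (rule sum_over_permutations_insert) auto
  also have "\<dots> = F id + F t12 + F t01 + F cy + F t02 + F cz"
    unfolding two using ne by (simp add: eq_commute add.assoc)
  finally show ?thesis unfolding lessThan3 .
qed

lemma permutes3:
  "t12 permutes {..<3}" "t01 permutes {..<3}" "t02 permutes {..<3}" "cy permutes {..<3}" "cz permutes {..<3}"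
proof -
  show 1: "t12 permutes {..<3}" "t01 permutes {..<3}" "t02 permutes {..<3}"
    by (auto intro: permutes_swap_id)
  show "cy permutes {..<3}" "cz permutes {..<3}" by (rule permutes_compose[OF 1(1)], rule 1)+
qed

lemma permutes3_cases:
  assumes "p permutes {..<3}"
  obtains "p = id" | "p = t12" | "p = t01" | "p = cy" | "p = t02" | "p = cz"
proof -
  have "p \<in> {id, t12, t01, cy, t02, cz}"
  proof (rule ccontr)
    assume "\<not> ?thesis"
    \<comment> \<open>The explicit six-term sum, evaluated on the indicator of \<open>p\<close>,
      shows that the list of permutations is complete.\<close>
    then have "(\<Sum>q\<in>Sn 3. if q = p then 1 else (0::nat)) = 0" unfolding sum_permutes3 by auto
    then show False using assms by (simp add: finite_permutations)
  qed
  then show ?thesis using that by auto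
qed

lemma permute_list3:
  "permute_list id [a, b, c] = [a, b, c]" "permute_list t12 [a, b, c] = [a, c, b]"
  "permute_list t01 [a, b, c] = [b, a, c]" "permute_list cy [a, b, c] = [b, c, a]"
  "permute_list t02 [a, b, c] = [c, b, a]" "permute_list cz [a, b, c] = [c, a, b]"
  by (simp_all add: permute_list_def transpose_def upt_rec numeral_2_eq_2)

lemma sgf3: "sgf id = 1" "sgf t12 = -1" "sgf t01 = -1" "sgf cy = 1" "sgf t02 = -1" "sgf cz = 1"
  using permutes3 by (simp_all add: sgf_transpose sgf_compose[where n = 3] del: One_nat_def)

lemma mmf3: "mmf id = 1" "mmf t12 = - (1 / 2)" "mmf t01 = - (1 / 2)" "mmf cy = - (1 / 2)" "mmf t02 = 1" "mmf cz = - (1 / 2)"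
  by (simp_all add: mmf_def transpose_def)

lemma compose3:
  "t12 \<circ> cy = t02" "t12 \<circ> cz = t01" "t12 \<circ> t02 = cy" "t01 \<circ> cy = t12" "t01 \<circ> cz = t02" "t01 \<circ> t02 = cz"
  "t02 \<circ> cy = t01" "t02 \<circ> cz = t12" "t02 \<circ> t02 = id" "cy \<circ> cy = cz" "cy \<circ> cz = id" "cy \<circ> t02 = t12"
  "cz \<circ> cy = id" "cz \<circ> cz = cy" "cz \<circ> t02 = t01" "cy \<circ> t12 = t01" "cy \<circ> t01 = t02" "cz \<circ> t12 = t02"
  "cz \<circ> t01 = t12"
  by (auto simp: fun_eq_iff transpose_def)

lemma inv3: "inv t02 = t02" "inv cy = cz" "inv cz = cy"
  by (rule inv_unique_comp; simp only: compose3)+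

text \<open>In a real model, let the symmetric group permute the unit vectors v_0, v_1, v_2 of an
  equilateral triangle, with mutual inner products -1/2. Then \<open>X s\<close> is the inner
  product of the image of v_a under \<open>s\<close> with v_b, and \<open>m\<close> is the case of
  v_1 twice. The sums express the absence of invariant and of sign-invariant vectors, and Schur
  orthogonality with factor 6/2. Giving \<open>w\<close> by an equation keeps the claims
  polynomial.\<close>

lemma half_coefficient_sums:
  fixes w :: "'a::field"
  assumes w: "2 * w = -1" and a: "a < 3" and b: "b < (3::nat)"
  defines "X \<equiv> \<lambda>s :: nat \<Rightarrow> nat. if s a = b then 1 else w" and "m \<equiv> \<lambda>s :: nat \<Rightarrow> nat. if s 1 = 1 then 1 else w"
  shows "(\<Sum>s\<in>Sn 3. X s) = 0"
    and "(\<Sum>s\<in>Sn 3. sgf s * X s) = 0"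
    and "(\<Sum>s\<in>Sn 3. m s * X s) = 3 * (if b = 1 then 1 else w) * (if a = 1 then 1 else w)"
proof -
  have ab: "a = 0 \<or> a = 1 \<or> a = 2" "b = 0 \<or> b = 1 \<or> b = 2" using a b by auto
  note s = sum_permutes3 sgf3 X_def m_def transpose_def
  show "(\<Sum>s\<in>Sn 3. X s) = 0"
    unfolding s using ab by (elim disjE) (simp_all, ((thin_tac "_ = (_::nat)")+, insert w, algebra)+)
  show "(\<Sum>s\<in>Sn 3. sgf s * X s) = 0"
    unfolding sum_permutes3 sgf3 X_def using ab by (elim disjE) (simp_all add: transpose_def)
  show "(\<Sum>s\<in>Sn 3. m s * X s) = 3 * (if b = 1 then 1 else w) * (if a = 1 then 1 else w)"
    unfolding s using ab by (elim disjE) (simp_all, ((thin_tac "_ = (_::nat)")+, insert w, algebra)+)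
qed

section \<open>Orthogonality and completeness on three letters\<close>

definition ka3 :: "kind \<Rightarrow> 'a::field" where
  "ka3 \<kappa> = (case \<kappa> of Sy \<Rightarrow> 6 | Al \<Rightarrow> 6 | Mp \<Rightarrow> 3 | Mm \<Rightarrow> 3)"

lemma ka3_simps [simp]: "ka3 Sy = 6" "ka3 Al = 6" "ka3 Mp = 3" "ka3 Mm = 3"
  by (simp_all add: ka3_def)

lemma not_id3: "t12 \<noteq> id" "t01 \<noteq> id" "cy \<noteq> id" "t02 \<noteq> id" "cz \<noteq> id"
proof -
  have "p \<noteq> id" if "p 0 \<noteq> 0 \<or> p 1 \<noteq> 1" for p :: "nat \<Rightarrow> nat" using that by auto
  then show "t12 \<noteq> id" "t01 \<noteq> id" "cy \<noteq> id" "t02 \<noteq> id" "cz \<noteq> id" by (simp_all add: transpose_def)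
qed

lemma kinds3_orth:
  assumes two: "(2::'a::{finite,field}) \<noteq> 0" and h: "h permutes {..<3}" and p: "p permutes {..<3}"
    and bl: "\<kappa> = \<mu> \<or> bl \<kappa> \<noteq> bl \<mu>"
  shows "(\<Sum>s\<in>Sn 3. thf \<kappa> s * thf \<mu> (h \<circ> s \<circ> p)) = (if \<kappa> = \<mu> then ka3 \<kappa> * thf \<kappa> h * (thf \<kappa> p :: 'a) else 0)" (is "?L = _")
proof -
  let ?w = "- (1 / 2) :: 'a"
  define N where "N = {s. s permutes {..<3::nat}}"
  \<comment> \<open>The product \<open>h \<circ> s \<circ> p\<close> fixes 1 exactly if
    \<open>s\<close> sends \<open>p 1\<close> to \<open>inv h 1\<close>, so translation on both
    sides only moves the pair of labels.\<close>
  define X :: "(nat \<Rightarrow> nat) \<Rightarrow> 'a" where "X s = (if s (p 1) = inv h 1 then 1 else ?w)" for s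
  define D :: 'a where "D = sgf h * sgf p"
  have w: "2 * ?w = -1" using two by simp
  have lt: "p 1 < 3" "inv h 1 < 3" using permutes_in_image[OF p, of 1] permutes_in_image[OF permutes_inv[OF h], of 1] by auto
  have sg: "sgf (h \<circ> s \<circ> p) = D * sgf s" if "s \<in> N" for s
    using that h p by (simp add: N_def D_def sgf_compose[where n = 3] permutes_compose mult_ac)
  have mX: "mmf (h \<circ> s \<circ> p) = X s" for s
    using permutes_inv_eq[OF h, of 1 "s (p 1)"] by (auto simp: mmf_def X_def)
  have mh: "(if inv h 1 = 1 then 1 else ?w) = mmf h"
    using permutes_inv_eq[OF h, of 1 1] by (simp add: mmf_def)
  have mp: "(if p 1 = 1 then 1 else ?w) = mmf p" by (simp add: mmf_def)
  have m_eq: "(if s 1 = 1 then 1 else ?w) = mmf s" for s :: "nat \<Rightarrow> nat" by (simp add: mmf_def)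
  have s6: "(\<Sum>s\<in>N. 1) = (6::'a)" and S0: "(\<Sum>s\<in>N. sgf s) = (0::'a)"
    unfolding N_def by (simp_all only: sum_permutes3 sgf3) simp_all
  have S1: "(\<Sum>s\<in>N. mmf s) = (0::'a)" and S2: "(\<Sum>s\<in>N. sgf s * mmf s) = (0::'a)"
    using half_coefficient_sums(1,2)[OF w, of 1 1] by (simp_all add: N_def mmf_def)
  have M1: "(\<Sum>s\<in>N. X s) = 0" and M2: "(\<Sum>s\<in>N. sgf s * X s) = 0"
    and M3: "(\<Sum>s\<in>N. mmf s * X s) = 3 * mmf h * mmf p"
    using half_coefficient_sums[OF w lt] unfolding X_def N_def mh mp by (simp_all only: m_eq)
  have F: "(\<Sum>s\<in>N. thf \<kappa> s * thf \<mu> (h \<circ> s \<circ> p)) = C * S"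
    if "sum Y N = S" "\<And>s. s \<in> N \<Longrightarrow> thf \<kappa> s * thf \<mu> (h \<circ> s \<circ> p) = C * Y s" for Y and C S :: 'a
    using that by (simp add: sum_distrib_left[symmetric] cong: sum.cong)
  note simps = sg mX D_def mult_ac
  have "(\<Sum>s\<in>N. thf \<kappa> s * thf \<mu> (h \<circ> s \<circ> p)) = (if \<kappa> = \<mu> then ka3 \<kappa> * thf \<kappa> h * (thf \<kappa> p :: 'a) else 0)"
  proof (cases \<kappa>)
    case Sy
    then show ?thesis using bl F[OF s6, of 1] F[OF S0, of D] F[OF M1, of 1] F[OF M2, of D]
      by (cases \<mu>) (simp_all add: simps)
  next
    case Al
    then show ?thesis using bl F[OF S0, of 1] F[OF s6, of D] F[OF M2, of 1] F[OF M1, of D]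
      by (cases \<mu>) (simp_all add: simps)
  next
    case Mp
    then show ?thesis using bl F[OF S1, of 1] F[OF S2, of D] F[OF M3, of 1]
      by (cases \<mu>) (simp_all add: simps)
  next
    case Mm
    then show ?thesis using bl F[OF S2, of 1] F[OF S1, of D] F[OF M3, of D]
      by (cases \<mu>) (simp_all add: simps)
  qed
  then show ?thesis by (simp add: N_def)
qed

lemma kinds3:
  assumes two: "(2::'a::{finite,field}) \<noteq> 0" and three: "(3::'a) \<noteq> 0"
  shows "kinds 3 {Sy, Al, Mp, Mm} (thf :: kind \<Rightarrow> _ \<Rightarrow> 'a) ka3"
proof
  have "(6::'a) = 2 * 3" by simp
  then have six: "(6::'a) \<noteq> 0" using two three by (metis mult_eq_0_iff)
  show "ka3 \<kappa> \<noteq> (0::'a)" if "\<kappa> \<in> {Sy, Al, Mp, Mm}" for \<kappa> using three six by (cases \<kappa>) auto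
  show "thf \<kappa> id = (1::'a)" for \<kappa> by (cases \<kappa>) (auto simp: mmf_def)
  show "thf \<kappa> (inv p) = (thf \<kappa> p :: 'a)" if "p permutes {..<3}" for \<kappa> p
    using permutes_inv_eq[OF that, of 1 1] by (cases \<kappa>) (auto simp: mmf_def sgf_inv[OF that])
  show "(\<Sum>s\<in>Sn 3. thf \<kappa> s * thf \<mu> (h \<circ> s \<circ> p)) = (if \<kappa> = \<mu> then ka3 \<kappa> * thf \<kappa> h * (thf \<kappa> p :: 'a) else 0)"
    if "\<kappa> = \<mu> \<or> bl \<kappa> \<noteq> bl \<mu>" "h permutes {..<3}" "p permutes {..<3}" for \<kappa> \<mu> h p
    by (rule kinds3_orth[OF two that(2,3,1)])
  show "(\<Sum>\<kappa>\<in>{Sy, Al, Mp, Mm}. thf \<kappa> p / ka3 \<kappa>) = (if p = id then 1 else (0::'a))" if p: "p permutes {..<3}" for p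
  proof -
    have e: "6 * (x / 3) = 2 * x" "6 * (x / 6) = x" for x :: 'a using three six by (simp_all add: field_simps)
    have "(\<Sum>\<kappa>\<in>{Sy, Al, Mp, Mm}. thf \<kappa> p / ka3 \<kappa>) = 1 / 6 + sgf p / 6 + mmf p / 3 + (sgf p * mmf p) / (3::'a)"
      by simp
    moreover have "6 * (1 / 6 + sgf p / 6 + mmf p / 3 + (sgf p * mmf p) / (3::'a)) = 1 + sgf p + 2 * mmf p + 2 * (sgf p * mmf p)"
      by (simp only: distrib_left e)
    ultimately have "6 * (\<Sum>\<kappa>\<in>{Sy, Al, Mp, Mm}. thf \<kappa> p / ka3 \<kappa>) = 1 + sgf p + 2 * mmf p + 2 * (sgf p * (mmf p :: 'a))" by (simp only:)
    \<comment> \<open>This is the regular character: \<open>mmf p + sgf p * mmf p\<close> is the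
      trace of the two-dimensional representation.\<close>
    also have "1 + sgf p + 2 * mmf p + 2 * (sgf p * mmf p) = (if p = id then 6 else (0::'a))"
      using two not_id3 by (rule_tac permutes3_cases[OF p]) (simp_all add: sgf3 mmf3 del: One_nat_def)
    finally have "6 * (\<Sum>\<kappa>\<in>{Sy, Al, Mp, Mm}. thf \<kappa> p / ka3 \<kappa>) = 6 * (if p = id then 1 else (0::'a))" by simp
    then show ?thesis using six by (simp only: mult_cancel_left simp_thms)
  qed
qed simp

text \<open>The scalar \<open>e\<close> is the sign under reversal of a word, so that both halves of
  the two-dimensional type are handled together.\<close>

definition Msign :: "kind \<Rightarrow> 'a::field \<Rightarrow> bool" where
  "Msign \<kappa> e \<longleftrightarrow> \<kappa> = Mp \<and> e = 1 \<or> \<kappa> = Mm \<and> e = -1"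

lemma sum_M:
  assumes "Msign \<kappa> e"
  shows "(\<Sum>p\<in>Sn 3. thf \<kappa> p * h (permute_list p [a, b, c])) =
    h [a, b, c] + e * h [c, b, a] - (1 / 2) * (e * h [a, c, b] + e * h [b, a, c] + h [b, c, a] + h [c, a, b])"
  using assms unfolding Msign_def sum_permutes3 permute_list3
  by (elim disjE conjE; simp only: thf_simps mmf3 sgf3) (simp_all add: algebra_simps)

text \<open>Comparing the eigenvalue equation at a word and at its reversal gives the reversal rule;
  substituting that rule back leaves the cyclic relation. The predicate \<open>S\<close> is a domain
  of words closed under adjacent exchanges, hence under all permutations.\<close>

lemma M_relations:
  fixes h :: "'w list \<Rightarrow> 'a::field"
  assumes e: "Msign \<kappa> e" and two: "(2::'a) \<noteq> 0" and three: "(3::'a) \<noteq> 0"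
    and S: "\<And>a b c. S a b c \<Longrightarrow> S b a c \<and> S a c b"
    and h: "\<And>a b c. S a b c \<Longrightarrow> (\<Sum>p\<in>Sn 3. thf \<kappa> p * h (permute_list p [a, b, c])) = 3 * h [a, b, c]"
    and abc: "S a b c"
  shows "h [a, b, c] = e * h [c, b, a]" "h [a, b, c] + h [b, c, a] + h [c, a, b] = 0"
proof -
  have ee: "e * (e * x) = x" for x using e by (auto simp: Msign_def)
  have rv: "h [a, b, c] = e * h [c, b, a]" if abc: "S a b c" for a b c
  proof -
    have cba: "S c b a" using S abc by blast
    have "e * (3 * h [c, b, a]) = 3 * h [a, b, c]"
      unfolding h[OF abc, symmetric] h[OF cba, symmetric] sum_M[OF e] by (simp add: algebra_simps ee)
    then have "3 * h [a, b, c] = 3 * (e * h [c, b, a])" by (simp only: mult.left_commute)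
    then show ?thesis using three by (simp only: mult_cancel_left simp_thms)
  qed
  show "h [a, b, c] = e * h [c, b, a]" by (rule rv[OF abc])
  define w :: 'a where "w = 1 / 2"
  have w: "w = 1 / 2" "2 * w = 1" using two by (simp_all add: w_def)
  have "3 * h [a, b, c] = h [a, b, c] + e * h [c, b, a] - w * (e * h [a, c, b] + e * h [b, a, c] + h [b, c, a] + h [c, a, b])"
    using h[OF abc] unfolding sum_M[OF e] w(1) by simp
  moreover have "h [c, b, a] = e * h [a, b, c]" "h [a, c, b] = e * h [b, c, a]" "h [b, a, c] = e * h [c, a, b]"
    using rv S abc by blast+
  ultimately have "3 * h [a, b, c] = h [a, b, c] + h [a, b, c] - w * (h [b, c, a] + h [c, a, b] + h [b, c, a] + h [c, a, b])"
    by (simp only: ee)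
  then show "h [a, b, c] + h [b, c, a] + h [c, a, b] = 0" using w(2) by algebra
qed

lemma M_relations_conv:
  fixes h :: "'w list \<Rightarrow> 'a::field"
  assumes e: "Msign \<kappa> e" and two: "(2::'a) \<noteq> 0" and rv: "\<And>a b c. h [a, b, c] = e * h [c, b, a]"
    and cyc: "\<And>a b c. h [a, b, c] + h [b, c, a] + h [c, a, b] = 0"
  shows "(\<Sum>p\<in>Sn 3. thf \<kappa> p * h (permute_list p [a, b, c])) = 3 * h [a, b, c]"
proof -
  have ee: "e * (e * x) = x" for x using e by (auto simp: Msign_def)
  define w :: 'a where "w = 1 / 2"
  have w: "w = 1 / 2" "2 * w = 1" using two by (simp_all add: w_def)
  show ?thesis unfolding sum_M[OF e] w(1)[symmetric] rv[of c b a] rv[of a c b] rv[of b a c] ee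
    using cyc[of a b c] w(2) by algebra
qed

lemma basisV3: "v \<in> basisV t 3 \<longleftrightarrow> (\<exists>a b c. v = [a, b, c] \<and> a < t \<and> b < t \<and> c < t)"
  by (auto simp: basisV_def numeral_3_eq_3 length_Suc_conv)

lemma Bsf_M: "Msign \<kappa> e \<Longrightarrow> [a, b, c] \<in> Bsf t 3 \<kappa> \<longleftrightarrow> a < c \<and> b \<le> c \<and> c < t"
  by (auto simp: Bsf_def basisV3 Msign_def)

text \<open>If first and last entries differ and one of them is the maximum, the word is a normal
  form or the reversal of one. If the middle entry is strictly largest, or the outer entries agree
  and exceed it, the cyclic relation reduces to these. For three equal entries that relation says
  three times the value is 0.\<close>

lemma M_determines:
  fixes h :: "nat list \<Rightarrow> 'a::field"
  assumes \<kappa>: "Msign \<kappa> e" and three: "(3::'a) \<noteq> 0"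
    and rv: "\<And>a b c. a < t \<Longrightarrow> b < t \<Longrightarrow> c < t \<Longrightarrow> h [a, b, c] = e * h [c, b, a]"
    and cyc: "\<And>a b c. a < t \<Longrightarrow> b < t \<Longrightarrow> c < t \<Longrightarrow> h [a, b, c] + h [b, c, a] + h [c, a, b] = 0"
    and z: "\<And>v. v \<in> Bsf t 3 \<kappa> \<Longrightarrow> h v = 0"
    and abc: "a < t" "b < t" "c < t"
  shows "h [a, b, c] = 0"
proof -
  have z1: "h [a, b, c] = 0" if "a < c" "b \<le> c" "c < t" for a b c
    by (rule z) (use that Bsf_M[OF \<kappa>] in blast)
  have z2: "h [a, b, c] = 0" if "c < a" "b \<le> a" "a < t" for a b c
    using rv[of a b c] z1[of c a b] that by simp
  consider "a < c" "b \<le> c" | "c < a" "b \<le> a" | "a < b" "c < b" | "a = c" "b < a" | "a = b" "b = c"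
    by linarith
  then show ?thesis
  proof cases
    case 3
    have "h [b, c, a] = 0" by (rule z2) (use 3 abc in auto)
    moreover have "h [c, a, b] = 0" by (rule z1) (use 3 abc in auto)
    ultimately show ?thesis using cyc[OF abc] by simp
  next
    case 4
    have "h [b, c, a] = 0" by (rule z1) (use 4 abc in auto)
    moreover have "h [c, a, b] = 0" by (rule z2) (use 4 abc in auto)
    ultimately show ?thesis using cyc[OF abc] by simp
  next
    case 5
    then have "3 * h [a, b, c] = 0" using cyc[OF abc] by simp
    then show ?thesis using three by simp
  qed (use z1 z2 abc in auto)
qed

lemma ind_rotate:
  "ind [x, y, z] [b, c, a] = ind [z, x, y] [a, b, c]" "ind [x, y, z] [c, a, b] = ind [y, z, x] [a, b, c]"
  "ind [x, y, z] [c, b, a] = ind [z, y, x] [a, b, c]"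
  by (auto simp: ind_def)

lemma M_dual:
  assumes e: "Msign \<kappa> (e::'a::field)" and two: "(2::'a) \<noteq> 0" and b: "[x, y, z] \<in> Bsf t 3 \<kappa>"
  shows "\<exists>h. (\<forall>v\<in>basisV t 3. (\<Sum>p\<in>Sn 3. thf \<kappa> p * h (permute_list p v)) = 3 * (h v :: 'a)) \<and>
        h [x, y, z] = 1 \<and> (\<forall>b'\<in>Bsf t 3 \<kappa> - {[x, y, z]}. h b' = 0)"
proof -
  have ee: "e * (e * x) = x" for x using e by (auto simp: Msign_def)
  have xyz: "x < z" "y \<le> z" using b Bsf_M[OF e] by blast+
  \<comment> \<open>Start from \<open>[x, y, z]\<close>, add the reversal with sign
    \<open>e\<close>, and subtract what makes cyclic sums vanish. No other word used is a normal
    form: its first entry is at least its last, or its middle entry exceeds its last. For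
    \<open>y = z\<close> the general formula would collapse, to 0 if \<open>e = 1\<close>, so
    another one is used.\<close>
  define h :: "nat list \<Rightarrow> 'a" where "h v = (if y = z then ind [x, z, z] v + e * ind [z, z, x] v - (1 + e) * ind [z, x, z] v
    else ind [x, y, z] v + e * ind [z, y, x] v - ind [y, z, x] v - e * ind [x, z, y] v)" for v
  have rv: "h [a, b, c] = e * h [c, b, a]" for a b c
    unfolding h_def ind_rotate(3)[of _ _ _ c b a] by (simp add: algebra_simps ee)
  have cyc: "h [a, b, c] + h [b, c, a] + h [c, a, b] = 0" for a b c
    unfolding h_def ind_rotate(1)[of _ _ _ b c a] ind_rotate(2)[of _ _ _ c a b] by (simp add: algebra_simps)
  have "(\<Sum>p\<in>Sn 3. thf \<kappa> p * h (permute_list p v)) = 3 * h v" if "v \<in> basisV t 3" for v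
    using that M_relations_conv[of \<kappa> e h, OF e two rv cyc] by (auto simp: basisV3)
  moreover have "h [x, y, z] = 1" using xyz by (auto simp: h_def ind_def)
  moreover have "h b' = 0" if b': "b' \<in> Bsf t 3 \<kappa> - {[x, y, z]}" for b'
  proof -
    obtain a b c where abc: "b' = [a, b, c]" using b' by (auto simp: Bsf_def basisV3)
    have "a < c" "b \<le> c" using b' Bsf_M[OF e] abc by blast+
    then show ?thesis using xyz b' abc by (auto simp: h_def ind_def)
  qed
  ultimately show ?thesis by blast
qed

section \<open>The third Lie power for two tensor factors\<close>

definition ij :: "kind \<Rightarrow> kind \<Rightarrow> nat \<Rightarrow> kind" where
  "ij \<kappa> \<mu> = (\<lambda>k. if k = 0 then \<kappa> else if k = 1 then \<mu> else Sy)"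

text \<open>In each pair the two reversal signs agree, as invariance of Lie elements under reversal
  demands. A one-dimensional kind together with the two-dimensional type leaves only one such half;
  for two columns of two-dimensional type \<open>ij Mp Mp\<close> is the representative.\<close>

definition I3 :: "(nat \<Rightarrow> kind) set" where
  "I3 = {ij Sy Mp, ij Mp Sy, ij Al Mm, ij Mm Al, ij Mp Mp}"

lemma ij_simps [simp]: "ij \<kappa> \<mu> 0 = \<kappa>" "ij \<kappa> \<mu> (Suc 0) = \<mu>"
  by (simp_all add: ij_def)

lemma ij_eq_iff [simp]: "ij \<kappa> \<mu> = ij \<kappa>' \<mu>' \<longleftrightarrow> \<kappa> = \<kappa>' \<and> \<mu> = \<mu>'"
  by (metis ij_simps)

lemma ij_swap: "ij \<kappa> \<mu> \<circ> transpose 0 1 = ij \<mu> \<kappa>"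
  by (auto simp: ij_def fun_eq_iff transpose_def)

lemma permutes_lessThan2: "\<sigma> permutes {..<2::nat} \<longleftrightarrow> \<sigma> = id \<or> \<sigma> = transpose 0 1"
  unfolding lessThan2 permutes_doubleton_iff ..

lemma prod_lessThan2: "(\<Prod>k<2::nat. F k) = F 0 * F 1"
  by (simp add: lessThan2)

lemma LiePow3_Mp:
  assumes two: "(2::'a::{finite,field}) \<noteq> 0" and three: "(3::'a) \<noteq> 0"
  shows "LiePow t r 3 = {x :: nat list list \<Rightarrow> 'a. x \<in> homog t r 3 \<and> kinds.dproj t r 3 thf ka3 Mp x = x}"
proof -
  interpret K: kinds t r 3 "{Sy, Al, Mp, Mm}" "thf :: kind \<Rightarrow> _ \<Rightarrow> 'a" ka3 by (rule kinds3[OF two three])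
  have Mp: "Msign Mp (1::'a)" by (simp add: Msign_def)
  have dp: "K.dproj Mp x [a, b, c] = (\<Sum>p\<in>Sn 3. thf Mp p * x (permute_list p [a, b, c])) / 3"
    if "[a, b, c] \<in> words t r 3" for x :: "nat list list \<Rightarrow> 'a" and a b c
    using that by (simp add: K.dproj_words sum_divide_distrib)
  have "(\<forall>a b c. x [a, b, c] = x [c, b, a]) \<and> (\<forall>a b c. x [a, b, c] + x [b, c, a] + x [c, a, b] = 0) \<longleftrightarrow> K.dproj Mp x = x"
    if x: "x \<in> homog t r 3" for x :: "nat list list \<Rightarrow> 'a"
  proof
    assume rel: "(\<forall>a b c. x [a, b, c] = x [c, b, a]) \<and> (\<forall>a b c. x [a, b, c] + x [b, c, a] + x [c, a, b] = 0)"
    show "K.dproj Mp x = x"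
    proof
      fix ws show "K.dproj Mp x ws = x ws"
      proof (cases "ws \<in> words t r 3")
        case True
        then obtain a b c where ws: "ws = [a, b, c]" by (auto simp: words3)
        have "(\<Sum>p\<in>Sn 3. thf Mp p * x (permute_list p [a, b, c])) = 3 * x [a, b, c]"
          by (rule M_relations_conv[OF Mp two]) (use rel in \<open>simp, blast\<close>)
        then show ?thesis using dp[OF True[unfolded ws], of x] three unfolding ws by simp
      next
        case False
        then show ?thesis using homogD[OF x] homogD[OF K.dproj_homog] by simp
      qed
    qed
  next
    assume eq: "K.dproj Mp x = x"
    let ?S = "\<lambda>a b c. [a, b, c] \<in> words t r 3"
    have S: "?S b a c \<and> ?S a c b" if "?S a b c" for a b c using that by (auto simp: words3)
    have h: "(\<Sum>p\<in>Sn 3. thf Mp p * x (permute_list p [a, b, c])) = 3 * x [a, b, c]" if "?S a b c" for a b c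
    proof -
      have "x [a, b, c] = (\<Sum>p\<in>Sn 3. thf Mp p * x (permute_list p [a, b, c])) / 3"
        using dp[OF that, of x] unfolding eq .
      then show ?thesis using three by (simp add: field_simps)
    qed
    have z: "x [a, b, c] = 0 \<and> x [c, b, a] = 0 \<and> x [b, c, a] = 0 \<and> x [c, a, b] = 0" if "\<not> ?S a b c" for a b c
    proof -
      have "\<not> ?S c b a" "\<not> ?S b c a" "\<not> ?S c a b" using that S by blast+
      then show ?thesis using that homogD[OF x] by blast
    qed
    have "x [a, b, c] = x [c, b, a] \<and> x [a, b, c] + x [b, c, a] + x [c, a, b] = 0" for a b c
      using z[of a b c] M_relations[where S = ?S and h = x, OF Mp two three S h] by (cases "?S a b c") auto
    then show "(\<forall>a b c. x [a, b, c] = x [c, b, a]) \<and> (\<forall>a b c. x [a, b, c] + x [b, c, a] + x [c, a, b] = 0)" by blast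
  qed
  then show ?thesis unfolding LiePow3[OF three] by blast
qed

text \<open>In the triangle model \<open>mmf\<close> is the coefficient at v_1 and
  \<open>thf Mm\<close> that at a unit vector orthogonal to it. The three rotations add to 0. The
  difference of the two nontrivial ones is a quarter turn times the square root of 3 up to sign, so
  both sides of the second identity are one and the same multiple of an off-diagonal coefficient;
  differences avoid a square root in the field.\<close>

lemma Mm_right_translates:
  assumes two: "(2::'a::field) \<noteq> 0" and p: "p permutes {..<3}"
  shows "thf Mm p + thf Mm (p \<circ> cy) + thf Mm (p \<circ> cz) = (0::'a)"
    and "thf Mm (p \<circ> cy) - thf Mm (p \<circ> cz) = mmf (cy \<circ> p) - (mmf (cz \<circ> p) :: 'a)"
proof -
  show "thf Mm p + thf Mm (p \<circ> cy) + thf Mm (p \<circ> cz) = (0::'a)"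
    by (rule permutes3_cases[OF p]; simp only: compose3 thf_simps sgf3 mmf3 id_comp comp_id) (use two in simp_all)
  show "thf Mm (p \<circ> cy) - thf Mm (p \<circ> cz) = mmf (cy \<circ> p) - (mmf (cz \<circ> p) :: 'a)"
    by (rule permutes3_cases[OF p]; simp only: compose3 thf_simps sgf3 mmf3 id_comp comp_id) simp_all
qed

lemma thf_t02:
  assumes p: "p permutes {..<3}"
  shows "thf \<kappa> (p \<circ> t02) = (if \<kappa> = Al \<or> \<kappa> = Mm then - thf \<kappa> p else (thf \<kappa> p :: 'a::field))"
  by (rule permutes3_cases[OF p]; cases \<kappa>; simp only: compose3 thf_simps sgf3 mmf3 id_comp comp_id) simp_all

lemma thf_cycle:
  assumes p: "p permutes {..<3}" and k: "\<kappa> = Sy \<or> \<kappa> = Al"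
  shows "thf \<kappa> (p \<circ> cy) = (thf \<kappa> p :: 'a::field)" "thf \<kappa> (p \<circ> cz) = (thf \<kappa> p :: 'a)"
  using k sgf_compose[OF p permutes3(4)] sgf_compose[OF p permutes3(5)] by (auto simp: sgf3 simp del: One_nat_def)

text \<open>If the reversal signs of the two kinds differ, reversal both fixes and negates the
  component. For \<open>Sy\<close> or \<open>Al\<close> twice, a cycle acts trivially on the
  component and the cyclic relation gives three times it. For \<open>Mm\<close> twice, the cyclic
  relation expresses it through translates of the vanishing component at
  \<open>ij Mp Mp\<close>.\<close>

lemma lie3_outside:
  fixes x :: "nat list list \<Rightarrow> 'a::{finite,field}"
  assumes two: "(2::'a) \<noteq> 0" and three: "(3::'a) \<noteq> 0"
    and x: "x \<in> LiePow t 2 3" and z: "kinds.proj t 2 3 thf ka3 (ij Mp Mp) x = 0"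
    and ks: "(\<kappa>, \<mu>) \<notin> {(Sy, Mp), (Mp, Sy), (Al, Mm), (Mm, Al), (Mp, Mp)}"
  shows "kinds.proj t 2 3 thf ka3 (ij \<kappa> \<mu>) x = 0"
proof -
  interpret K: kinds t 2 3 "{Sy, Al, Mp, Mm}" "thf :: kind \<Rightarrow> _ \<Rightarrow> 'a" ka3 by (rule kinds3[OF two three])
  have chi: "K.chi (ij \<alpha> \<beta>) \<pi> = thf \<alpha> (\<pi> 0) * thf \<beta> (\<pi> 1)" for \<alpha> \<beta> \<pi>
    by (simp add: K.chi_def prod_lessThan2)
  have xh: "x \<in> homog t 2 3" using x by (simp add: LiePow_def)
  have rv: "x [a, b, c] = x [c, b, a]" and cyc: "x [a, b, c] + x [b, c, a] + x [c, a, b] = 0" for a b c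
    using x unfolding LiePow3[OF three] by blast+
  let ?R = "\<lambda>p. Rop t 2 3 (diagG 2 p) x"
  have R0: "?R p ws = 0" if "ws \<notin> words t 2 3" for p ws using homogD[OF Rop_homog that] .
  have Rt: "?R t02 = x"
  proof
    fix ws show "?R t02 ws = x ws"
    proof (cases "ws \<in> words t 2 3")
      case True
      then obtain a b c where ws: "ws = [a, b, c]" by (auto simp: words3)
      show ?thesis using K.Rop_diag[OF True permutes3(3), of x] rv[of a b c] by (simp only: ws permute_list3)
    qed (use R0 homogD[OF xh] in simp)
  qed
  have Rc: "x + ?R cy + ?R cz = 0"
  proof
    fix ws show "(x + ?R cy + ?R cz) ws = 0 ws"
    proof (cases "ws \<in> words t 2 3")
      case True
      then obtain a b c where ws: "ws = [a, b, c]" by (auto simp: words3)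
      have "?R cy ws = x [b, c, a]" "?R cz ws = x [c, a, b]"
        using K.Rop_diag[OF True permutes3(4), of x] K.Rop_diag[OF True permutes3(5), of x] by (simp_all only: ws permute_list3)
      then show ?thesis using cyc[of a b c] ws by simp
    qed (use R0 homogD[OF xh] in simp)
  qed
  define y where "y \<pi> ws = Rop t 2 3 \<pi> x ws" for \<pi> ws
  have pr: "K.proj i x ws = (\<Sum>\<pi>\<in>PG 2 3. K.chi i \<pi> / K.Kc i * y \<pi> ws)" for i ws
    by (simp add: K.proj_def sum_fun_apply y_def)
  have prR: "K.proj (ij \<alpha> \<beta>) (?R q) ws = (\<Sum>\<pi>\<in>PG 2 3. thf \<alpha> (\<pi> 0 \<circ> inv q) * thf \<beta> (\<pi> 1 \<circ> inv q) / K.Kc (ij \<alpha> \<beta>) * y \<pi> ws)"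
    if "q permutes {..<3}" for \<alpha> \<beta> q ws
    by (simp add: K.proj_Rop[OF diagG_PG[OF that]] sum_fun_apply y_def chi) (simp add: mulG_def invG_def diagG_def)
  have per: "\<pi> k permutes {..<3}" if "\<pi> \<in> PG 2 3" for \<pi> k using that by (rule PG_perm)
  let ?j = "ij \<kappa> \<mu>"
  let ?s = "\<lambda>\<kappa>. \<kappa> = Al \<or> \<kappa> = Mm"
  consider "?s \<kappa> \<noteq> ?s \<mu>" | "\<kappa> = \<mu>" "\<kappa> = Sy \<or> \<kappa> = Al" | "\<kappa> = Mm" "\<mu> = Mm"
    using ks by (cases \<kappa>; cases \<mu>) auto
  then show ?thesis
  proof cases
    case 1
    show ?thesis
    proof
      fix ws
      have "K.proj ?j x ws = K.proj ?j (?R t02) ws" by (simp only: Rt)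
      also have "\<dots> = (\<Sum>\<pi>\<in>PG 2 3. - (K.chi ?j \<pi> / K.Kc ?j * y \<pi> ws))"
        unfolding prR[OF permutes3(3)] inv3
        using 1 by (intro sum.cong refl) (auto simp: thf_t02[OF per] chi)
      also have "\<dots> = - K.proj ?j x ws" by (simp add: pr sum_negf)
      finally show "K.proj ?j x ws = 0 ws" using neg_eq_self_imp_zero[OF two, of "K.proj ?j x ws"] by simp
    qed
  next
    case 2
    then have kk: "\<kappa> = Sy \<or> \<kappa> = Al" "\<mu> = Sy \<or> \<mu> = Al" by auto
    have e: "K.proj ?j (?R cy) ws = K.proj ?j x ws" "K.proj ?j (?R cz) ws = K.proj ?j x ws" for ws
      unfolding prR[OF permutes3(4)] prR[OF permutes3(5)] pr inv3
      by (simp_all only: thf_cycle[OF per kk(1)] thf_cycle[OF per kk(2)] chi cong: sum.cong)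
    show ?thesis
    proof
      fix ws
      have "K.proj ?j (x + ?R cy + ?R cz) ws = 0" by (simp only: Rc K.proj_zero zero_fun_apply)
      then have "3 * K.proj ?j x ws = 0" unfolding K.proj_add plus_fun_apply e by simp
      then show "K.proj ?j x ws = 0 ws" using three by simp
    qed
  next
    case 3
    have three_cancel: "a = 0" if "3 * a = 0" for a :: 'a using that three by simp
    have Kc: "K.Kc (ij Mm Mm) = 9" "K.Kc (ij Mp Mp) = 9" by (simp_all add: K.Kc_def prod_lessThan2)
    \<comment> \<open>Permuting the columns of the zero component independently shows that its
      translated coefficients also sum to zero.\<close>
    have Z: "(\<Sum>\<pi>\<in>PG 2 3. mmf (\<alpha> \<circ> \<pi> 0) * mmf (\<beta> \<circ> \<pi> 1) / 9 * y \<pi> ws) = 0"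
      if "\<alpha> permutes {..<3}" "\<beta> permutes {..<3}" for \<alpha> \<beta> ws
    proof -
      define \<rho> where "\<rho> = (\<lambda>k::nat. if k = 0 then inv \<alpha> else if k = 1 then inv \<beta> else id)"
      have \<rho>: "\<rho> \<in> PG 2 3" using that by (auto simp: PG_def \<rho>_def permutes_inv)
      have "0 = Rop t 2 3 \<rho> (K.proj (ij Mp Mp) x) ws" by (simp add: z Rop_def)
      also have "\<dots> = (\<Sum>\<pi>\<in>PG 2 3. K.chi (ij Mp Mp) (mulG (invG \<rho>) \<pi>) / 9 * y \<pi> ws)"
        unfolding K.Rop_proj[OF \<rho>] sum_fun_apply fscale_apply Kc y_def ..
      also have "\<dots> = (\<Sum>\<pi>\<in>PG 2 3. mmf (\<alpha> \<circ> \<pi> 0) * mmf (\<beta> \<circ> \<pi> 1) / 9 * y \<pi> ws)"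
        unfolding chi by (simp add: mulG_def invG_def \<rho>_def inv_inv_eq permutes_bij[OF that(1)] permutes_bij[OF that(2)])
      finally show ?thesis ..
    qed
    show ?thesis
    proof
      fix ws
      let ?m = "thf Mm :: _ \<Rightarrow> 'a"
      define d where "d = inverse (9::'a)"
      let ?S = "\<lambda>F. \<Sum>\<pi>\<in>PG 2 3. F (\<pi> 0) (\<pi> 1) / 9 * y \<pi> ws"
      have "K.proj ?j (x + ?R cy + ?R cz) ws = 0" by (simp only: Rc K.proj_zero zero_fun_apply)
      then have 0: "?S (\<lambda>p q. ?m p * ?m q) + ?S (\<lambda>p q. ?m (p \<circ> cz) * ?m (q \<circ> cz)) + ?S (\<lambda>p q. ?m (p \<circ> cy) * ?m (q \<circ> cy)) = 0"
        unfolding K.proj_add plus_fun_apply 3 prR[OF permutes3(4)] prR[OF permutes3(5)] pr inv3 chi Kc .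
      \<comment> \<open>If a0 + a1 + a2 = 0 and b0 + b1 + b2 = 0, then 2 (a0 b0 + a1 b1 + a2 b2) = 3
        a0 b0 + (a1 - a2) (b1 - b2). The differences are rewritten through \<open>mmf\<close> by
        \<open>Mm_right_translates\<close>.\<close>
      have "2 * (?S (\<lambda>p q. ?m p * ?m q) + ?S (\<lambda>p q. ?m (p \<circ> cz) * ?m (q \<circ> cz)) + ?S (\<lambda>p q. ?m (p \<circ> cy) * ?m (q \<circ> cy))) =
        3 * ?S (\<lambda>p q. ?m p * ?m q) + (?S (\<lambda>p q. mmf (cy \<circ> p) * mmf (cy \<circ> q)) - ?S (\<lambda>p q. mmf (cy \<circ> p) * mmf (cz \<circ> q))
           - ?S (\<lambda>p q. mmf (cz \<circ> p) * mmf (cy \<circ> q)) + ?S (\<lambda>p q. mmf (cz \<circ> p) * mmf (cz \<circ> q)))"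
        unfolding sum.distrib[symmetric] sum_distrib_left sum_subtractf[symmetric]
      proof (rule sum.cong[OF refl])
        fix \<pi> assume \<pi>: "\<pi> \<in> PG 2 3"
        note r = Mm_right_translates[OF two per[OF \<pi>]]
        show "2 * (?m (\<pi> 0) * ?m (\<pi> 1) / 9 * y \<pi> ws + ?m (\<pi> 0 \<circ> cz) * ?m (\<pi> 1 \<circ> cz) / 9 * y \<pi> ws + ?m (\<pi> 0 \<circ> cy) * ?m (\<pi> 1 \<circ> cy) / 9 * y \<pi> ws) =
          3 * (?m (\<pi> 0) * ?m (\<pi> 1) / 9 * y \<pi> ws) + (mmf (cy \<circ> \<pi> 0) * mmf (cy \<circ> \<pi> 1) / 9 * y \<pi> ws - mmf (cy \<circ> \<pi> 0) * mmf (cz \<circ> \<pi> 1) / 9 * y \<pi> ws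
            - mmf (cz \<circ> \<pi> 0) * mmf (cy \<circ> \<pi> 1) / 9 * y \<pi> ws + mmf (cz \<circ> \<pi> 0) * mmf (cz \<circ> \<pi> 1) / 9 * y \<pi> ws)"
          unfolding divide_inverse d_def[symmetric] using r(1)[of 0] r(2)[of 0] r(1)[of 1] r(2)[of 1] by algebra
      qed
      then have "3 * ?S (\<lambda>p q. ?m p * ?m q) = 0"
        unfolding 0 Z[OF permutes3(4) permutes3(4)] Z[OF permutes3(4) permutes3(5)] Z[OF permutes3(5) permutes3(4)] Z[OF permutes3(5) permutes3(5)] by simp
      then have "?S (\<lambda>p q. ?m p * ?m q) = 0" by (rule three_cancel)
      then show "K.proj ?j x ws = 0 ws" unfolding pr 3 chi Kc by simp
    qed
  qed
qed

lemma lie_setup3: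
  assumes two: "(2::'a::{finite,field}) \<noteq> 0" and three: "(3::'a) \<noteq> 0" and t: "t \<ge> 2"
  shows "lie_setup t 2 3 {Sy, Al, Mp, Mm} (thf :: kind \<Rightarrow> _ \<Rightarrow> 'a) ka3 Mp I3 (Bsf t 3)"
proof -
  interpret K: kinds t 2 3 "{Sy, Al, Mp, Mm}" "thf :: kind \<Rightarrow> _ \<Rightarrow> 'a" ka3 by (rule kinds3[OF two three])
  have "(6::'a) = 2 * 3" by simp
  then have six: "(6::'a) \<noteq> 0" using two three by (metis mult_eq_0_iff)
  have f3: "(of_nat (fact 3) :: 'a) = 6" by (simp add: fact_numeral)
  have idxI: "ij \<kappa> \<mu> \<in> K.idx" for \<kappa> \<mu>
  proof -
    have "\<kappa> \<in> {Sy, Al, Mp, Mm}" for \<kappa> by (cases \<kappa>) simp_all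
    then have "{Sy, Al, Mp, Mm} = UNIV" by blast
    then show ?thesis unfolding K.idx_def by (simp add: ij_def)
  qed
  have idxE: "j = ij (j 0) (j 1)" if "j \<in> K.idx" for j
    using that by (auto simp: K.idx_def ij_def fun_eq_iff)
  have pw: "(\<Sum>c\<in>(UNIV::'a set). c ^ k) = 0" if "k < 3" for k
  proof -
    \<comment> \<open>The multiplier 2 serves both positive exponents, since 2 - 1 = 1 and 4 - 1 = 3
      are nonzero.\<close>
    have "(2::'a) ^ 1 \<noteq> 1" by (metis add_cancel_right_right one_add_one power_one_right zero_neq_one)
    moreover have "(2::'a) ^ 2 \<noteq> 1"
    proof
      assume "(2::'a) ^ 2 = 1"
      then have "(4::'a) - 1 = 0" by simp
      then show False using three by simp
    qed
    ultimately have "(\<Sum>c\<in>(UNIV::'a set). c ^ 1) = 0" "(\<Sum>c\<in>(UNIV::'a set). c ^ 2) = 0"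
      using sum_power_field_zero[OF two] by blast+
    moreover have "k = 0 \<or> k = 1 \<or> k = 2" using that by linarith
    ultimately show ?thesis using sum_one_field_zero[where 'a = 'a] by fastforce
  qed
  define w :: 'a where "w = - (1 / 2)"
  have w: "2 * w = -1" using two by (simp add: w_def)
  have coef: "K.coef Mp (ij \<kappa> \<mu>) = (thf \<kappa> id * thf \<mu> id + w * (thf \<kappa> t12 * thf \<mu> t12) + w * (thf \<kappa> t01 * thf \<mu> t01)
      + w * (thf \<kappa> cy * thf \<mu> cy) + thf \<kappa> t02 * thf \<mu> t02 + w * (thf \<kappa> cz * thf \<mu> cz)) / 3" for \<kappa> \<mu>
    unfolding K.coef_def K.chi_def prod_lessThan2 sum_permutes3 diagG_def thf_simps(3) mmf3 w_def[symmetric] by simp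
  have coef_nz: "K.coef Mp i \<noteq> 0" if "i \<in> I3" for i
  proof -
    \<comment> \<open>The coefficient is 1 when one of the two kinds is one-dimensional and 1/2 for
      \<open>ij Mp Mp\<close>.\<close>
    have e1: "1 + w * w + w * w + w * w + 1 + w * w = 3" using w by algebra
    have e2: "2 * (1 + w * (w * w) + w * (w * w) + w * (w * w) + 1 + w * (w * w)) = 3" using w by algebra
    have "K.coef Mp i = (1 + w * w + w * w + w * w + 1 + w * w) / 3 \<or>
      K.coef Mp i = (1 + w * (w * w) + w * (w * w) + w * (w * w) + 1 + w * (w * w)) / 3"
      using that unfolding I3_def
      by (elim insertE emptyE; simp only: coef thf_simps sgf3 mmf3 w_def[symmetric]) simp_all
    then show ?thesis
    proof
      assume "K.coef Mp i = (1 + w * w + w * w + w * w + 1 + w * w) / 3"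
      then show ?thesis unfolding e1 using three by simp
    next
      assume c: "K.coef Mp i = (1 + w * (w * w) + w * (w * w) + w * (w * w) + 1 + w * (w * w)) / 3"
      have "2 * (K.coef Mp i * 3) = 3" unfolding e2[symmetric] c using three by simp
      then show ?thesis using three by auto
    qed
  qed
  let ?Bs = "\<lambda>\<kappa> h. \<forall>v\<in>basisV t 3. (\<Sum>p\<in>Sn 3. thf \<kappa> p * h (permute_list p v)) = ka3 \<kappa> * (h v :: 'a)"
  have kind_cases: "\<kappa> = Sy \<or> \<kappa> = Al \<or> (\<exists>e::'a. Msign \<kappa> e \<and> ka3 \<kappa> = (3::'a))" for \<kappa>
    by (cases \<kappa>) (auto simp: Msign_def)
  have determines: "h v = 0" if htyp: "?Bs \<kappa> h" and zero: "\<And>v. v \<in> Bsf t 3 \<kappa> \<Longrightarrow> h v = 0" and vb: "v \<in> basisV t 3" for \<kappa> h v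
    using kind_cases[of \<kappa>]
  proof (elim disjE exE conjE)
    assume "\<kappa> = Sy"
    then show ?thesis using htyp zero vb six by (intro Sy_determines[of 3 t h v, unfolded f3]) auto
  next
    assume "\<kappa> = Al"
    then show ?thesis using htyp zero vb six two by (intro Al_determines[of 3 t h v, unfolded f3]) auto
  next
    fix e :: 'a assume e: "Msign \<kappa> e" "ka3 \<kappa> = (3::'a)"
    let ?S = "\<lambda>a b c. a < t \<and> b < t \<and> c < (t::nat)"
    have S: "?S b a c \<and> ?S a c b" if "?S a b c" for a b c using that by auto
    have h: "(\<Sum>p\<in>Sn 3. thf \<kappa> p * h (permute_list p [a, b, c])) = 3 * h [a, b, c]" if "?S a b c" for a b c
      using htyp that e(2) by (auto simp: basisV3)
    note rel = M_relations[where S = ?S and h = h, OF e(1) two three S h]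
    obtain a b c where v: "v = [a, b, c]" "a < t" "b < t" "c < t" using vb by (auto simp: basisV3)
    show ?thesis unfolding v(1)
      by (rule M_determines[where h = h and \<kappa> = \<kappa> and t = t, OF e(1) three _ _ zero v(2-4)]) (use rel in blast)+
  qed
  have dual: "\<exists>h. ?Bs \<kappa> h \<and> h b = 1 \<and> (\<forall>b'\<in>Bsf t 3 \<kappa> - {b}. h b' = 0)" if b: "b \<in> Bsf t 3 \<kappa>" for \<kappa> b
    using kind_cases[of \<kappa>]
  proof (elim disjE exE conjE)
    assume "\<kappa> = Sy"
    then show ?thesis using Sy_dual[of b t 3, where 'a = 'a] b unfolding f3 by simp
  next
    assume "\<kappa> = Al"
    then show ?thesis using Al_dual[of b t 3, where 'a = 'a] b unfolding f3 by simp
  next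
    fix e :: 'a assume e: "Msign \<kappa> e" "ka3 \<kappa> = (3::'a)"
    obtain x y z where "b = [x, y, z]" using b by (auto simp: Bsf_def basisV3)
    then show ?thesis using M_dual[OF e(1) two, of x y z t] b e(2) by simp
  qed
  show ?thesis
  proof unfold_locales
    show "I3 \<subseteq> K.idx" using idxI by (auto simp: I3_def)
    show "K.sep i j" if "i \<in> I3" "j \<in> I3" for i j
    proof -
      have "K.sep i j" if "bl (i 0) \<noteq> bl (j 0) \<or> bl (i 1) \<noteq> bl (j 1) \<or> i = j"
        unfolding K.sep_def
      proof (cases "bl (i 0) = bl (j 0)")
        case True
        then show "i = j \<or> (\<exists>k<2. bl (i k) \<noteq> bl (j k))" using that by (intro disjCI exI[of _ 1]) auto
      qed (auto intro: exI[of _ 0])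
      then show ?thesis using that unfolding I3_def by (elim insertE emptyE) simp_all
    qed
    show "i \<circ> \<sigma> \<in> I3" if "i \<in> I3" "\<sigma> permutes {..<2}" for i \<sigma>
      using that unfolding permutes_lessThan2 I3_def by (auto simp: ij_swap simp del: One_nat_def)
    show "K.proj j x = 0" if x: "x \<in> LiePow t 2 3" "\<And>i. i \<in> I3 \<Longrightarrow> K.proj i x = 0" and j: "j \<in> K.idx - I3" for x j
    proof -
      have je: "j = ij (j 0) (j 1)" using j idxE by blast
      have "(j 0, j 1) \<notin> {(Sy, Mp), (Mp, Sy), (Al, Mm), (Mm, Al), (Mp, Mp)}"
        using j je unfolding I3_def by auto
      moreover have "K.proj (ij Mp Mp) x = 0" by (rule x(2)) (simp add: I3_def)
      ultimately have "K.proj (ij (j 0) (j 1)) x = 0" using lie3_outside[OF two three x(1)] by blast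
      then show ?thesis using je by simp
    qed
    show "LiePow t 2 3 = {x \<in> homog t 2 3. K.dproj Mp x = x}" using LiePow3_Mp[OF two three] by simp
    show "Bsf t 3 \<kappa> \<subseteq> basisV t 3" for \<kappa> by (auto simp: Bsf_def)
    show "h v = 0" if "\<kappa> \<in> {Sy, Al, Mp, Mm}"
      "\<And>v. v \<in> basisV t 3 \<Longrightarrow> (\<Sum>p\<in>Sn 3. thf \<kappa> p * h (permute_list p v)) = ka3 \<kappa> * (h v :: 'a)"
      "\<And>v. v \<in> Bsf t 3 \<kappa> \<Longrightarrow> h v = 0" "v \<in> basisV t 3" for \<kappa> h v
      using determines[of \<kappa> h v] that(2-) by blast
  qed (use t pw coef_nz dual in auto)
qed

section \<open>Counting normal forms and the quotients of the third Lie power\<close>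

lemma card_Bsf_M:
  assumes \<kappa>: "Msign \<kappa> e"
  shows "3 * card (Bsf t 3 \<kappa>) = (t - 1) * t * (t + 1)"
proof -
  have "Bsf t 3 \<kappa> = (\<lambda>(c, a, b). [a, b, c]) ` Sigma {..<t} (\<lambda>c. {..<c} \<times> {..c})"
  proof (intro equalityI subsetI)
    fix v assume v: "v \<in> Bsf t 3 \<kappa>"
    then obtain a b c where abc: "v = [a, b, c]" by (auto simp: Bsf_def basisV3)
    then have "a < c" "b \<le> c" "c < t" using v Bsf_M[OF \<kappa>] by blast+
    then show "v \<in> (\<lambda>(c, a, b). [a, b, c]) ` Sigma {..<t} (\<lambda>c. {..<c} \<times> {..c})"
      by (auto simp: abc intro!: image_eqI[of _ _ "(c, a, b)"])
  qed (use Bsf_M[OF \<kappa>] in auto)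
  then have "card (Bsf t 3 \<kappa>) = card (Sigma {..<t} (\<lambda>c. {..<c} \<times> {..c}))"
    by (simp add: card_image inj_on_def split_beta)
  \<comment> \<open>With the last entry \<open>c\<close> fixed there are \<open>c\<close> choices
    for the first entry and \<open>c + 1\<close> for the middle one.\<close>
  also have "\<dots> = (\<Sum>c<t. c * (c + 1))" by (simp add: card_SigmaI card_cartesian_product)
  finally have "card (Bsf t 3 \<kappa>) = (\<Sum>c<t. c * (c + 1))" .
  moreover have "3 * (\<Sum>c<t. c * (c + 1)) = (t - 1) * t * (t + 1)"
  proof (induction t)
    case (Suc t)
    then show ?case by (cases t) (simp_all add: algebra_simps)
  qed simp
  ultimately show ?thesis by simp
qed

lemma six_choose_three: "6 * (t choose 3) = t * (t - 1) * (t - 2)"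
proof (induction t)
  case (Suc t)
  have "even (t * (t - 1))" by (cases t) auto
  then have "2 * (t choose 2) = t * (t - 1)" by (simp add: choose_two)
  moreover have "Suc t choose 3 = (t choose 2) + (t choose 3)" by (simp add: numeral_3_eq_3 numeral_2_eq_2)
  ultimately have "6 * (Suc t choose 3) = 3 * (t * (t - 1)) + t * (t - 1) * (t - 2)" using Suc by simp
  also have "\<dots> = Suc t * (Suc t - 1) * (Suc t - 2)"
  proof (cases t)
    case (Suc s)
    then show ?thesis by (cases s) (simp_all add: algebra_simps)
  qed simp
  finally show ?case .
qed (simp add: numeral_3_eq_3)

context
  fixes t :: nat
  assumes two: "(2::'a::{finite,field}) \<noteq> 0" and three: "(3::'a) \<noteq> 0" and t: "t \<ge> 2"
begin

interpretation L: lie_setup t 2 3 "{Sy, Al, Mp, Mm}" "thf :: kind \<Rightarrow> _ \<Rightarrow> 'a" ka3 Mp I3 "Bsf t 3"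
  by (rule lie_setup3[OF two three t])

abbreviation "cS \<equiv> card (Bsf t 3 Sy)"
abbreviation "cA \<equiv> card (Bsf t 3 Al)"
abbreviation "cM \<equiv> card (Bsf t 3 Mp)"

lemma Mp: "Msign Mp 1"
  by (simp add: Msign_def)

lemma cM_Mm: "card (Bsf t 3 Mm) = cM"
  by (simp add: Bsf_def)

lemma wt3: "L.wt (ij \<kappa> \<mu>) = card (Bsf t 3 \<kappa>) * card (Bsf t 3 \<mu>)"
  by (simp add: L.wt_def prod_lessThan2)

text \<open>These compare the three orbit weights \<open>2 * (cS * cM)\<close>,
  \<open>2 * (cA * cM)\<close> and \<open>cM * cM\<close>. The second bound is
  \<open>t - 2 \<le> t + 1\<close> after cancelling the common factors in
  \<open>six_choose_three\<close> and \<open>card_Bsf_M\<close>.\<close>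

lemma card_bounds: "cA \<le> cS" "2 * cA \<le> cM" "0 < cM" "0 < cS"
proof -
  have fin: "finite (Bsf t 3 Sy)" by (rule finite_subset[OF _ finite_basisV[of t 3]]) (auto simp: Bsf_def)
  show "cA \<le> cS" using fin by (rule card_mono) (auto simp: Bsf_def)
  have 3: "3 * cM = (t - 1) * t * (t + 1)" by (rule card_Bsf_M[OF Mp])
  have "3 * (2 * cA) = (t - 1) * t * (t - 2)" using six_choose_three[of t] by (simp add: card_Bsf_Al mult_ac)
  also have "\<dots> \<le> 3 * cM" unfolding 3 by (intro mult_le_mono2) simp
  finally show "2 * cA \<le> cM" by simp
  show "0 < cM" using 3 t by (cases "cM = 0") auto
  have "[0, 0, 0] \<in> Bsf t 3 Sy" using t by (auto simp: Bsf_def basisV_def)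
  then show "0 < cS" using fin card_gt_0_iff by blast
qed

lemma closed3_swap: "L.closed J \<Longrightarrow> ij \<kappa> \<mu> \<in> J \<Longrightarrow> ij \<mu> \<kappa> \<in> J"
  unfolding L.closed_def using ij_swap[of \<kappa> \<mu>] permutes_lessThan2[of "transpose 0 1"] by metis

lemma closed3I: "(\<And>\<kappa> \<mu>. ij \<kappa> \<mu> \<in> J \<Longrightarrow> ij \<mu> \<kappa> \<in> J) \<Longrightarrow> J \<subseteq> I3 \<Longrightarrow> L.closed J"
proof -
  assume J: "\<And>\<kappa> \<mu>. ij \<kappa> \<mu> \<in> J \<Longrightarrow> ij \<mu> \<kappa> \<in> J" "J \<subseteq> I3"
  have "\<exists>\<kappa> \<mu>. i = ij \<kappa> \<mu>" if "i \<in> J" for i using that J(2) by (auto simp: I3_def)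
  then show ?thesis unfolding L.closed_def permutes_lessThan2 using J(1) ij_swap by (metis comp_id)
qed

text \<open>The complement of a closed set contains a full orbit of positive weight, and the
  exchange of the two columns has three orbits on \<open>I3\<close>. Positivity is recorded for the
  alternating orbit because \<open>cA = 0\<close> when \<open>t = 2\<close>.\<close>

lemma missing_weight:
  assumes J: "J \<subseteq> I3" "L.closed J" and pos: "(\<Sum>i\<in>I3 - J. L.wt i) > 0"
  shows "2 * (cS * cM) \<le> (\<Sum>i\<in>I3 - J. L.wt i) \<or> (2 * (cA * cM) \<le> (\<Sum>i\<in>I3 - J. L.wt i) \<and> cA * cM > 0) \<or>
    cM * cM \<le> (\<Sum>i\<in>I3 - J. L.wt i)"
proof -
  have fin: "finite (I3 - J)" using L.finite_I by simp
  obtain i where i: "i \<in> I3 - J" "L.wt i > 0" using pos fin by (metis gr_zeroI sum.neutral less_irrefl)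
  have two_terms: "L.wt (ij \<kappa> \<mu>) + L.wt (ij \<mu> \<kappa>) \<le> (\<Sum>i\<in>I3 - J. L.wt i)"
    if "ij \<kappa> \<mu> \<in> I3 - J" "ij \<mu> \<kappa> \<in> I3" "\<kappa> \<noteq> \<mu>" for \<kappa> \<mu>
  proof -
    have "ij \<mu> \<kappa> \<in> I3 - J" using that closed3_swap[OF J(2)] by blast
    then have "(\<Sum>i\<in>{ij \<kappa> \<mu>, ij \<mu> \<kappa>}. L.wt i) \<le> (\<Sum>i\<in>I3 - J. L.wt i)"
      using that fin by (intro sum_mono2) auto
    then show ?thesis using that(3) by simp
  qed
  consider "i = ij Sy Mp" | "i = ij Mp Sy" | "i = ij Al Mm" | "i = ij Mm Al" | "i = ij Mp Mp"
    using i unfolding I3_def by blast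
  then show ?thesis
  proof cases
    case 1
    then show ?thesis using two_terms[of Sy Mp] i by (simp add: wt3 I3_def mult_ac)
  next
    case 2
    then show ?thesis using two_terms[of Mp Sy] i by (simp add: wt3 I3_def mult_ac)
  next
    case 3
    then show ?thesis using two_terms[of Al Mm] i by (simp add: wt3 I3_def mult_ac cM_Mm)
  next
    case 4
    then show ?thesis using two_terms[of Mm Al] i by (simp add: wt3 I3_def mult_ac cM_Mm)
  next
    case 5
    have "L.wt i \<le> (\<Sum>i\<in>I3 - J. L.wt i)" using i fin by (intro member_le_sum) auto
    then show ?thesis using 5 by (simp add: wt3)
  qed
qed

lemma third_power_reducible: "Hreducible t 2 3 TYPE('a)"
proof (rule L.HreducibleI)
  show "{ij Mp Mp} \<subseteq> I3" by (simp add: I3_def)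
  show "L.closed {ij Mp Mp}" by (rule closed3I) (auto simp: I3_def)
  show "0 < (\<Sum>i\<in>{ij Mp Mp}. L.wt i)" using card_bounds by (simp add: wt3)
  have "0 < L.wt (ij Sy Mp)" using card_bounds by (simp add: wt3)
  also have "\<dots> \<le> (\<Sum>i\<in>I3 - {ij Mp Mp}. L.wt i)"
    using L.finite_I by (intro member_le_sum) (auto simp: I3_def)
  finally show "0 < (\<Sum>i\<in>I3 - {ij Mp Mp}. L.wt i)" .
qed

text \<open>For \<open>t > 2\<close> the smallest orbit is the one with an alternating column, of
  weight \<open>2 * (cA * cM)\<close>; the two counting formulas turn nine times this into the
  stated product, so the division is exact. For \<open>t = 2\<close> that orbit is zero, and the
  minimum is \<open>cM * cM\<close> with \<open>cM = 2\<close>.\<close>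

lemma third_power_min_quot:
  "min_quot_dim t 2 3 TYPE('a) (if t = 2 then 4 else (t + 1) * t ^ 2 * (t - 1) ^ 2 * (t - 2) div 9)"
proof (cases "t = 2")
  case True
  have M: "cM = 2" using card_Bsf_M[OF Mp, of t] True by simp
  have A: "cA = 0" by (simp add: card_Bsf_Al True)
  have d: "(\<Sum>i\<in>I3 - (I3 - {ij Mp Mp}). L.wt i) = 4"
  proof -
    have "I3 - (I3 - {ij Mp Mp}) = {ij Mp Mp}" by (auto simp: I3_def)
    then show ?thesis by (simp add: wt3 M)
  qed
  have "min_quot_dim t 2 3 TYPE('a) 4"
  proof (rule L.min_quot_dimI[OF _ _ d])
    show "L.closed (I3 - {ij Mp Mp})" by (rule closed3I) (auto simp: I3_def)
    fix J assume "J \<subseteq> I3" "L.closed J" "0 < (\<Sum>i\<in>I3 - J. L.wt i)"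
    from missing_weight[OF this] show "4 \<le> (\<Sum>i\<in>I3 - J. L.wt i)"
      using card_bounds(4) by (auto simp: M A)
  qed auto
  then show ?thesis using True by simp
next
  case False
  then have t3: "t \<ge> 3" using t by simp
  have A: "cA > 0" using t3 by (simp add: card_Bsf_Al)
  have d: "(\<Sum>i\<in>I3 - (I3 - {ij Al Mm, ij Mm Al}). L.wt i) = 2 * (cA * cM)"
  proof -
    have "I3 - (I3 - {ij Al Mm, ij Mm Al}) = {ij Al Mm, ij Mm Al}" by (auto simp: I3_def)
    then show ?thesis by (simp add: wt3 cM_Mm mult_ac)
  qed
  have "min_quot_dim t 2 3 TYPE('a) (2 * (cA * cM))"
  proof (rule L.min_quot_dimI[OF _ _ d])
    show "L.closed (I3 - {ij Al Mm, ij Mm Al})" by (rule closed3I) (auto simp: I3_def)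
    show "0 < 2 * (cA * cM)" using A card_bounds by simp
    fix J assume J: "J \<subseteq> I3" "L.closed J" "0 < (\<Sum>i\<in>I3 - J. L.wt i)"
    have "2 * (cA * cM) \<le> 2 * (cS * cM)" using card_bounds(1) by simp
    moreover have "2 * (cA * cM) \<le> cM * cM" using mult_le_mono1[OF card_bounds(2), of cM] by simp
    ultimately show "2 * (cA * cM) \<le> (\<Sum>i\<in>I3 - J. L.wt i)" using missing_weight[OF J] by linarith
  qed auto
  moreover have eq: "9 * (2 * (cA * cM)) = (t + 1) * t ^ 2 * (t - 1) ^ 2 * (t - 2)"
  proof -
    have "9 * (2 * (cA * cM)) = (6 * cA) * (3 * cM)" by simp
    also have "\<dots> = (t * (t - 1) * (t - 2)) * ((t - 1) * t * (t + 1))"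
      unfolding card_Bsf_Al six_choose_three card_Bsf_M[OF Mp] ..
    finally show ?thesis by (simp only: power2_eq_square mult_ac)
  qed
  moreover have "(t + 1) * t ^ 2 * (t - 1) ^ 2 * (t - 2) div 9 = 2 * (cA * cM)"
    unfolding eq[symmetric] by (rule nonzero_mult_div_cancel_left) simp
  ultimately show ?thesis using False by (simp only: if_False)
qed

end

theorem mainTheorem14:
  fixes t r :: nat
  assumes "CHAR('a::{finite,field}) > 2" and "r \<ge> 2" and "t \<ge> 2"
  shows "(r > 2 \<longrightarrow>
            Hreducible t r 2 TYPE('a) \<and>
            min_quot_dim t r 2 TYPE('a)
              (if odd r then (t choose 2) ^ r else r * (t choose 2) ^ (r - 1) * ((t + 1) choose 2)))
       \<and> (CHAR('a) > 3 \<and> r = 2 \<longrightarrow>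
            Hirred t r 2 TYPE('a) \<and> Hreducible t r 3 TYPE('a) \<and>
            min_quot_dim t r 3 TYPE('a)
              (if t = 2 then 4 else (t + 1) * t ^ 2 * (t - 1) ^ 2 * (t - 2) div 9))"
proof -
  have small: "(of_nat k :: 'a) \<noteq> 0" if "0 < k" "k < CHAR('a)" for k
    using that by (simp add: of_nat_eq_0_iff_char_dvd nat_dvd_not_less)
  have two: "(2::'a) \<noteq> 0" using small[of 2] assms(1) by simp
  have three: "(3::'a) \<noteq> 0" if "CHAR('a) > 3" using small[of 3] that by simp
  show ?thesis
    using exterior_square_reducible[OF two assms(3), of r] exterior_square_min_quot[OF two assms(3), of r]
      exterior_square_irreducible[OF two assms(3), of r]
      third_power_reducible[OF two three assms(3)] third_power_min_quot[OF two three assms(3)]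
    by auto
qed

end
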